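(* Let $0<L,W<\infty$, $\tau=iW/L$, $\Lambda=[0,L)\times i[0,W)$, $N\in\mathbb{N}$. Consider the one-component plasma of $N$ particles of charge $+1$ in $\Lambda$ with two-point potential $\Phi^\sharp$, $\sharp\in\{-,\pm\}$, uniform background with $N^-$ negative charges, at inverse temperature $\beta$ (Boltzmann weight $Q^\sharp_{\mathrm{plasma}}(\mathbf{z};N,N^-,\beta)$ as defined below). Then in each of the following three cases the $N$-particle configuration in $\Lambda$, distributed with probability density on $\Lambda^N$ proportional to the indicated weight, is a determinantal point process whose correlation kernel is the kernel $K^{R_N}$ defined below: (1) $\sharp=-$, $N^-=N$, $\beta=2$, weight $\widehat Q^-_{\mathrm{plasma}}(\mathbf{z})=|\vartheta_{\tilde s(N)}(\sum_{k=1}^N(z_k/L-(L+iW)/(2L));\tau)|^2Q^-_{\mathrm{plasma}}(\mathbf{z};N,N,2)$, with $\tilde s(N)=0$ for $N$ even and $1$ for $N$ odd; kernel $K^{A_{N-1}}$; the system is neutral ($N-N^-=0$); (2) $\sharp=\pm$, $N^-=N+1$, $\beta=2$, weight $Q^\pm_{\mathrm{plasma}}(\mathbf{z};N,N+1,2)$; kernel $K^{C_N}$; total charge $N-N^-=-1$; (3) $\sharp=\pm$, $N^-=N-1$ (with $N\ge2$), $\beta=2$, weight $Q^\pm_{\mathrm{plasma}}(\mathbf{z};N,N-1,2)$; kernel $K^{D_N}$; total charge $N-N^-=+1$.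
   Context: Theta functions ($\Im\tau>0$, $q_0=e^{\pi i\tau}$): $\vartheta_0(v;\tau)=\sum_{n\in\mathbb{Z}}(-1)^nq_0^{n^2}e^{2\pi inv}$, $\vartheta_1(v;\tau)=i\sum_n(-1)^nq_0^{(n-1/2)^2}e^{(2n-1)\pi iv}$, $\vartheta_2(v;\tau)=\sum_nq_0^{(n-1/2)^2}e^{(2n-1)\pi iv}$, $\vartheta_3(v;\tau)=\sum_nq_0^{n^2}e^{2\pi inv}$; $\eta(\tau)=e^{\pi i\tau/12}\prod_{n\ge1}(1-e^{2\pi in\tau})$. Potentials for $z,z'\in\Lambda$: $\Phi^-(z,z')=-\log|\vartheta_1((z-z')/L;\tau)|+3\log\eta(\tau)+\log(2\pi/L)$; $\Phi^\pm(z,z')=-\log|\vartheta_1((z+z')/L;\tau)|-\log|\vartheta_1((z-z')/L;\tau)|+3\log\eta(\tau)+\log(2\pi/L)+\frac12\{\log|\vartheta_1(2z/L;\tau)|+\log|\vartheta_1(2z'/L;\tau)|\}$. Energies: $E^\sharp_{\mathrm{pp}}(\mathbf{z})=\sum_{1\le j<k\le N}\Phi^\sharp(z_k,z_j)$; $V^\sharp(z)=-\frac{N^-}{LW}\int_0^Ldx'\int_0^Wdy'\,\Phi^\sharp(z,x'+iy')$; $E^\sharp_{\mathrm{pb}}(\mathbf{z})=\sum_{j=1}^NV^\sharp(z_j)$; $E^\sharp_{\mathrm{bb}}=-\frac12\frac{N^-}{LW}\int_0^Ldx\int_0^Wdy\,V^\sharp(x+iy)$; $Q^\sharp_{\mathrm{plasma}}(\mathbf{z};N,N^-,\beta)=\exp[-\beta(E^\sharp_{\mathrm{pp}}(\mathbf{z})+E^\sharp_{\mathrm{pb}}(\mathbf{z})+E^\sharp_{\mathrm{bb}})]$.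 Kernels: for $R_N\in\{A_{N-1},C_N,D_N\}$, $\mathcal{N}=N,\,2(N+1),\,2(N-1)$ and $J(j)=j-1/2,\,j,\,j-1$ respectively; $M_j^{A_{N-1}}(z)=e^{2\pi iJ(j)z/L}\vartheta_2(J(j)\tau+\mathcal{N}z/L;\mathcal{N}\tau)$; $M_j^{C_N}(z)=e^{2\pi iJ(j)z/L}\vartheta_2(J(j)\tau+\mathcal{N}z/L;\mathcal{N}\tau)-e^{-2\pi iJ(j)z/L}\vartheta_2(J(j)\tau-\mathcal{N}z/L;\mathcal{N}\tau)$; $M_j^{D_N}$ the same with $+$. With $e_j=e^{-2\tau\pi iJ(j)^2/\mathcal{N}}$, $c=LW/\sqrt{2\mathcal{N}\Im\tau}$: $h^{A_{N-1}}_j=ce_j$, $h^{C_N}_j=2ce_j$, $h^{D_N}_j=4ce_j$ for $j\in\{1,N\}$ and $2ce_j$ otherwise. $K^{R_N}(z,z')=e^{-\pi\mathcal{N}(y^2+y'^2)/(LW)}\sum_{n=1}^NM_n(z)\overline{M_n(z')}/h_n$, $y=\Im z$, $y'=\Im z'$. Determinantal: the $n$-point correlation functions ($n\le N$), $\frac{N!}{(N-n)!}\int_{\Lambda^{N-n}}p(\mathbf{z})\prod_{j>n}dz_j$ for the normalized symmetric density $p$ on $\Lambda^N$, equal $\det_{1\le j,k\le n}[K(z_j,z_k)]$. *)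

theory Defs
  imports "HOL-Analysis.Analysis"
begin

definition theta0 :: "complex \<Rightarrow> complex \<Rightarrow> complex" where
  "theta0 v \<tau> = infsum (\<lambda>n::int. (-1) powi n * exp (pi * \<i> * \<tau> * of_int n ^ 2)
                                   * exp (2 * pi * \<i> * of_int n * v)) UNIV"

definition theta1 :: "complex \<Rightarrow> complex \<Rightarrow> complex" where
  "theta1 v \<tau> = \<i> * infsum (\<lambda>n::int. (-1) powi n * exp (pi * \<i> * \<tau> * (of_int n - 1/2) ^ 2)
                                   * exp ((2 * of_int n - 1) * pi * \<i> * v)) UNIV"

definition theta2 :: "complex \<Rightarrow> complex \<Rightarrow> complex" where
  "theta2 v \<tau> = infsum (\<lambda>n::int. exp (pi * \<i> * \<tau> * (of_int n - 1/2) ^ 2)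
                                   * exp ((2 * of_int n - 1) * pi * \<i> * v)) UNIV"

definition theta3 :: "complex \<Rightarrow> complex \<Rightarrow> complex" where
  "theta3 v \<tau> = infsum (\<lambda>n::int. exp (pi * \<i> * \<tau> * of_int n ^ 2)
                                   * exp (2 * pi * \<i> * of_int n * v)) UNIV"

definition eta :: "complex \<Rightarrow> complex" where
  "eta \<tau> = exp (pi * \<i> * \<tau> / 12) * (\<Prod>n. (1 - exp (2 * pi * \<i> * of_nat (Suc n) * \<tau>)))"

definition Lambda :: "real \<Rightarrow> real \<Rightarrow> complex set" where
  "Lambda L W = {z. 0 \<le> Re z \<and> Re z < L \<and> 0 \<le> Im z \<and> Im z < W}"

text \<open>Since tau = i W/L, eta(tau) is real positive, so 3 log eta(tau) = 3 ln |eta(tau)|.\<close>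

definition Phi_minus :: "real \<Rightarrow> complex \<Rightarrow> complex \<Rightarrow> complex \<Rightarrow> real" where
  "Phi_minus L \<tau> z z' =
     - ln (cmod (theta1 ((z - z') / of_real L) \<tau>)) + 3 * ln (cmod (eta \<tau>)) + ln (2 * pi / L)"

definition Phi_pm :: "real \<Rightarrow> complex \<Rightarrow> complex \<Rightarrow> complex \<Rightarrow> real" where
  "Phi_pm L \<tau> z z' =
     - ln (cmod (theta1 ((z + z') / of_real L) \<tau>)) - ln (cmod (theta1 ((z - z') / of_real L) \<tau>))
     + 3 * ln (cmod (eta \<tau>)) + ln (2 * pi / L)
     + 1/2 * (ln (cmod (theta1 (2 * z / of_real L) \<tau>)) + ln (cmod (theta1 (2 * z' / of_real L) \<tau>)))"

text \<open>Configurations z_1..z_N are functions on indices 0..N-1.\<close>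

definition E_pp :: "(complex \<Rightarrow> complex \<Rightarrow> real) \<Rightarrow> nat \<Rightarrow> (nat \<Rightarrow> complex) \<Rightarrow> real" where
  "E_pp \<Phi> N z = (\<Sum>k<N. \<Sum>j<k. \<Phi> (z k) (z j))"

definition V_bg :: "(complex \<Rightarrow> complex \<Rightarrow> real) \<Rightarrow> real \<Rightarrow> real \<Rightarrow> nat \<Rightarrow> complex \<Rightarrow> real" where
  "V_bg \<Phi> L W Nm z = - (real Nm / (L * W)) * (LINT w:Lambda L W|lborel. \<Phi> z w)"

definition E_pb :: "(complex \<Rightarrow> complex \<Rightarrow> real) \<Rightarrow> real \<Rightarrow> real \<Rightarrow> nat \<Rightarrow> nat \<Rightarrow> (nat \<Rightarrow> complex) \<Rightarrow> real" where
  "E_pb \<Phi> L W N Nm z = (\<Sum>j<N. V_bg \<Phi> L W Nm (z j))"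

definition E_bb :: "(complex \<Rightarrow> complex \<Rightarrow> real) \<Rightarrow> real \<Rightarrow> real \<Rightarrow> nat \<Rightarrow> real" where
  "E_bb \<Phi> L W Nm = - 1/2 * (real Nm / (L * W)) * (LINT w:Lambda L W|lborel. V_bg \<Phi> L W Nm w)"

definition Q_plasma :: "(complex \<Rightarrow> complex \<Rightarrow> real) \<Rightarrow> real \<Rightarrow> real \<Rightarrow> nat \<Rightarrow> nat \<Rightarrow> real
                        \<Rightarrow> (nat \<Rightarrow> complex) \<Rightarrow> real" where
  "Q_plasma \<Phi> L W N Nm \<beta> z = exp (- \<beta> * (E_pp \<Phi> N z + E_pb \<Phi> L W N Nm z + E_bb \<Phi> L W Nm))"

datatype root_sys = A_type | C_type | D_type

fun calN :: "root_sys \<Rightarrow> nat \<Rightarrow> nat" where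
  "calN A_type N = N"
| "calN C_type N = 2 * (N + 1)"
| "calN D_type N = 2 * (N - 1)"

fun Jf :: "root_sys \<Rightarrow> nat \<Rightarrow> real" where
  "Jf A_type j = real j - 1/2"
| "Jf C_type j = real j"
| "Jf D_type j = real j - 1"

definition Mf :: "root_sys \<Rightarrow> real \<Rightarrow> complex \<Rightarrow> nat \<Rightarrow> nat \<Rightarrow> complex \<Rightarrow> complex" where
  "Mf R L \<tau> N j z =
     (let J = of_real (Jf R j); n = of_nat (calN R N);
          P = exp (2 * pi * \<i> * J * z / of_real L) * theta2 (J * \<tau> + n * z / of_real L) (n * \<tau>);
          Q = exp (- 2 * pi * \<i> * J * z / of_real L) * theta2 (J * \<tau> - n * z / of_real L) (n * \<tau>)
      in case R of A_type \<Rightarrow> P | C_type \<Rightarrow> P - Q | D_type \<Rightarrow> P + Q)"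

definition hf :: "root_sys \<Rightarrow> real \<Rightarrow> real \<Rightarrow> complex \<Rightarrow> nat \<Rightarrow> nat \<Rightarrow> complex" where
  "hf R L W \<tau> N j =
     (let J = of_real (Jf R j); n = calN R N;
          e = exp (- 2 * \<tau> * pi * \<i> * J ^ 2 / of_nat n);
          c = of_real (L * W / sqrt (2 * real n * Im \<tau>))
      in case R of A_type \<Rightarrow> c * e | C_type \<Rightarrow> 2 * c * e
                 | D_type \<Rightarrow> (if j = 1 \<or> j = N then 4 * c * e else 2 * c * e))"

definition Kern :: "root_sys \<Rightarrow> real \<Rightarrow> real \<Rightarrow> complex \<Rightarrow> nat \<Rightarrow> complex \<Rightarrow> complex \<Rightarrow> complex" where
  "Kern R L W \<tau> N z z' =
     of_real (exp (- pi * real (calN R N) * ((Im z)\<^sup>2 + (Im z')\<^sup>2) / (L * W)))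
     * (\<Sum>m=1..N. Mf R L \<tau> N m z * cnj (Mf R L \<tau> N m z') / hf R L W \<tau> N m)"

definition detn :: "nat \<Rightarrow> (nat \<Rightarrow> nat \<Rightarrow> complex) \<Rightarrow> complex" where
  "detn n A = (\<Sum>p\<in>{p. p permutes {..<n}}. of_int (sign p) * (\<Prod>i<n. A i (p i)))"

definition corr_fun :: "complex set \<Rightarrow> nat \<Rightarrow> ((nat \<Rightarrow> complex) \<Rightarrow> real) \<Rightarrow> nat
                        \<Rightarrow> (nat \<Rightarrow> complex) \<Rightarrow> real" where
  "corr_fun S N w n x =
     (fact N / fact (N - n)) *
     (\<integral>y. (\<Prod>i\<in>{n..<N}. indicator S (y i)) * w (\<lambda>i. if i < n then x i else y i)
        \<partial>(PiM {n..<N} (\<lambda>_. lborel)))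
     / (\<integral>y. (\<Prod>i\<in>{..<N}. indicator S (y i)) * w y \<partial>(PiM {..<N} (\<lambda>_. lborel)))"

definition determinantal ::
  "complex set \<Rightarrow> nat \<Rightarrow> ((nat \<Rightarrow> complex) \<Rightarrow> real) \<Rightarrow> (complex \<Rightarrow> complex \<Rightarrow> complex) \<Rightarrow> bool" where
  "determinantal S N w K \<longleftrightarrow>
     (\<forall>n\<le>N. AE x in PiM {..<n} (\<lambda>_. lborel).
        (\<forall>i<n. x i \<in> S) \<longrightarrow> complex_of_real (corr_fun S N w n x) = detn n (\<lambda>j k. K (x j) (x k)))"

end

(* A density of the form C |det phi_j(z_k)|^2 with phi_1, ..., phi_N orthonormal in L^2(Lambda) is
   determinantal with kernel sum_m phi_m(z) cnj(phi_m(w)): integrating out variables in the Leibniz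
   expansion identifies pairs of permutations.  So the Boltzmann weights have to be recognised as such
   squares.

   The background potential only sees the mean of ln |theta_1| over horizontal lines.  By the triple
   product this mean is piecewise linear in the height, so exp (-2 V) is a Gaussian in Im z, up to a
   linear term that the theta function of the centre of mass compensates (case A) and powers of
   |theta_1 (2 z / L)| (cases C, D).  What remains of the weight is |F|^2 with F an antisymmetric product
   of theta functions.  In each variable F has an absolutely convergent Fourier expansion, and
   quasi-periodicity, together with parity in the cases C and D, reduces its coefficients to N free
   ones: F lies in the span of the functions M_j in every slot.  An antisymmetric function with that
   property is a constant multiple of det M_j(z_k), which plays the role of the denominator formulas;
   the constants never matter because correlation functions are normalised.

   Orthogonality of the M_j: expanding into Fourier modes, the damped coefficients are Gaussians in
   Im z whose translates tile the real line. *)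
theory Submission
  imports Defs "HOL-Probability.Probability" "HOL-Complex_Analysis.Complex_Analysis" "Jordan_Normal_Form.Determinant"
begin

subsection \<open>Cauchy--Binet sums over permutations\<close>

text \<open>The charges are singled out by a count of degrees: in each variable the degree n of F as
  a theta function has to match the Gaussian left by the background. In case A the N - 1 pair
  factors have degree 1 and the centre-of-mass factor supplies one more, so n = N. For
  \<open>Phi_pm\<close> the pair factors have degree 2 each. At beta = 2 the background contributes
  |theta_1(2 z / L)| to the power N^-, the half logarithms in the N - 1 pairs containing z
  contribute the power -(N - 1). The exponent N^- - N + 1 is 2 for N^- = N + 1, so that F gains a
  factor theta_1(2 v) of degree 4 and n = 2 N + 2, and 0 for N^- = N - 1, with n = 2 N - 2. In both
  cases n = 2 N^-.

  The analytic obstacle is \<open>ln 0 = 0\<close>: at coinciding points the formal weight does not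
  vanish, so it equals C |F|^2 only off a null set, described by conditions on pairs and on single
  points. Two functions must be shown not to vanish identically: the determinant, whose squared
  modulus integrates to N!, and F, which is evaluated at an explicit configuration of small
  heights.\<close>

lemma sum_permutes_agree:
  fixes g :: "(nat \<Rightarrow> nat) \<Rightarrow> complex"
  assumes p: "p permutes {..<N}" and "n \<le> N"
  shows "(\<Sum>q | q permutes {..<N} \<and> (\<forall>i\<in>{n..<N}. q i = p i). g q)
       = (\<Sum>\<pi> | \<pi> permutes {..<n}. g (p \<circ> \<pi>))"
\<comment> \<open>A permutation q that agrees with p from n on differs from p by a permutation of
  the first n indices, the composition of the inverse of p with q.\<close>
proof (rule sum.reindex_bij_witness[where j = "\<lambda>q. inv_into UNIV p \<circ> q" and i = "\<lambda>\<pi>. p \<circ> \<pi>"])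
  fix q assume q: "q \<in> {q. q permutes {..<N} \<and> (\<forall>i\<in>{n..<N}. q i = p i)}"
  show "p \<circ> (inv_into UNIV p \<circ> q) = q"
    by (simp add: o_assoc permutes_inv_o[OF p])
  then show "g (p \<circ> (inv_into UNIV p \<circ> q)) = g q" by simp
  have 1: "inv_into UNIV p \<circ> q permutes {..<N}"
    using q p by (auto intro!: permutes_compose permutes_inv)
  have 2: "(inv_into UNIV p \<circ> q) i = i" if "i \<notin> {..<n}" for i
  proof (cases "i < N")
    case True
    then have "q i = p i" using q that by auto
    then show ?thesis using p by (simp add: permutes_inverses)
  next
    case False then show ?thesis using 1 by (simp add: permutes_def)
  qed
  show "inv_into UNIV p \<circ> q \<in> {\<pi>. \<pi> permutes {..<n}}"
    using permutes_superset[OF 1, of "{..<n}"] 2 by simp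
next
  fix \<pi> assume \<pi>: "\<pi> \<in> {\<pi>. \<pi> permutes {..<n}}"
  show "inv_into UNIV p \<circ> (p \<circ> \<pi>) = \<pi>"
    by (simp add: o_assoc permutes_inv_o[OF p])
  have "\<pi> permutes {..<N}" using \<pi> assms by (auto intro: permutes_subset)
  then show "p \<circ> \<pi> \<in> {q. q permutes {..<N} \<and> (\<forall>i\<in>{n..<N}. q i = p i)}"
    using \<pi> p permutes_compose[of \<pi> "{..<N}" p] by (auto simp: permutes_not_in)
qed

text \<open>One extension \<open>p0\<close> of f is built by matching the leftover indices
  arbitrarily; composing it with the permutations of {n..<N} gives all others, and there are (N -
  n)! of those.\<close>

lemma card_permutes_extending:
  assumes f: "inj_on f {..<n}" "f ` {..<n} \<subseteq> {..<N}" and "n \<le> N"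
  shows "card {p. p permutes {..<N} \<and> (\<forall>i<n. p i = f i)} = fact (N - n)"
proof -
  have c: "card {n..<N} = card ({..<N} - f ` {..<n})"
    using f by (simp add: card_Diff_subset card_image)
  obtain h where h: "bij_betw h {n..<N} ({..<N} - f ` {..<n})"
    using finite_same_card_bij[OF _ _ c] by auto
  define p0 where "p0 = (\<lambda>i. if i < n then f i else if i < N then h i else i)"
  have b: "bij_betw p0 ({..<n} \<union> {n..<N}) (f ` {..<n} \<union> ({..<N} - f ` {..<n}))"
  proof (rule bij_betw_combine)
    show "bij_betw p0 {..<n} (f ` {..<n})"
      using f by (subst bij_betw_cong[of _ _ f]) (auto simp: p0_def bij_betw_def)
    show "bij_betw p0 {n..<N} ({..<N} - f ` {..<n})"
      using h by (subst bij_betw_cong[of _ _ h]) (auto simp: p0_def)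
  qed auto
  have "{..<n} \<union> {n..<N} = {..<N}" "f ` {..<n} \<union> ({..<N} - f ` {..<n}) = {..<N}"
    using assms by auto
  then have "bij_betw p0 {..<N} {..<N}" using b by simp
  then have p0: "p0 permutes {..<N}"
    using \<open>n \<le> N\<close> by (intro bij_imp_permutes) (auto simp: p0_def)
  have "bij_betw (\<lambda>q. p0 \<circ> q) {q. q permutes {n..<N}} {p. p permutes {..<N} \<and> (\<forall>i<n. p i = f i)}"
  proof (rule bij_betw_byWitness[where f' = "\<lambda>p. inv_into UNIV p0 \<circ> p"])
    show "\<forall>a\<in>{q. q permutes {n..<N}}. inv_into UNIV p0 \<circ> (p0 \<circ> a) = a"
      by (simp add: o_assoc permutes_inv_o[OF p0])
    show "\<forall>a'\<in>{p. p permutes {..<N} \<and> (\<forall>i<n. p i = f i)}. p0 \<circ> (inv_into UNIV p0 \<circ> a') = a'"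
      by (simp add: o_assoc permutes_inv_o[OF p0])
    show "(\<circ>) p0 ` {q. q permutes {n..<N}} \<subseteq> {p. p permutes {..<N} \<and> (\<forall>i<n. p i = f i)}"
    proof safe
      fix q assume q: "q permutes {n..<N}"
      then have "q permutes {..<N}" by (rule permutes_subset) auto
      then show "p0 \<circ> q permutes {..<N}" using p0 by (rule permutes_compose)
      fix i assume "i < n"
      then show "(p0 \<circ> q) i = f i" using q by (auto simp: permutes_def p0_def)
    qed
    show "(\<lambda>p. inv_into UNIV p0 \<circ> p) ` {p. p permutes {..<N} \<and> (\<forall>i<n. p i = f i)} \<subseteq> {q. q permutes {n..<N}}"
    proof safe
      fix p assume p: "p permutes {..<N}" "\<forall>i<n. p i = f i"
      have 1: "inv_into UNIV p0 \<circ> p permutes {..<N}" using p p0 by (auto intro!: permutes_compose permutes_inv)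
      have "(inv_into UNIV p0 \<circ> p) i = i" if "i \<in> {..<N} - {n..<N}" for i
      proof -
        have "p i = p0 i" using that p by (auto simp: p0_def)
        then show ?thesis using p0 by (simp add: permutes_inverses)
      qed
      then show "inv_into UNIV p0 \<circ> p permutes {n..<N}"
        by (intro permutes_superset[OF 1]) auto
    qed
  qed
  then have "card {p. p permutes {..<N} \<and> (\<forall>i<n. p i = f i)} = card {q. q permutes {n..<N}}"
    by (simp add: bij_betw_same_card)
  also have "\<dots> = fact (N - n)"
    by (rule card_permutations) auto
  finally show ?thesis .
qed

text \<open>For fixed p the inner sum depends on p only through its first n values, and is called
  \<open>G\<close>. Each injective choice of these values comes from (N - n)! permutations; on a
  non-injective choice \<open>G\<close> vanishes like a determinant with equal rows, so these
  choices can be added for free. Then the values range independently over {..<N}, and sum and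
  product can be exchanged.\<close>

lemma cauchy_binet_permutes:
  fixes a b :: "nat \<Rightarrow> nat \<Rightarrow> complex"
  assumes "n \<le> N"
  shows "(\<Sum>p | p permutes {..<N}. \<Sum>q | q permutes {..<N} \<and> (\<forall>i\<in>{n..<N}. q i = p i).
            of_int (sign p) * of_int (sign q) * (\<Prod>i<n. a (p i) i * b (q i) i))
       = fact (N - n) * detn n (\<lambda>j k. \<Sum>m<N. a m j * b m k)"
proof -
  define G where "G f = (\<Sum>\<pi> | \<pi> permutes {..<n}. of_int (sign \<pi>) * (\<Prod>i<n. a (f i) i * b (f (\<pi> i)) i))"
    for f :: "nat \<Rightarrow> nat"
  have G_cong: "G f = G g" if "\<And>i. i < n \<Longrightarrow> f i = g i" for f g
    unfolding G_def
  proof (intro sum.cong refl arg_cong2[where f = "(*)"] prod.cong)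
    fix \<pi> i assume "\<pi> \<in> {\<pi>. \<pi> permutes {..<n}}" "i \<in> {..<n}"
    then have "\<pi> i < n" using permutes_in_image[of \<pi> "{..<n}" i] by auto
    then show "b (f (\<pi> i)) i = b (g (\<pi> i)) i" using that by simp
  qed (use that in auto)
  have G0: "G f = 0" if not_inj: "\<not> inj_on f {..<n}" for f
  proof -
    obtain u v where uv: "u < n" "v < n" "u \<noteq> v" "f u = f v" using not_inj by (auto simp: inj_on_def)
    let ?t = "Transposition.transpose u v"
    have t: "?t permutes {..<n}" using uv by (simp add: permutes_swap_id)
    have "G f = (\<Sum>\<pi> | \<pi> permutes {..<n}. of_int (sign (?t \<circ> \<pi>)) * (\<Prod>i<n. a (f i) i * b (f ((?t \<circ> \<pi>) i)) i))"
      unfolding G_def by (rule setum_permutations_compose_left[OF t])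
    also have "\<dots> = (\<Sum>\<pi> | \<pi> permutes {..<n}. - (of_int (sign \<pi>) * (\<Prod>i<n. a (f i) i * b (f (\<pi> i)) i)))"
    proof (intro sum.cong refl)
      fix \<pi> assume pi: "\<pi> \<in> {\<pi>. \<pi> permutes {..<n}}"
      have "sign (?t \<circ> \<pi>) = - sign \<pi>"
        using pi t uv by (subst sign_compose)
          (auto simp: sign_swap_id permutation_swap_id intro: permutes_imp_permutation finite_lessThan)
      moreover have "f (?t j) = f j" for j using uv by (auto simp: Transposition.transpose_def)
      ultimately show "of_int (sign (?t \<circ> \<pi>)) * (\<Prod>i<n. a (f i) i * b (f ((?t \<circ> \<pi>) i)) i)
          = - (of_int (sign \<pi>) * (\<Prod>i<n. a (f i) i * b (f (\<pi> i)) i))" by simp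
    qed
    also have "\<dots> = - G f" by (simp add: G_def sum_negf)
    finally show ?thesis by simp
  qed
  have 1: "(\<Sum>q | q permutes {..<N} \<and> (\<forall>i\<in>{n..<N}. q i = p i).
            of_int (sign p) * of_int (sign q) * (\<Prod>i<n. a (p i) i * b (q i) i)) = G p"
    if p: "p permutes {..<N}" for p
    unfolding G_def
  proof (subst sum_permutes_agree[OF p assms], intro sum.cong refl)
    fix \<pi> assume pi: "\<pi> \<in> {\<pi>. \<pi> permutes {..<n}}"
    have "sign (p \<circ> \<pi>) = sign p * sign \<pi>"
      using pi p by (intro sign_compose) (auto intro: permutes_imp_permutation finite_lessThan)
    then show "of_int (sign p) * of_int (sign (p \<circ> \<pi>)) * (\<Prod>i<n. a (p i) i * b ((p \<circ> \<pi>) i) i)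
       = of_int (sign \<pi>) * (\<Prod>i<n. a (p i) i * b (p (\<pi> i)) i)"
      by (simp add: sign_def)
  qed
  let ?E = "PiE {..<n} (\<lambda>_. {..<N})"
  let ?I = "{f \<in> ?E. inj_on f {..<n}}"
  have finE: "finite ?E" by (intro finite_PiE) auto
  have "(\<Sum>p | p permutes {..<N}. G p) = (\<Sum>p | p permutes {..<N}. G (restrict p {..<n}))"
    by (intro sum.cong refl G_cong) auto
  also have "\<dots> = (\<Sum>f\<in>?I. \<Sum>p\<in>{p \<in> {p. p permutes {..<N}}. restrict p {..<n} = f}. G (restrict p {..<n}))"
  proof (rule sum.group[symmetric])
    show "finite {p. p permutes {..<N}}" by (simp add: finite_permutations)
    show "finite ?I" using finE by simp
    show "(\<lambda>p. restrict p {..<n}) ` {p. p permutes {..<N}} \<subseteq> ?I"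
    proof (rule image_subsetI)
      fix p assume "p \<in> {p. p permutes {..<N}}"
      then have p: "p permutes {..<N}" by simp
      have "inj_on (restrict p {..<n}) {..<n}"
        using p by (metis inj_on_restrict_eq permutes_inj_on)
      moreover have "p i < N" if "i < n" for i
        using permutes_in_image[OF p, of i] that assms by auto
      ultimately show "restrict p {..<n} \<in> ?I" by auto
    qed
  qed
  also have "\<dots> = (\<Sum>f\<in>?I. fact (N - n) * G f)"
  proof (intro sum.cong refl)
    fix f assume f: "f \<in> ?I"
    have "{p \<in> {p. p permutes {..<N}}. restrict p {..<n} = f} = {p. p permutes {..<N} \<and> (\<forall>i<n. p i = f i)}"
      using f by (auto simp: restrict_def PiE_def extensional_def fun_eq_iff)
    moreover have "f ` {..<n} \<subseteq> {..<N}" using f by auto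
    ultimately have c: "card {p \<in> {p. p permutes {..<N}}. restrict p {..<n} = f} = fact (N - n)"
      using card_permutes_extending[of f n N] f assms by simp
    have "(\<Sum>p\<in>{p \<in> {p. p permutes {..<N}}. restrict p {..<n} = f}. G (restrict p {..<n}))
        = (\<Sum>p\<in>{p \<in> {p. p permutes {..<N}}. restrict p {..<n} = f}. G f)"
      by (rule sum.cong) auto
    also have "\<dots> = fact (N - n) * G f" by (simp only: sum_constant c of_nat_fact)
    finally show "(\<Sum>p\<in>{p \<in> {p. p permutes {..<N}}. restrict p {..<n} = f}. G (restrict p {..<n})) = fact (N - n) * G f" .
  qed
  also have "\<dots> = fact (N - n) * (\<Sum>f\<in>?I. G f)" by (simp add: sum_distrib_left)
  also have "(\<Sum>f\<in>?I. G f) = (\<Sum>f\<in>?E. G f)"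
    by (rule sum.mono_neutral_left) (use finE G0 in auto)
  \<comment> \<open>The factors of b are reindexed by the inverse of \<pi>, so that f enters every
    factor only through its value at i.\<close>
  also have "(\<Sum>f\<in>?E. G f) = (\<Sum>\<pi> | \<pi> permutes {..<n}. of_int (sign \<pi>) * (\<Sum>f\<in>?E. \<Prod>i<n. a (f i) i * b (f i) (inv_into UNIV \<pi> i)))"
    unfolding G_def
  proof (subst sum.swap, intro sum.cong refl, subst sum_distrib_left[symmetric], intro arg_cong2[where f = "(*)"] refl sum.cong)
    fix \<pi> f assume pi: "\<pi> \<in> {\<pi>. \<pi> permutes {..<n}}"
    then have \<pi>: "\<pi> permutes {..<n}" by simp
    have "(\<Prod>i<n. b (f (\<pi> i)) i) = (\<Prod>i<n. b (f (\<pi> (inv_into UNIV \<pi> i))) (inv_into UNIV \<pi> i))"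
      using prod.permute[OF permutes_inv[OF \<pi>], of "\<lambda>i. b (f (\<pi> i)) i"] by (simp only: o_def)
    also have "\<dots> = (\<Prod>i<n. b (f i) (inv_into UNIV \<pi> i))"
      by (simp only: permutes_inverses[OF \<pi>])
    finally have "(\<Prod>i<n. b (f (\<pi> i)) i) = (\<Prod>i<n. b (f i) (inv_into UNIV \<pi> i))" .
    then show "(\<Prod>i<n. a (f i) i * b (f (\<pi> i)) i) = (\<Prod>i<n. a (f i) i * b (f i) (inv_into UNIV \<pi> i))"
      by (simp add: prod.distrib)
  qed
  also have "\<dots> = (\<Sum>\<pi> | \<pi> permutes {..<n}. of_int (sign \<pi>) * (\<Prod>i<n. \<Sum>m<N. a m i * b m (inv_into UNIV \<pi> i)))"
    by (intro sum.cong refl arg_cong2[where f = "(*)"] prod_sum_PiE[symmetric]) auto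
  also have "\<dots> = (\<Sum>\<pi> | \<pi> permutes {..<n}. of_int (sign \<pi>) * (\<Prod>i<n. \<Sum>m<N. a m i * b m (\<pi> i)))"
  proof (subst sum_permutations_inverse, intro sum.cong refl)
    fix \<pi> assume "\<pi> \<in> {\<pi>. \<pi> permutes {..<n}}"
    then have "permutation \<pi>" "inv_into UNIV (inv_into UNIV \<pi>) = \<pi>"
      by (auto intro: permutes_imp_permutation permutes_inv_inv)
    then show "of_int (sign (inv_into UNIV \<pi>)) * (\<Prod>i<n. \<Sum>m<N. a m i * b m (inv_into UNIV (inv_into UNIV \<pi>) i))
        = of_int (sign \<pi>) * (\<Prod>i<n. \<Sum>m<N. a m i * b m (\<pi> i))"
      by (simp add: sign_inverse)
  qed
  also have "\<dots> = detn n (\<lambda>j k. \<Sum>m<N. a m j * b m k)" by (simp add: detn_def)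
  finally have "(\<Sum>p | p permutes {..<N}. G p) = fact (N - n) * detn n (\<lambda>j k. \<Sum>m<N. a m j * b m k)" .
  moreover have "(\<Sum>p | p permutes {..<N}. \<Sum>q | q permutes {..<N} \<and> (\<forall>i\<in>{n..<N}. q i = p i).
            of_int (sign p) * of_int (sign q) * (\<Prod>i<n. a (p i) i * b (q i) i)) = (\<Sum>p | p permutes {..<N}. G p)"
    using 1 by (intro sum.cong) auto
  ultimately show ?thesis by simp
qed

subsection \<open>Determinantal densities\<close>

lemma emeasure_PiM_insert_0:
  fixes A :: "('i \<Rightarrow> 'a::euclidean_space) set"
  assumes "finite I" "i \<notin> I" and A: "A \<in> sets (PiM (insert i I) (\<lambda>_. lborel :: 'a measure))"
    and ae: "\<And>x. x \<in> space (PiM I (\<lambda>_. lborel :: 'a measure)) \<Longrightarrow> AE b in lborel. x(i := b) \<notin> A"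
  shows "emeasure (PiM (insert i I) (\<lambda>_. lborel)) A = 0"
proof -
  interpret product_sigma_finite "\<lambda>_. lborel :: 'a measure" ..
  have "emeasure (PiM (insert i I) (\<lambda>_. lborel)) A = (\<integral>\<^sup>+x. indicator A x \<partial>PiM (insert i I) (\<lambda>_. lborel))"
    using A by simp
  also have "\<dots> = (\<integral>\<^sup>+x. (\<integral>\<^sup>+b. indicator A (x(i := b)) \<partial>lborel) \<partial>PiM I (\<lambda>_. lborel))"
    by (rule product_nn_integral_insert) (use assms in auto)
  also have "\<dots> = (\<integral>\<^sup>+x. 0 \<partial>PiM I (\<lambda>_. lborel :: 'a measure))"
  proof (rule nn_integral_cong)
    fix x assume x: "x \<in> space (PiM I (\<lambda>_. lborel :: 'a measure))"
    have "(\<integral>\<^sup>+b. indicator A (x(i := b)) \<partial>lborel) = (\<integral>\<^sup>+(b::'a). 0 \<partial>lborel)"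
      by (rule nn_integral_cong_AE) (use ae[OF x] in eventually_elim, auto)
    then show "(\<integral>\<^sup>+b. indicator A (x(i := b)) \<partial>lborel) = (0::ennreal)" by simp
  qed
  finally show ?thesis by simp
qed

text \<open>By Tonelli in slot i: with the other coordinates fixed, the exceptional set is one of
  the null slices in the hypothesis. This will discard the configurations in which a theta function
  of two points vanishes.\<close>

lemma AE_PiM_lborel_pair:
  fixes P :: "'a::euclidean_space \<Rightarrow> 'a \<Rightarrow> bool"
  assumes "finite I" "i \<in> I" "j \<in> I" "i \<noteq> j"
    and [measurable]: "Measurable.pred (borel \<Otimes>\<^sub>M borel) (\<lambda>(a, b). P a b)"
    and ae: "\<And>a. AE b in lborel. P a b"
  shows "AE x in PiM I (\<lambda>_. lborel). P (x j) (x i)"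
proof -
  let ?M = "PiM I (\<lambda>_. lborel :: 'a measure)"
  have [measurable]: "(\<lambda>x. x i) \<in> borel_measurable ?M" "(\<lambda>x. x j) \<in> borel_measurable ?M"
    using assms by auto
  have "Measurable.pred ?M (\<lambda>x. (\<lambda>(a, b). P a b) (x j, x i))"
    by measurable
  then have m: "{x \<in> space ?M. \<not> P (x j) (x i)} \<in> sets ?M" by simp
  have ins: "insert i (I - {i}) = I" using assms by auto
  have "emeasure (PiM (insert i (I - {i})) (\<lambda>_. lborel)) {x \<in> space ?M. \<not> P (x j) (x i)} = 0"
  proof (rule emeasure_PiM_insert_0)
    show "{x \<in> space ?M. \<not> P (x j) (x i)} \<in> sets (PiM (insert i (I - {i})) (\<lambda>_. lborel))"
      unfolding ins by (rule m)
    fix x :: "'b \<Rightarrow> 'a"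
    show "AE b in lborel. x(i := b) \<notin> {x \<in> space ?M. \<not> P (x j) (x i)}"
      using ae[of "x j"] by eventually_elim (use assms in auto)
  qed (use assms in auto)
  then show ?thesis using m unfolding ins by (intro AE_I[OF _ _ m]) auto
qed

lemma AE_PiM_lborel_component:
  fixes P :: "'a::euclidean_space \<Rightarrow> bool"
  assumes "finite I" "i \<in> I"
    and [measurable]: "Measurable.pred borel P"
    and ae: "AE b in lborel. P b"
  shows "AE x in PiM I (\<lambda>_. lborel). P (x i)"
proof -
  let ?M = "PiM I (\<lambda>_. lborel :: 'a measure)"
  have [measurable]: "(\<lambda>x. x i) \<in> borel_measurable ?M"
    using assms by auto
  have "Measurable.pred ?M (\<lambda>x. P (x i))"
    by measurable
  then have m: "{x \<in> space ?M. \<not> P (x i)} \<in> sets ?M" by simp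
  have ins: "insert i (I - {i}) = I" using assms by auto
  have "emeasure (PiM (insert i (I - {i})) (\<lambda>_. lborel)) {x \<in> space ?M. \<not> P (x i)} = 0"
  proof (rule emeasure_PiM_insert_0)
    show "{x \<in> space ?M. \<not> P (x i)} \<in> sets (PiM (insert i (I - {i})) (\<lambda>_. lborel))"
      unfolding ins by (rule m)
    fix x :: "'b \<Rightarrow> 'a"
    show "AE b in lborel. x(i := b) \<notin> {x \<in> space ?M. \<not> P (x i)}"
      using ae by eventually_elim auto
  qed (use assms in auto)
  then show ?thesis using m unfolding ins by (intro AE_I[OF _ _ m]) auto
qed

text \<open>Serves both integrals in \<open>corr_fun\<close>: general n gives the numerator, n = 0
  the normalisation.\<close>

lemma integral_detn_cnj:
  fixes \<phi> :: "nat \<Rightarrow> complex \<Rightarrow> complex"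
  assumes int: "\<And>j k. j < N \<Longrightarrow> k < N \<Longrightarrow> set_integrable lborel S (\<lambda>z. \<phi> j z * cnj (\<phi> k z))"
    and orth: "\<And>j k. j < N \<Longrightarrow> k < N \<Longrightarrow>
                 (LINT z:S|lborel. \<phi> j z * cnj (\<phi> k z)) = (if j = k then 1 else 0)"
    and "n \<le> N"
  defines "D \<equiv> \<lambda>z. detn N (\<lambda>i m. \<phi> m (z i))"
  shows "(\<integral>y. (\<Prod>i\<in>{n..<N}. indicator S (y i)) * (D (\<lambda>i. if i < n then x i else y i) * cnj (D (\<lambda>i. if i < n then x i else y i)))
            \<partial>PiM {n..<N} (\<lambda>_. lborel))
         = fact (N - n) * detn n (\<lambda>j k. \<Sum>m<N. \<phi> m (x j) * cnj (\<phi> m (x k)))"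
proof -
  interpret product_sigma_finite "\<lambda>_. lborel :: complex measure" ..
  let ?M = "PiM {n..<N} (\<lambda>_. lborel :: complex measure)"
  let ?P = "{p. p permutes {..<N}}"
  define X where "X p q = (\<Prod>i<n. \<phi> (p i) (x i) * cnj (\<phi> (q i) (x i)))" for p q :: "nat \<Rightarrow> nat"
  define Y where "Y p q y = (\<Prod>i\<in>{n..<N}. indicator S (y i) *\<^sub>R (\<phi> (p i) (y i) * cnj (\<phi> (q i) (y i))))"
    for p q :: "nat \<Rightarrow> nat" and y
  have lt: "p i < N" if "p permutes {..<N}" "i < N" for p i
    using permutes_in_image[of p "{..<N}" i] that by simp
  \<comment> \<open>The integral over the last variables factorises, and orthonormality makes factor
    i the indicator of p i = q i.\<close>
  have Yint: "integrable ?M (Y p q)" and Yval: "integral\<^sup>L ?M (Y p q) = (if \<forall>i\<in>{n..<N}. q i = p i then 1 else 0)"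
    if "p permutes {..<N}" "q permutes {..<N}" for p q
  proof -
    have i: "integrable lborel (\<lambda>b. indicator S b *\<^sub>R (\<phi> (p i) b * cnj (\<phi> (q i) b)))" if "i \<in> {n..<N}" for i
      using int[of "p i" "q i"] lt that \<open>p permutes _\<close> \<open>q permutes _\<close> unfolding set_integrable_def by auto
    show "integrable ?M (Y p q)" unfolding Y_def
      by (rule product_integrable_prod) (use i in auto)
    have "integral\<^sup>L ?M (Y p q) = (\<Prod>i\<in>{n..<N}. LINT b|lborel. indicator S b *\<^sub>R (\<phi> (p i) b * cnj (\<phi> (q i) b)))"
      unfolding Y_def by (rule product_integral_prod) (use i in auto)
    also have "\<dots> = (\<Prod>i\<in>{n..<N}. if q i = p i then 1 else 0)"
      using orth lt that unfolding set_lebesgue_integral_def by (intro prod.cong) auto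
    also have "\<dots> = (if \<forall>i\<in>{n..<N}. q i = p i then 1 else 0)"
      by (auto intro!: prod.neutral)
    finally show "integral\<^sup>L ?M (Y p q) = (if \<forall>i\<in>{n..<N}. q i = p i then 1 else 0)" .
  qed
  have split: "(\<Prod>i<N. f i) = (\<Prod>i<n. f i) * (\<Prod>i\<in>{n..<N}. f i)" for f :: "nat \<Rightarrow> complex"
  proof -
    have "{..<N} = {..<n} \<union> {n..<N}" using \<open>n \<le> N\<close> by auto
    show ?thesis unfolding \<open>{..<N} = _\<close> by (subst prod.union_disjoint) auto
  qed
  have eq: "(\<Prod>i\<in>{n..<N}. indicator S (y i)) * (D (\<lambda>i. if i < n then x i else y i) * cnj (D (\<lambda>i. if i < n then x i else y i)))
     = (\<Sum>p\<in>?P. \<Sum>q\<in>?P. of_int (sign p) * of_int (sign q) * X p q * Y p q y)" for y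
  proof -
    let ?z = "\<lambda>i. if i < n then x i else y i"
    have "D ?z * cnj (D ?z) = (\<Sum>p\<in>?P. \<Sum>q\<in>?P. (of_int (sign p) * (\<Prod>i<N. \<phi> (p i) (?z i)))
           * (of_int (sign q) * (\<Prod>i<N. cnj (\<phi> (q i) (?z i)))))"
      by (simp add: D_def detn_def sum_product)
    also have "\<dots> = (\<Sum>p\<in>?P. \<Sum>q\<in>?P. of_int (sign p) * of_int (sign q) * X p q *
                 (\<Prod>i\<in>{n..<N}. \<phi> (p i) (y i) * cnj (\<phi> (q i) (y i))))"
      by (intro sum.cong refl) (simp add: split X_def prod.distrib ac_simps)
    finally have D: "D ?z * cnj (D ?z) = \<dots>" .
    show ?thesis unfolding D sum_distrib_left
      by (intro sum.cong refl) (simp add: Y_def scaleR_conv_of_real prod.distrib ac_simps of_real_indicator)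
  qed
  have "(\<integral>y. (\<Prod>i\<in>{n..<N}. indicator S (y i)) * (D (\<lambda>i. if i < n then x i else y i) * cnj (D (\<lambda>i. if i < n then x i else y i))) \<partial>?M)
     = (\<Sum>p\<in>?P. \<Sum>q\<in>?P. of_int (sign p) * of_int (sign q) * X p q * integral\<^sup>L ?M (Y p q))"
    unfolding eq using Yint by (subst Bochner_Integration.integral_sum;
      (intro Bochner_Integration.integrable_sum)?; auto intro!: sum.cong simp: Bochner_Integration.integral_sum)
  also have "\<dots> = (\<Sum>p\<in>?P. \<Sum>q\<in>?P. if \<forall>i\<in>{n..<N}. q i = p i then of_int (sign p) * of_int (sign q) * X p q else 0)"
    using Yval by (intro sum.cong refl) auto
  also have "\<dots> = (\<Sum>p\<in>?P. \<Sum>q | q permutes {..<N} \<and> (\<forall>i\<in>{n..<N}. q i = p i). of_int (sign p) * of_int (sign q) * X p q)"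
    by (subst sum.inter_filter[symmetric]) (auto simp: finite_permutations)
  also have "\<dots> = fact (N - n) * detn n (\<lambda>j k. \<Sum>m<N. \<phi> m (x j) * cnj (\<phi> m (x k)))"
    unfolding X_def by (rule cauchy_binet_permutes) fact
  finally show ?thesis .
qed

text \<open>If the determinant vanished identically, the case n = 0 of the previous formula would
  give 0 = N!.\<close>

lemma ex_detn_nonzero:
  fixes \<phi> :: "nat \<Rightarrow> complex \<Rightarrow> complex"
  assumes int: "\<And>j k. j < N \<Longrightarrow> k < N \<Longrightarrow> set_integrable lborel S (\<lambda>z. \<phi> j z * cnj (\<phi> k z))"
    and orth: "\<And>j k. j < N \<Longrightarrow> k < N \<Longrightarrow>
                 (LINT z:S|lborel. \<phi> j z * cnj (\<phi> k z)) = (if j = k then 1 else 0)"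
  shows "\<exists>z. detn N (\<lambda>i m. \<phi> m (z i)) \<noteq> 0"
proof (rule ccontr)
  assume "\<not> ?thesis"
  then show False
    using integral_detn_cnj[OF int orth, of N 0] by (simp add: detn_def)
qed

text \<open>The formula for the weight is demanded only where \<open>P\<close> holds for all pairs
  and \<open>R\<close> for all points, because the energies take a logarithm of 0 where a theta
  function vanishes. Measurability is stated for arbitrary measurable families \<open>g\<close>, as
  it has to apply also to configurations whose first n points are frozen.\<close>

lemma determinantalI:
  fixes \<phi> :: "nat \<Rightarrow> complex \<Rightarrow> complex" and C :: real
  assumes int: "\<And>j k. j < N \<Longrightarrow> k < N \<Longrightarrow> set_integrable lborel S (\<lambda>z. \<phi> j z * cnj (\<phi> k z))"
    and orth: "\<And>j k. j < N \<Longrightarrow> k < N \<Longrightarrow>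
                 (LINT z:S|lborel. \<phi> j z * cnj (\<phi> k z)) = (if j = k then 1 else 0)"
    and S [measurable]: "S \<in> sets borel"
    and \<phi> [measurable]: "\<And>j. j < N \<Longrightarrow> \<phi> j \<in> borel_measurable borel"
    and w_meas: "\<And>(M :: (nat \<Rightarrow> complex) measure) g. (\<And>i. i < N \<Longrightarrow> (\<lambda>\<omega>. g \<omega> i) \<in> borel_measurable M) \<Longrightarrow>
        (\<lambda>\<omega>. (\<Prod>i<N. indicator S (g \<omega> i)) * w (g \<omega>)) \<in> borel_measurable M"
    and P [measurable]: "Measurable.pred (borel \<Otimes>\<^sub>M borel) (\<lambda>(a, b). P a b)" and P_ae: "\<And>a. AE b in lborel. P a b"
    and R [measurable]: "Measurable.pred borel R" and R_ae: "AE b in lborel. R b"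
    and w: "\<And>z. (\<And>i. i < N \<Longrightarrow> z i \<in> S \<and> R (z i)) \<Longrightarrow> (\<And>j k. j < k \<Longrightarrow> k < N \<Longrightarrow> P (z j) (z k)) \<Longrightarrow>
        w z = C * (cmod (detn N (\<lambda>i m. \<phi> m (z i))))\<^sup>2"
    and "C \<noteq> 0"
    and K: "\<And>x y. K x y = (\<Sum>m<N. \<phi> m x * cnj (\<phi> m y))"
  shows "determinantal S N w K"
proof -
  let ?D = "\<lambda>z. detn N (\<lambda>i m. \<phi> m (z i))"
  define good where "good I z \<longleftrightarrow> (\<forall>i\<in>I. R (z i)) \<and> (\<forall>k\<in>I. \<forall>j\<in>I. j < k \<longrightarrow> P (z j) (z k))"
    for I :: "nat set" and z
  have good_ae: "AE x in PiM I (\<lambda>_. lborel). good I x" if "finite I" for I :: "nat set"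
    unfolding good_def using that
    by (intro AE_conjI AE_finite_allI AE_impI AE_PiM_lborel_component R R_ae AE_PiM_lborel_pair P P_ae) auto
  have integral: "(\<integral>y. (\<Prod>i\<in>{n..<N}. indicator S (y i)) * w (\<lambda>i. if i < n then x i else y i) \<partial>PiM {n..<N} (\<lambda>_. lborel))
      = C * fact (N - n) * detn n (\<lambda>j k. K (x j) (x k))"
    if "n \<le> N" and xS: "\<forall>i<n. x i \<in> S" and x: "good {..<n} x" for n x
  proof -
    let ?M = "PiM {n..<N} (\<lambda>_. lborel :: complex measure)"
    let ?z = "\<lambda>y i. if i < n then x i else y i"
    have g [measurable]: "(\<lambda>y. ?z y i) \<in> borel_measurable ?M" if "i < N" for i
      using that by (cases "i < n") auto
    have split: "(\<Prod>i<N. indicator S (?z y i)) = (\<Prod>i\<in>{n..<N}. indicator S (y i) :: real)" for y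
    proof -
      have "{..<N} = {..<n} \<union> {n..<N}" using \<open>n \<le> N\<close> by auto
      show ?thesis unfolding \<open>{..<N} = _\<close> using xS by (subst prod.union_disjoint) auto
    qed
    have D_meas: "(\<lambda>y. ?D (?z y)) \<in> borel_measurable ?M"
      unfolding detn_def
    proof (intro borel_measurable_sum borel_measurable_times borel_measurable_const borel_measurable_prod)
      fix p i assume "p \<in> {p. p permutes {..<N}}" "i \<in> {..<N}"
      then have "p i < N" "i < N" using permutes_in_image[of p "{..<N}" i] by auto
      then show "(\<lambda>y. \<phi> (p i) (?z y i)) \<in> borel_measurable ?M"
        using measurable_compose[OF g \<phi>] by auto
    qed
    \<comment> \<open>Pairs of one frozen and one integrated point are covered by neither
      \<open>good\<close> condition. For fixed \<open>x j\<close> they constrain a single coordinate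
      of y.\<close>
    have cross: "AE y in ?M. \<forall>k\<in>{n..<N}. \<forall>j\<in>{..<n}. P (x j) (y k)"
    proof (intro AE_finite_allI)
      fix k j assume "k \<in> {n..<N}"
      moreover have "Measurable.pred borel (\<lambda>b. (\<lambda>(a, b). P a b) (x j, b))" by measurable
      ultimately show "AE y in ?M. P (x j) (y k)"
        by (intro AE_PiM_lborel_component P_ae) auto
    qed auto
    have "AE y in ?M. (\<Prod>i\<in>{n..<N}. indicator S (y i)) * w (?z y)
        = (\<Prod>i\<in>{n..<N}. indicator S (y i)) * (C * (cmod (?D (?z y)))\<^sup>2)"
      using good_ae[of "{n..<N}", simplified] cross
    proof eventually_elim
      case (elim y)
      show ?case
      proof (cases "\<forall>i\<in>{n..<N}. y i \<in> S")
        case True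
        have "w (?z y) = C * (cmod (?D (?z y)))\<^sup>2"
          by (rule w) (use True xS x elim in \<open>auto simp: good_def\<close>)
        then show ?thesis by simp
      next
        case False
        then have "(\<Prod>i\<in>{n..<N}. indicator S (y i) :: real) = 0" by (force simp: indicator_def)
        then show ?thesis by simp
      qed
    qed
    then have "(\<integral>y. (\<Prod>i\<in>{n..<N}. indicator S (y i)) * w (?z y) \<partial>?M)
        = (\<integral>y. (\<Prod>i\<in>{n..<N}. indicator S (y i)) * (C * (cmod (?D (?z y)))\<^sup>2) \<partial>?M)"
    proof (rule integral_cong_AE[rotated 2])
      show "(\<lambda>y. (\<Prod>i\<in>{n..<N}. indicator S (y i)) * w (?z y)) \<in> borel_measurable ?M"
        using w_meas[of "?z" ?M] g by (simp add: split)
      have [measurable]: "(\<lambda>y. \<Prod>i\<in>{n..<N}. indicator S (y i) :: real) \<in> borel_measurable ?M"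
        by (intro borel_measurable_prod) measurable
      show "(\<lambda>y. (\<Prod>i\<in>{n..<N}. indicator S (y i)) * (C * (cmod (?D (?z y)))\<^sup>2)) \<in> borel_measurable ?M"
        using D_meas by measurable
    qed
    also have "complex_of_real \<dots> = (\<integral>y. C * ((\<Prod>i\<in>{n..<N}. indicator S (y i)) * (?D (?z y) * cnj (?D (?z y)))) \<partial>?M)"
      by (subst integral_complex_of_real[symmetric], intro Bochner_Integration.integral_cong refl)
         (simp add: complex_mult_cnj cmod_power2 of_real_indicator)
    also have "\<dots> = C * (fact (N - n) * detn n (\<lambda>j k. \<Sum>m<N. \<phi> m (x j) * cnj (\<phi> m (x k))))"
      by (simp only: integral_mult_right_zero integral_detn_cnj[OF int orth \<open>n \<le> N\<close>])
    finally show ?thesis by (simp add: K)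
  qed
  show ?thesis
    unfolding determinantal_def
  proof safe
    fix n assume "n \<le> N"
    \<comment> \<open>With n = 0 nothing is frozen, the small determinant is 1 and the normalising
      integral appears.\<close>
    have Z: "complex_of_real (\<integral>y. (\<Prod>i\<in>{..<N}. indicator S (y i)) * w y \<partial>(PiM {..<N} (\<lambda>_. lborel))) = C * fact N"
      using integral[of 0 "\<lambda>_. 0"] by (simp add: good_def detn_def atLeast0LessThan)
    show "AE x in PiM {..<n} (\<lambda>_. lborel). (\<forall>i<n. x i \<in> S) \<longrightarrow>
        complex_of_real (corr_fun S N w n x) = detn n (\<lambda>j k. K (x j) (x k))"
      using good_ae[of "{..<n}", simplified]
    proof eventually_elim
      case (elim x)
      show ?case
      proof
        assume "\<forall>i<n. x i \<in> S"
        then have "complex_of_real (corr_fun S N w n x)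
            = fact N / fact (N - n) * (C * fact (N - n) * detn n (\<lambda>j k. K (x j) (x k))) / (C * fact N)"
          unfolding corr_fun_def of_real_divide of_real_mult Z
          by (subst integral[OF \<open>n \<le> N\<close> _ elim]) auto
        also have "\<dots> = detn n (\<lambda>j k. K (x j) (x k))" using \<open>C \<noteq> 0\<close> by simp
        finally show "complex_of_real (corr_fun S N w n x) = detn n (\<lambda>j k. K (x j) (x k))" .
      qed
    qed
  qed
qed

subsection \<open>Antisymmetric functions\<close>

text \<open>Opens the way to inverse matrices, from which the dual functions for interpolation are
  made.\<close>

lemma detn_conv_det: "detn N f = det (mat N N (\<lambda>(i, j). f i j))"
proof -
  have "detn N f = (\<Sum>p | p permutes {0..<N}. signof p * (\<Prod>i = 0..<N. mat N N (\<lambda>(i, j). f i j) $$ (i, p i)))"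
    unfolding detn_def atLeast0LessThan
  proof (intro sum.cong refl arg_cong2[where f = "(*)"] prod.cong)
    fix p i assume "p \<in> {p. p permutes {..<N}}" "i \<in> {..<N}"
    then have "p i < N" using permutes_in_image[of p "{..<N}" i] by auto
    then show "f i (p i) = mat N N (\<lambda>(i, j). f i j) $$ (i, p i)" using \<open>i \<in> {..<N}\<close> by auto
  qed
  also have "\<dots> = det (mat N N (\<lambda>(i, j). f i j))"
    by (simp add: Determinant.det_def)
  finally show ?thesis .
qed

lemma antisym_permutes:
  fixes F :: "(nat \<Rightarrow> 'a) \<Rightarrow> complex"
  assumes anti: "\<And>z i j. i < N \<Longrightarrow> j < N \<Longrightarrow> i \<noteq> j \<Longrightarrow> F (z \<circ> Transposition.transpose i j) = - F z"
    and "\<sigma> permutes {..<N}"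
  shows "F (z \<circ> \<sigma>) = of_int (sign \<sigma>) * F z"
  using \<open>\<sigma> permutes {..<N}\<close> finite_lessThan
proof (induction \<sigma> arbitrary: z rule: permutes_induct)
  case id
  then show ?case by (simp add: sign_id)
next
  case (swap a b p)
  have "F (z \<circ> (Transposition.transpose a b \<circ> p)) = of_int (sign p) * F (z \<circ> Transposition.transpose a b)"
    unfolding o_assoc by (rule swap.IH)
  also have "\<dots> = - of_int (sign p) * F z"
    using swap anti[of a b z] by simp
  also have "sign (Transposition.transpose a b \<circ> p) = - sign p"
    using swap by (subst sign_compose)
      (auto simp: sign_swap_id permutation_swap_id intro: permutes_imp_permutation finite_lessThan)
  then have "- of_int (sign p) * F z = of_int (sign (Transposition.transpose a b \<circ> p)) * F z" by simp
  finally show ?case .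
qed

text \<open>The functions \<open>\<psi> l\<close> reproduce F in one slot from its values at the
  nodes \<open>p l\<close>, as in Lagrange interpolation. Applying this to the slots of A one after
  another gives a sum over all assignments of nodes to slots.\<close>

lemma interpolate_slots:
  fixes F :: "(nat \<Rightarrow> 'a) \<Rightarrow> complex"
  assumes interp: "\<And>z i w. i < N \<Longrightarrow> F (z(i := w)) = (\<Sum>l<N. F (z(i := p l)) * \<psi> l w)"
    and "finite A" and "A \<subseteq> {..<N}"
  shows "F z = (\<Sum>k\<in>PiE A (\<lambda>_. {..<N}). F (\<lambda>i. if i \<in> A then p (k i) else z i) * (\<Prod>i\<in>A. \<psi> (k i) (z i)))"
  using assms(2,3)
proof (induction A)
  case empty
  then show ?case by simp
next
  case (insert a A)
  let ?E = "PiE A (\<lambda>_. {..<N})"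
  have a: "a < N" using insert by auto
  have "F z = (\<Sum>k\<in>?E. F (\<lambda>i. if i \<in> A then p (k i) else z i) * (\<Prod>i\<in>A. \<psi> (k i) (z i)))"
    using insert by auto
  also have "\<dots> = (\<Sum>k\<in>?E. \<Sum>l<N. F (\<lambda>i. if i \<in> insert a A then p ((k(a := l)) i) else z i) * (\<Prod>i\<in>insert a A. \<psi> ((k(a := l)) i) (z i)))"
  proof (intro sum.cong refl)
    fix k
    let ?z = "\<lambda>i. if i \<in> A then p (k i) else z i"
    have "?z = ?z(a := z a)" using insert by (auto simp: fun_eq_iff)
    then have "F ?z = F (?z(a := z a))" by simp
    also have "\<dots> = (\<Sum>l<N. F (?z(a := p l)) * \<psi> l (z a))"
      by (rule interp[OF a])
    finally have 1: "F ?z = (\<Sum>l<N. F (?z(a := p l)) * \<psi> l (z a))" .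
    have 2: "(\<Prod>i\<in>insert a A. \<psi> ((k(a := l)) i) (z i)) = \<psi> l (z a) * (\<Prod>i\<in>A. \<psi> (k i) (z i))" for l
    proof -
      have "(\<Prod>i\<in>A. \<psi> ((k(a := l)) i) (z i)) = (\<Prod>i\<in>A. \<psi> (k i) (z i))"
        using insert by (intro prod.cong) auto
      then show ?thesis using insert by simp
    qed
    have 3: "(\<lambda>i. if i \<in> insert a A then p ((k(a := l)) i) else z i) = ?z(a := p l)" for l
      using insert by (auto simp: fun_eq_iff)
    show "F ?z * (\<Prod>i\<in>A. \<psi> (k i) (z i)) = (\<Sum>l<N. F (\<lambda>i. if i \<in> insert a A then p ((k(a := l)) i) else z i) * (\<Prod>i\<in>insert a A. \<psi> ((k(a := l)) i) (z i)))"
      unfolding 1 2 3 sum_distrib_right by (intro sum.cong) (auto simp: ac_simps)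
  qed
  also have "\<dots> = (\<Sum>(l, k)\<in>{..<N} \<times> ?E. F (\<lambda>i. if i \<in> insert a A then p ((k(a := l)) i) else z i) * (\<Prod>i\<in>insert a A. \<psi> ((k(a := l)) i) (z i)))"
    by (subst sum.swap, subst sum.cartesian_product) simp
  also have "\<dots> = (\<Sum>k\<in>(\<lambda>(l, k). k(a := l)) ` ({..<N} \<times> ?E). F (\<lambda>i. if i \<in> insert a A then p (k i) else z i) * (\<Prod>i\<in>insert a A. \<psi> (k i) (z i)))"
  proof (subst sum.reindex)
    show "inj_on (\<lambda>(l, k). k(a := l)) ({..<N} \<times> ?E)"
      using insert.hyps(2) inj_combinator[of a A "\<lambda>_. {..<N}"] by simp
  qed (rule sum.cong, auto)
  also have "(\<lambda>(l, k). k(a := l)) ` ({..<N} \<times> ?E) = PiE (insert a A) (\<lambda>_. {..<N})"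
    by (simp add: PiE_insert_eq)
  finally show ?case .
qed

text \<open>After interpolation in every slot F is evaluated only at nodes. Repeated nodes give 0 by
  antisymmetry, rearrangements give a sign times F p, so a single value of F determines it.\<close>

lemma antisym_interpolation:
  fixes F :: "(nat \<Rightarrow> 'a) \<Rightarrow> complex"
  assumes interp: "\<And>z i w. i < N \<Longrightarrow> F (z(i := w)) = (\<Sum>l<N. F (z(i := p l)) * \<psi> l w)"
    and anti: "\<And>z i j. i < N \<Longrightarrow> j < N \<Longrightarrow> i \<noteq> j \<Longrightarrow> F (z \<circ> Transposition.transpose i j) = - F z"
    and loc: "\<And>z z'. (\<And>i. i < N \<Longrightarrow> z i = z' i) \<Longrightarrow> F z = F z'"
  shows "F z = F p * (\<Sum>\<sigma> | \<sigma> permutes {..<N}. of_int (sign \<sigma>) * (\<Prod>i<N. \<psi> (\<sigma> i) (z i)))"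
proof -
  let ?E = "PiE {..<N} (\<lambda>_. {..<N})" and ?S = "{\<sigma>. \<sigma> permutes {..<N}}"
  let ?r = "\<lambda>\<sigma>. restrict \<sigma> {..<N}"
  have r: "?r ` ?S = {k \<in> ?E. inj_on k {..<N}}"
  proof (intro subset_antisym subsetI)
    fix k assume "k \<in> ?r ` ?S"
    then obtain \<sigma> where s: "\<sigma> permutes {..<N}" and k: "k = ?r \<sigma>" by auto
    have "inj_on (?r \<sigma>) {..<N}" using s by (metis inj_on_restrict_eq permutes_inj_on)
    moreover have "?r \<sigma> \<in> ?E" using permutes_in_image[OF s] by auto
    ultimately show "k \<in> {k \<in> ?E. inj_on k {..<N}}" using k by simp
  next
    fix k assume "k \<in> {k \<in> ?E. inj_on k {..<N}}"
    then have k: "k \<in> ?E" "inj_on k {..<N}" by auto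
    define \<sigma> where "\<sigma> i = (if i < N then k i else i)" for i
    have "inj_on \<sigma> {..<N}" "\<sigma> ` {..<N} \<subseteq> {..<N}" using k by (auto simp: \<sigma>_def inj_on_def)
    then have "bij_betw \<sigma> {..<N} {..<N}"
      by (metis bij_betw_def endo_inj_surj finite_lessThan)
    then have "\<sigma> permutes {..<N}" by (rule bij_imp_permutes) (auto simp: \<sigma>_def)
    moreover have "k = ?r \<sigma>" using k by (auto simp: \<sigma>_def fun_eq_iff PiE_def extensional_def)
    ultimately show "k \<in> ?r ` ?S" by blast
  qed
  have inj: "inj_on ?r ?S"
  proof (rule inj_onI)
    fix s t assume "s \<in> ?S" "t \<in> ?S" "?r s = ?r t"
    then have "s i = t i" for i
      by (cases "i < N") (auto simp: permutes_not_in dest: fun_cong[where x = i])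
    then show "s = t" ..
  qed
  have fin: "finite ?E" by (intro finite_PiE) auto
  have zero: "F (\<lambda>i. if i \<in> {..<N} then p (k i) else z i) = 0" if "k \<in> ?E" and ni: "\<not> inj_on k {..<N}" for k
  proof -
    obtain a b where ab: "a < N" "b < N" "a \<noteq> b" "k a = k b" using ni by (auto simp: inj_on_def)
    let ?z = "\<lambda>i. if i \<in> {..<N} then p (k i) else z i"
    have "?z \<circ> Transposition.transpose a b = ?z" using ab by (auto simp: fun_eq_iff Transposition.transpose_def)
    then show ?thesis using anti[of a b ?z] ab by simp
  qed
  have "F z = (\<Sum>k\<in>?E. F (\<lambda>i. if i \<in> {..<N} then p (k i) else z i) * (\<Prod>i<N. \<psi> (k i) (z i)))"
    by (rule interpolate_slots[OF interp]) auto
  also have "\<dots> = (\<Sum>k\<in>?r ` ?S. F (\<lambda>i. if i \<in> {..<N} then p (k i) else z i) * (\<Prod>i<N. \<psi> (k i) (z i)))"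
    unfolding r by (rule sum.mono_neutral_right) (use fin zero in auto)
  also have "\<dots> = (\<Sum>\<sigma>\<in>?S. F p * (of_int (sign \<sigma>) * (\<Prod>i<N. \<psi> (\<sigma> i) (z i))))"
  proof (subst sum.reindex[OF inj], intro sum.cong refl)
    fix \<sigma> assume s: "\<sigma> \<in> ?S"
    have "F (\<lambda>i. if i \<in> {..<N} then p (?r \<sigma> i) else z i) = F (p \<circ> \<sigma>)" by (rule loc) simp
    also have "\<dots> = of_int (sign \<sigma>) * F p" by (rule antisym_permutes[OF anti]) (use s in auto)
    finally show "((\<lambda>k. F (\<lambda>i. if i \<in> {..<N} then p (k i) else z i) * (\<Prod>i<N. \<psi> (k i) (z i))) \<circ> ?r) \<sigma>
        = F p * (of_int (sign \<sigma>) * (\<Prod>i<N. \<psi> (\<sigma> i) (z i)))"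
      by (simp add: o_def)
  qed
  finally show ?thesis by (simp add: sum_distrib_left)
qed

text \<open>Nodes at which the determinant does not vanish admit dual functions
  \<open>\<psi>\<close> common to F and to the determinant. By interpolation each of the two is its
  value at p times the same sum \<open>G\<close>, so their quotient is constant.\<close>

lemma antisym_multispan_conv_detn:
  fixes F :: "(nat \<Rightarrow> 'a) \<Rightarrow> complex" and \<phi> :: "nat \<Rightarrow> 'a \<Rightarrow> complex"
  assumes p: "detn N (\<lambda>i m. \<phi> m (p i)) \<noteq> 0"
    and span: "\<And>z i. i < N \<Longrightarrow> \<exists>c. \<forall>w. F (z(i := w)) = (\<Sum>m<N. c m * \<phi> m w)"
    and anti: "\<And>z i j. i < N \<Longrightarrow> j < N \<Longrightarrow> i \<noteq> j \<Longrightarrow> F (z \<circ> Transposition.transpose i j) = - F z"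
    and loc: "\<And>z z'. (\<And>i. i < N \<Longrightarrow> z i = z' i) \<Longrightarrow> F z = F z'"
  shows "\<exists>C. \<forall>z. F z = C * detn N (\<lambda>i m. \<phi> m (z i))"
proof -
  let ?A = "mat N N (\<lambda>(i, m). \<phi> m (p i))"
  let ?D = "\<lambda>z. detn N (\<lambda>i m. \<phi> m (z i))"
  have "det ?A \<noteq> 0" using p by (simp add: detn_conv_det)
  then obtain B where B: "B \<in> carrier_mat N N" "B * ?A = 1\<^sub>m N"
    using det_non_zero_imp_unit[of ?A N] by (auto simp: Units_def ring_mat_def)
  \<comment> \<open>The coefficients are the columns of the inverse matrix; this makes every
    combination of the \<open>\<phi> m\<close> equal to the interpolant of its values at the
    nodes.\<close>
  define \<psi> where "\<psi> l w = (\<Sum>m<N. B $$ (m, l) * \<phi> m w)" for l w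
  have BA: "(\<Sum>l<N. B $$ (m, l) * \<phi> j (p l)) = (if m = j then 1 else 0)" if "m < N" "j < N" for m j
  proof -
    have "(B * ?A) $$ (m, j) = (\<Sum>l<N. B $$ (m, l) * \<phi> j (p l))"
      using B(1) that by (simp add: times_mat_def scalar_prod_def atLeast0LessThan)
    then show ?thesis using B(2) that by simp
  qed
  have interp: "f w = (\<Sum>l<N. f (p l) * \<psi> l w)" if f: "\<And>w. f w = (\<Sum>m<N. c m * \<phi> m w)" for f c w
  proof -
    have "(\<Sum>l<N. f (p l) * \<psi> l w) = (\<Sum>l<N. \<Sum>j<N. \<Sum>m<N. c j * \<phi> m w * (B $$ (m, l) * \<phi> j (p l)))"
      unfolding f \<psi>_def sum_product by (intro sum.cong refl) (simp add: ac_simps)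
    also have "\<dots> = (\<Sum>j<N. \<Sum>l<N. \<Sum>m<N. c j * \<phi> m w * (B $$ (m, l) * \<phi> j (p l)))"
      by (rule sum.swap)
    also have "\<dots> = (\<Sum>j<N. \<Sum>m<N. \<Sum>l<N. c j * \<phi> m w * (B $$ (m, l) * \<phi> j (p l)))"
      by (intro sum.cong refl sum.swap)
    also have "\<dots> = (\<Sum>j<N. \<Sum>m<N. c j * \<phi> m w * (if m = j then 1 else 0))"
      by (intro sum.cong refl) (simp add: BA flip: sum_distrib_left)
    also have "\<dots> = f w" by (simp add: f if_distrib cong: if_cong)
    finally show ?thesis ..
  qed
  have F: "F (z(i := w)) = (\<Sum>l<N. F (z(i := p l)) * \<psi> l w)" if i: "i < N" for z i w
  proof -
    obtain c where "\<forall>w. F (z(i := w)) = (\<Sum>m<N. c m * \<phi> m w)" using span[OF i, of z] by blast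
    then show ?thesis using interp[of "\<lambda>w. F (z(i := w))" c w] by simp
  qed
  have D: "?D (z(i := w)) = (\<Sum>l<N. ?D (z(i := p l)) * \<psi> l w)" if i: "i < N" for z i w
  proof -
    let ?S = "{\<sigma>. \<sigma> permutes {..<N}}"
    \<comment> \<open>Laplace expansion along slot i: permutations are grouped by the value they
      take at i.\<close>
    define c where "c m = (\<Sum>\<sigma>\<in>{\<sigma>\<in>?S. \<sigma> i = m}. of_int (sign \<sigma>) * (\<Prod>j\<in>{..<N} - {i}. \<phi> (\<sigma> j) (z j)))" for m
    have "?D (z(i := w)) = (\<Sum>m<N. c m * \<phi> m w)" for w
    proof -
      have "?D (z(i := w)) = (\<Sum>\<sigma>\<in>?S. of_int (sign \<sigma>) * (\<Prod>j\<in>{..<N} - {i}. \<phi> (\<sigma> j) (z j)) * \<phi> (\<sigma> i) w)"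
        unfolding detn_def
      proof (intro sum.cong refl)
        fix \<sigma>
        have "(\<Prod>j<N. \<phi> (\<sigma> j) ((z(i := w)) j)) = \<phi> (\<sigma> i) w * (\<Prod>j\<in>{..<N} - {i}. \<phi> (\<sigma> j) (z j))"
          using i by (subst prod.remove[of _ i]) auto
        then show "of_int (sign \<sigma>) * (\<Prod>j<N. \<phi> (\<sigma> j) ((z(i := w)) j)) = of_int (sign \<sigma>) * (\<Prod>j\<in>{..<N} - {i}. \<phi> (\<sigma> j) (z j)) * \<phi> (\<sigma> i) w"
          by simp
      qed
      also have "\<dots> = (\<Sum>m<N. \<Sum>\<sigma>\<in>{\<sigma>\<in>?S. \<sigma> i = m}. of_int (sign \<sigma>) * (\<Prod>j\<in>{..<N} - {i}. \<phi> (\<sigma> j) (z j)) * \<phi> (\<sigma> i) w)"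
        by (rule sum.group[symmetric]) (use i in \<open>auto simp: finite_permutations dest: permutes_in_image[of _ _ i]\<close>)
      also have "\<dots> = (\<Sum>m<N. c m * \<phi> m w)"
        unfolding c_def sum_distrib_right by (intro sum.cong) auto
      finally show ?thesis .
    qed
    then show ?thesis using interp[of "\<lambda>w. ?D (z(i := w))" c w] by simp
  qed
  have D_anti: "?D (z \<circ> Transposition.transpose i j) = - ?D z" if "i < N" "j < N" "i \<noteq> j" for z i j
  proof -
    let ?t = "Transposition.transpose i j"
    have t: "?t permutes {..<N}" using that by (simp add: permutes_swap_id)
    have "?D (z \<circ> ?t) = (\<Sum>\<sigma> | \<sigma> permutes {..<N}. of_int (sign (\<sigma> \<circ> ?t)) * (\<Prod>k<N. \<phi> ((\<sigma> \<circ> ?t) k) (z (?t k))))"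
      unfolding detn_def by (subst sum_permutations_compose_right[OF t]) simp
    also have "\<dots> = (\<Sum>\<sigma> | \<sigma> permutes {..<N}. - (of_int (sign \<sigma>) * (\<Prod>k<N. \<phi> (\<sigma> k) (z k))))"
    proof (intro sum.cong refl)
      fix \<sigma> assume s: "\<sigma> \<in> {\<sigma>. \<sigma> permutes {..<N}}"
      have "sign (\<sigma> \<circ> ?t) = - sign \<sigma>"
        using s t that by (subst sign_compose)
          (auto simp: sign_swap_id permutation_swap_id intro: permutes_imp_permutation finite_lessThan)
      moreover have "(\<Prod>k<N. \<phi> (\<sigma> k) (z k)) = (\<Prod>k<N. \<phi> ((\<sigma> \<circ> ?t) k) (z (?t k)))"
        by (subst prod.permute[OF t]) (simp add: o_def)
      ultimately show "of_int (sign (\<sigma> \<circ> ?t)) * (\<Prod>k<N. \<phi> ((\<sigma> \<circ> ?t) k) (z (?t k))) = - (of_int (sign \<sigma>) * (\<Prod>k<N. \<phi> (\<sigma> k) (z k)))"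
        by simp
    qed
    finally show ?thesis by (simp add: detn_def sum_negf)
  qed
  have D_loc: "?D z = ?D z'" if "\<And>i. i < N \<Longrightarrow> z i = z' i" for z z'
    using that by (simp add: detn_def)
  define G where "G z = (\<Sum>\<sigma> | \<sigma> permutes {..<N}. of_int (sign \<sigma>) * (\<Prod>i<N. \<psi> (\<sigma> i) (z i)))" for z
  have 1: "F z = F p * G z" for z
    unfolding G_def by (rule antisym_interpolation[OF F anti loc])
  have 2: "?D z = ?D p * G z" for z
    unfolding G_def by (rule antisym_interpolation[OF D D_anti D_loc])
  have "F z = F p / ?D p * ?D z" for z
    using 1[of z] 2[of z] p by simp
  then show ?thesis by blast
qed

subsection \<open>Fourier expansions\<close>

text \<open>\<open>has_sum\<close> is a limit over finite index sets, so the remainder is estimated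
  for each of them: it is at most the tail of b times the measure of A, and this tail tends to 0
  along the same net.\<close>

lemma has_sum_set_integral:
  fixes f :: "'i \<Rightarrow> 'a \<Rightarrow> complex"
  assumes A: "A \<in> sets M" "emeasure M A < \<infinity>"
    and f: "\<And>i. i \<in> I \<Longrightarrow> f i \<in> borel_measurable M" and F: "F \<in> borel_measurable M"
    and le: "\<And>i x. i \<in> I \<Longrightarrow> x \<in> A \<Longrightarrow> norm (f i x) \<le> b i" and b: "b summable_on I"
    and sum: "\<And>x. x \<in> A \<Longrightarrow> ((\<lambda>i. f i x) has_sum F x) I"
  shows "((\<lambda>i. LINT x:A|M. f i x) has_sum (LINT x:A|M. F x)) I"
proof -
  let ?B = "infsum b I"
  have Fle: "norm (F x) \<le> ?B" if "x \<in> A" for x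
    using norm_infsum_le[OF sum[OF that] has_sum_infsum[OF b]] le that by auto
  have bounded_int: "set_integrable M A g" if "g \<in> borel_measurable M" "\<And>x. x \<in> A \<Longrightarrow> norm (g x) \<le> C" for g :: "'a \<Rightarrow> complex" and C
    unfolding set_integrable_def
    by (rule integrableI_bounded_set_indicator[where B = C]) (use A that in auto)
  have fi: "set_integrable M A (f i)" if "i \<in> I" for i
    using bounded_int[OF f[OF that]] le[OF that] by blast
  have Fi: "set_integrable M A F" using bounded_int[OF F Fle] .
  have bound: "norm ((\<Sum>i\<in>X. LINT x:A|M. f i x) - (LINT x:A|M. F x)) \<le> (?B - sum b X) * measure M A"
    if X: "finite X" "X \<subseteq> I" for X
  proof -
    have "(\<Sum>i\<in>X. LINT x:A|M. f i x) = (LINT x:A|M. (\<Sum>i\<in>X. f i x))"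
      unfolding set_lebesgue_integral_def
      by (subst Bochner_Integration.integral_sum[symmetric])
         (use fi X in \<open>auto simp: set_integrable_def scaleR_sum_right subset_iff\<close>)
    moreover have Si: "set_integrable M A (\<lambda>x. \<Sum>i\<in>X. f i x)"
      using fi X unfolding set_integrable_def scaleR_sum_right by (intro Bochner_Integration.integrable_sum) auto
    ultimately have "(\<Sum>i\<in>X. LINT x:A|M. f i x) - (LINT x:A|M. F x) = (LINT x:A|M. (\<Sum>i\<in>X. f i x) - F x)"
      using Fi by (simp add: set_integral_diff)
    also have "norm \<dots> \<le> (LINT x:A|M. ?B - sum b X)"
    proof -
      have "norm ((\<Sum>i\<in>X. f i x) - F x) \<le> ?B - sum b X" if x: "x \<in> A" for x
      proof -
        have 1: "((\<lambda>i. f i x) has_sum (F x - (\<Sum>i\<in>X. f i x))) (I - X)"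
          using X sum[OF x] by (intro has_sum_Diff) auto
        have 2: "(b has_sum (?B - sum b X)) (I - X)"
          using X b by (intro has_sum_Diff) auto
        have "norm (F x - (\<Sum>i\<in>X. f i x)) \<le> ?B - sum b X"
          by (rule norm_infsum_le[OF 1 2]) (use le x in auto)
        then show ?thesis by (simp add: norm_minus_commute)
      qed
      moreover have "set_integrable M A (\<lambda>x. (\<Sum>i\<in>X. f i x) - F x)" using Si Fi by (rule set_integral_diff)
      moreover have "set_integrable M A (\<lambda>_. ?B - sum b X)"
        unfolding set_integrable_def using A by (intro integrable_scaleR_left integrable_real_indicator) auto
      ultimately show ?thesis
        unfolding set_lebesgue_integral_def set_integrable_def
        by (intro order_trans[OF integral_norm_bound integral_mono] integrable_norm) (simp_all add: indicator_def)
    qed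
    also have "\<dots> = (?B - sum b X) * measure M A"
      using A by (simp add: set_lebesgue_integral_def)
    finally show ?thesis .
  qed
  have "((\<lambda>X. (?B - sum b X) * measure M A) \<longlongrightarrow> (?B - ?B) * measure M A) (finite_subsets_at_top I)"
    using b by (intro tendsto_intros infsum_tendsto)
  then have lim: "((\<lambda>X. (?B - sum b X) * measure M A) \<longlongrightarrow> 0) (finite_subsets_at_top I)"
    by simp
  have "((\<lambda>X. (\<Sum>i\<in>X. LINT x:A|M. f i x) - (LINT x:A|M. F x)) \<longlongrightarrow> 0) (finite_subsets_at_top I)"
    by (rule Lim_null_comparison[OF _ lim], rule eventually_finite_subsets_at_top_weakI, rule bound)
  then show ?thesis
    unfolding has_sum_def by (simp add: LIM_zero_iff)
qed

text \<open>The passage from gauge integrals over closed intervals to Lebesgue integrals over the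
  half-open sides of \<open>Lambda\<close>.\<close>

lemma has_integral_Ico:
  fixes f :: "real \<Rightarrow> 'b::euclidean_space"
  assumes "continuous_on {a..b} f" and "(f has_integral I) {a..b}"
  shows "set_integrable lborel {a..<b} f" and "(LINT x:{a..<b}|lborel. f x) = I"
proof -
  show i: "set_integrable lborel {a..<b} f"
    by (rule set_integrable_subset[OF borel_integrable_atLeastAtMost'[OF assms(1)]]) auto
  have "(f has_integral I) {a..<b}"
    using assms(2) by (rule has_integral_spike_set_eq[THEN iffD1, rotated 2])
      (auto intro: negligible_subset[of "{a, b}"])
  then show "(LINT x:{a..<b}|lborel. f x) = I"
    using set_borel_integral_eq_integral(2)[OF i] by (simp add: integral_unique)
qed

section \<open>Exponentials of period one\<close>

definition qexp :: "complex \<Rightarrow> complex" where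
  "qexp z = exp (2 * of_real pi * \<i> * z)"

lemma qexp_add: "qexp (a + b) = qexp a * qexp b"
  by (simp add: qexp_def exp_add distrib_left)

lemma qexp_0 [simp]: "qexp 0 = 1"
  by (simp add: qexp_def)

lemma qexp_nonzero [simp]: "qexp z \<noteq> 0"
  by (simp add: qexp_def)

lemma qexp_minus: "qexp (- z) = inverse (qexp z)"
  by (simp add: qexp_def exp_minus)

lemma qexp_diff: "qexp (a - b) = qexp a / qexp b"
  by (simp add: qexp_def exp_diff right_diff_distrib)

lemma norm_qexp: "norm (qexp z) = exp (- 2 * pi * Im z)"
  by (simp add: qexp_def norm_exp_eq_Re)

lemma qexp_of_int [simp]: "qexp (of_int n) = 1"
  using exp_integer_2pi[of "of_int n"] by (simp add: qexp_def mult_ac)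

lemma qexp_of_nat_mult: "qexp (of_nat n * z) = qexp z ^ n"
  by (simp add: qexp_def exp_of_nat_mult[symmetric] mult_ac)

lemma continuous_on_qexp [continuous_intros]: "continuous_on A f \<Longrightarrow> continuous_on A (\<lambda>z. qexp (f z))"
  unfolding qexp_def by (intro continuous_intros)

lemma borel_measurable_qexp [measurable]: "qexp \<in> borel_measurable borel"
  by (intro borel_measurable_continuous_onI continuous_on_qexp continuous_on_id)

lemma integral_qexp:
  fixes n :: int
  assumes "0 < L"
  shows "(LINT x:{0..<L}|lborel. qexp (of_int n * of_real x / of_real L)) = (if n = 0 then of_real L else 0)"
proof (cases "n = 0")
  case True
  have "((\<lambda>x. 1::complex) has_integral (L - 0) *\<^sub>R 1) {0..L}"
    using has_integral_const_real[of "1::complex" 0 L] assms by simp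
  then show ?thesis
    using True by (simp add: has_integral_Ico(2)[of 0 L "\<lambda>_. 1"] scaleR_conv_of_real)
next
  case False
  let ?c = "2 * of_real pi * \<i> * of_int n / of_real L :: complex"
  have c: "?c \<noteq> 0" using False assms by auto
  have "((\<lambda>x. exp (?c * of_real x)) has_integral exp (?c * of_real L) / ?c - exp (?c * of_real 0) / ?c) {0..L}"
  proof (rule fundamental_theorem_of_calculus)
    fix x
    have "((\<lambda>z. exp (?c * z) / ?c) has_field_derivative exp (?c * of_real x)) (at (of_real x))"
      using c by (auto intro!: derivative_eq_intros)
    from has_vector_derivative_real_field[OF this]
    show "((\<lambda>x. exp (?c * of_real x) / ?c) has_vector_derivative exp (?c * of_real x)) (at x within {0..L})"
      by (rule has_vector_derivative_at_within)
  qed (use assms in auto)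
  moreover have "exp (?c * of_real L) = 1"
    using qexp_of_int[of n] assms by (simp add: qexp_def)
  ultimately have "((\<lambda>x. qexp (of_int n * of_real x / of_real L)) has_integral 0) {0..L}"
    by (simp add: qexp_def mult_ac)
  then show ?thesis
    using False assms by (subst has_integral_Ico(2)) (auto intro!: continuous_intros)
qed

text \<open>The frequencies lie in s + Z; s = -1/2 occurs for theta_1, and other offsets arise from
  products. Demanding the expansion at all complex v, with unordered and hence absolute convergence,
  makes translation by tau harmless.\<close>

definition fourier :: "complex \<Rightarrow> (int \<Rightarrow> complex) \<Rightarrow> (complex \<Rightarrow> complex) \<Rightarrow> bool" where
  "fourier s c f \<longleftrightarrow> (\<forall>v. ((\<lambda>m. c m * qexp ((of_int m + s) * v)) has_sum f v) UNIV)"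

lemma fourierD: "fourier s c f \<Longrightarrow> ((\<lambda>m. c m * qexp ((of_int m + s) * v)) has_sum f v) UNIV"
  by (simp add: fourier_def)

lemma has_sum_mult_Times:
  fixes f :: "'a \<Rightarrow> complex" and g :: "'b \<Rightarrow> complex"
  assumes f: "(f has_sum S) A" and g: "(g has_sum T) B"
  shows "((\<lambda>(x, y). f x * g y) has_sum (S * T)) (A \<times> B)"
proof (rule has_sum_SigmaI[where g = "\<lambda>x. f x * T"])
  fix x
  show "((\<lambda>y. case (x, y) of (x, y) \<Rightarrow> f x * g y) has_sum f x * T) B"
    using g by (simp add: has_sum_cmult_right)
next
  show "((\<lambda>x. f x * T) has_sum S * T) A"
    using f by (rule has_sum_cmult_left)
next
  have "(\<lambda>x. norm (f x)) summable_on A" "(\<lambda>x. norm (g x)) summable_on B"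
    using f g by (auto simp flip: summable_on_iff_abs_summable_on_complex intro: has_sum_imp_summable)
  then have "(\<lambda>(x, y). norm (f x) * norm (g y)) summable_on A \<times> B"
    by (intro summable_on_SigmaI[where g = "\<lambda>x. norm (f x) * infsum (\<lambda>y. norm (g y)) B"])
       (auto intro!: has_sum_cmult_right summable_on_cmult_left)
  then have "(\<lambda>x. norm (case x of (x, y) \<Rightarrow> f x * g y)) summable_on A \<times> B"
    by (simp add: case_prod_unfold norm_mult)
  then show "(\<lambda>(x, y). f x * g y) summable_on A \<times> B"
    by (rule abs_summable_summable)
qed

text \<open>The Cauchy product. Later arguments rest on the offset, which is why the coefficients
  are left unspecified.\<close>

lemma fourier_mult:
  assumes f: "fourier s c f" and g: "fourier t d g"
  shows "\<exists>b. fourier (s + t) b (\<lambda>v. f v * g v)"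
proof -
  have bij: "bij_betw (\<lambda>(k, n). (k - n, n)) (UNIV \<times> UNIV) (UNIV \<times> (UNIV :: int set))" for T
    by (rule bij_betw_byWitness[where f' = "\<lambda>(m, n). (m + n, n)"]) auto
  have main: "((\<lambda>(k, n). c (k - n) * d n * qexp ((of_int k + (s + t)) * v)) has_sum f v * g v) (UNIV \<times> UNIV)" for v
  proof -
    have "((\<lambda>(m, n). (c m * qexp ((of_int m + s) * v)) * (d n * qexp ((of_int n + t) * v))) has_sum f v * g v) (UNIV \<times> UNIV)"
      by (rule has_sum_mult_Times) (use f g in \<open>auto dest: fourierD\<close>)
    then have "((\<lambda>x. (\<lambda>(m, n). (c m * qexp ((of_int m + s) * v)) * (d n * qexp ((of_int n + t) * v))) ((\<lambda>(k, n). (k - n, n)) x)) has_sum f v * g v) (UNIV \<times> UNIV)"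
      by (subst has_sum_reindex_bij_betw[OF bij])
    also have "(\<lambda>x. (\<lambda>(m, n). (c m * qexp ((of_int m + s) * v)) * (d n * qexp ((of_int n + t) * v))) ((\<lambda>(k, n). (k - n, n)) x))
      = (\<lambda>(k, n). c (k - n) * d n * qexp ((of_int k + (s + t)) * v))"
    proof -
      have "qexp ((of_int (k - n) + s) * v) * qexp ((of_int n + t) * v) = qexp ((of_int k + (s + t)) * v)" for k n :: int
        by (simp add: qexp_add[symmetric] algebra_simps)
      then show ?thesis by (auto simp: fun_eq_iff mult_ac)
    qed
    finally show ?thesis .
  qed
  define b where "b k = infsum (\<lambda>n. c (k - n) * d n) UNIV" for k
  have b: "((\<lambda>n. c (k - n) * d n) has_sum b k) UNIV" for k
  proof -
    \<comment> \<open>At v = 0 the exponentials are 1, so this shows that the sum defining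
      \<open>b k\<close> converges.\<close>
    have "(\<lambda>n. c (k - n) * d n * qexp ((of_int k + (s + t)) * 0)) summable_on UNIV"
      using summable_on_SigmaD1[OF has_sum_imp_summable[OF main[of 0], unfolded UNIV_Times_UNIV[symmetric]], of k] by simp
    then show ?thesis by (simp add: b_def)
  qed
  have "fourier (s + t) b (\<lambda>v. f v * g v)"
    unfolding fourier_def
  proof
    fix v
    show "((\<lambda>m. b m * qexp ((of_int m + (s + t)) * v)) has_sum f v * g v) UNIV"
      by (rule has_sum_SigmaD[OF main]) (use b in \<open>auto intro: has_sum_cmult_left\<close>)
  qed
  then show ?thesis by blast
qed

lemma fourier_cmult: "fourier s c f \<Longrightarrow> fourier s (\<lambda>m. a * c m) (\<lambda>v. a * f v)"
  unfolding fourier_def by (auto simp: mult.assoc intro: has_sum_cmult_right)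

lemma fourier_translate: "fourier s c f \<Longrightarrow> fourier s (\<lambda>m. c m * qexp ((of_int m + s) * a)) (\<lambda>v. f (v + a))"
  unfolding fourier_def
proof
  fix v assume "\<forall>v. ((\<lambda>m. c m * qexp ((of_int m + s) * v)) has_sum f v) UNIV"
  then have "((\<lambda>m. c m * qexp ((of_int m + s) * (v + a))) has_sum f (v + a)) UNIV" by blast
  then show "((\<lambda>m. c m * qexp ((of_int m + s) * a) * qexp ((of_int m + s) * v)) has_sum f (v + a)) UNIV"
    by (simp add: distrib_left[of _ v a] qexp_add mult.assoc mult.commute[of "qexp (_ * v)"])
qed

text \<open>Together with \<open>fourier_translate\<close> this turns quasi-periodicity of f into a
  recursion for its coefficients.\<close>

lemma fourier_modulate:
  assumes "fourier s c f"
  shows "fourier s (\<lambda>m. c (m + k)) (\<lambda>v. qexp (- of_int k * v) * f v)"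
  unfolding fourier_def
proof
  fix v
  have "((\<lambda>m. c (m + k) * qexp ((of_int (m + k) + s) * v)) has_sum f v) UNIV"
    using fourierD[OF assms, of v] has_sum_reindex_bij_betw[of "\<lambda>m. m + k" UNIV UNIV "\<lambda>m. c m * qexp ((of_int m + s) * v)" "f v"]
    by (simp add: bij_plus_right)
  from has_sum_cmult_right[OF this, of "qexp (- of_int k * v)"]
  have "((\<lambda>m. qexp (- of_int k * v) * (c (m + k) * qexp ((of_int (m + k) + s) * v))) has_sum qexp (- of_int k * v) * f v) UNIV" .
  moreover have "qexp (- of_int k * v) * qexp ((of_int (m + k) + s) * v) = qexp ((of_int m + s) * v)" for m
    by (simp add: qexp_add[symmetric] algebra_simps)
  ultimately show "((\<lambda>m. c (m + k) * qexp ((of_int m + s) * v)) has_sum qexp (- of_int k * v) * f v) UNIV"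
    by (simp add: mult.left_commute)
qed

lemma fourier_double:
  assumes "fourier s c f"
  shows "\<exists>d. fourier (2 * s) d (\<lambda>v. f (2 * v))"
proof -
  define d where "d m = (if even m then c (m div 2) else 0)" for m
  have "fourier (2 * s) d (\<lambda>v. f (2 * v))"
    unfolding fourier_def
  proof
    fix v
    have "((\<lambda>m. d m * qexp ((of_int m + 2 * s) * v)) has_sum f (2 * v)) (range (\<lambda>m. 2 * m))"
      using fourierD[OF assms, of "2 * v"]
      by (subst has_sum_reindex) (auto simp: d_def o_def inj_on_def algebra_simps)
    then show "((\<lambda>m. d m * qexp ((of_int m + 2 * s) * v)) has_sum f (2 * v)) UNIV"
      by (rule has_sum_cong_neutral[THEN iffD1, rotated -1]) (auto simp: d_def elim!: evenE)
  qed
  then show ?thesis by blast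
qed

lemma fourier_shift_index:
  assumes "fourier (s + of_int k) c f"
  shows "\<exists>d. fourier s d f"
proof -
  have "fourier s (\<lambda>m. c (m - k)) f"
    unfolding fourier_def
  proof
    fix v
    have "((\<lambda>m. c (m + (- k)) * qexp ((of_int (m + (- k)) + (s + of_int k)) * v)) has_sum f v) UNIV"
      using fourierD[OF assms, of v]
        has_sum_reindex_bij_betw[of "\<lambda>m. m + (- k)" UNIV UNIV "\<lambda>m. c m * qexp ((of_int m + (s + of_int k)) * v)" "f v"]
        bij_plus_right[of "- k"]
      by simp
    then show "((\<lambda>m. c (m - k) * qexp ((of_int m + s) * v)) has_sum f v) UNIV"
      by (simp add: algebra_simps)
  qed
  then show ?thesis by blast
qed

text \<open>On a real period, after multiplication by the exponential of frequency -(k + s), all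
  exponentials have integer frequency and modulus 1. The coefficients of the difference then
  dominate its series, and termwise integration leaves only m = k.\<close>

lemma fourier_unique:
  assumes "fourier s c f" "fourier s d f"
  shows "c = d"
proof
  fix k
  define a where "a m = c m - d m" for m
  have a0: "((\<lambda>m. a m * qexp ((of_int m + s) * v)) has_sum 0) UNIV" for v
    using has_sum_add[OF fourierD[OF assms(1), of v] has_sum_cmult_right[OF fourierD[OF assms(2), of v], of "-1"]]
    by (simp add: a_def left_diff_distrib)
  have sum: "(\<lambda>m. norm (a m)) summable_on UNIV"
    using a0[of 0] by (auto simp flip: summable_on_iff_abs_summable_on_complex dest: has_sum_imp_summable)
  have a: "((\<lambda>m. a m * qexp (of_int (m - k) * of_real x / of_real 1)) has_sum 0) UNIV" for x :: real
  proof -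
    have eq: "a m * qexp (of_int (m - k) * of_real x) = a m * qexp ((of_int m + s) * of_real x) * qexp (- (of_int k + s) * of_real x)" for m
      by (simp add: mult.assoc qexp_add[symmetric]) (simp add: algebra_simps)
    show ?thesis unfolding of_real_1 div_by_1 eq
      using has_sum_cmult_left[OF a0[of "of_real x"], of "qexp (- (of_int k + s) * of_real x)"]
      unfolding mult_zero_left .
  qed
  have "((\<lambda>m. LINT x:{0..<1}|lborel. a m * qexp (of_int (m - k) * of_real x / of_real 1)) has_sum (LINT x:{0..<1::real}|lborel. 0)) UNIV"
    by (rule has_sum_set_integral[where b = "\<lambda>m. norm (a m)"]) (use a sum in \<open>auto simp: norm_mult norm_qexp\<close>)
  moreover have one: "(0::real) < 1" by simp
  ultimately have "((\<lambda>m. a m * (if m - k = 0 then of_real 1 else 0)) has_sum 0) UNIV"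
    by (simp only: set_integral_mult_right integral_qexp[OF one]) simp
  moreover have "((\<lambda>m. a m * (if m - k = 0 then of_real 1 else 0)) has_sum a k) UNIV"
    by (rule has_sum_finite_neutralI[of "{k}"]) auto
  ultimately have "a k = 0" by (rule has_sum_unique[symmetric])
  then show "c k = d k" by (simp add: a_def)
qed

subsection \<open>The triple product\<close>

text \<open>Two expansions of f(v + tau), by translation and by the functional equation, give c (m +
  N) = c m times qexp(N tau / 2 + (m + s) tau). The Gaussian in the conclusion solves this
  recursion, so the quotient by it is periodic.\<close>

lemma fourier_quasi_periodic:
  assumes c: "fourier s c f" and "0 < N"
    and f: "\<And>v. f (v + \<tau>) = qexp (- (of_nat N * v) - of_nat N * \<tau> / 2) * f v"
  obtains d where "\<And>m. d (m + int N) = d m"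
    and "\<And>m. c m = d m * qexp (\<tau> * (of_int m + s)\<^sup>2 / (2 * of_nat N))"
proof -
  have 1: "fourier s (\<lambda>m. c m * qexp ((of_int m + s) * \<tau>)) (\<lambda>v. f (v + \<tau>))"
    using c by (rule fourier_translate)
  have "fourier s (\<lambda>m. qexp (- (of_nat N * \<tau> / 2)) * c (m + int N)) (\<lambda>v. qexp (- (of_nat N * \<tau> / 2)) * (qexp (- of_int (int N) * v) * f v))"
    by (rule fourier_cmult[OF fourier_modulate[OF c, of "int N"], of "qexp (- (of_nat N * \<tau> / 2))"])
  also have "(\<lambda>v. qexp (- (of_nat N * \<tau> / 2)) * (qexp (- of_int (int N) * v) * f v)) = (\<lambda>v. f (v + \<tau>))"
  proof
    fix v
    have "- (of_nat N * v) - of_nat N * \<tau> / 2 = - (of_nat N * \<tau> / 2) + (- of_int (int N) * v)" by simp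
    then show "qexp (- (of_nat N * \<tau> / 2)) * (qexp (- of_int (int N) * v) * f v) = f (v + \<tau>)"
      unfolding f by (simp only: qexp_add mult.assoc)
  qed
  finally have 2: "fourier s (\<lambda>m. qexp (- (of_nat N * \<tau> / 2)) * c (m + int N)) (\<lambda>v. f (v + \<tau>))" .
  have eq: "qexp (- (of_nat N * \<tau> / 2)) * c (m + int N) = c m * qexp ((of_int m + s) * \<tau>)" for m
    using fun_cong[OF fourier_unique[OF 1 2], of m] by simp
  define d where "d m = c m * qexp (- (\<tau> * (of_int m + s)\<^sup>2 / (2 * of_nat N)))" for m
  show ?thesis
  proof
    fix m
    show "c m = d m * qexp (\<tau> * (of_int m + s)\<^sup>2 / (2 * of_nat N))"
      by (simp add: d_def mult.assoc qexp_minus)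
    have N: "of_nat N \<noteq> (0::complex)" using \<open>0 < N\<close> by simp
    have "c (m + int N) = qexp (of_nat N * \<tau> / 2) * (qexp (- (of_nat N * \<tau> / 2)) * c (m + int N))"
      by (simp add: qexp_minus)
    also have "\<dots> = c m * (qexp (of_nat N * \<tau> / 2) * qexp ((of_int m + s) * \<tau>))"
      unfolding eq by (simp only: mult_ac)
    finally have "c (m + int N) = c m * qexp (of_nat N * \<tau> / 2 + (of_int m + s) * \<tau>)"
      by (simp add: qexp_add)
    moreover have "of_nat N * \<tau> / 2 + (of_int m + s) * \<tau> - \<tau> * (of_int (m + int N) + s)\<^sup>2 / (2 * of_nat N)
        = - (\<tau> * (of_int m + s)\<^sup>2 / (2 * of_nat N))"
      using N by (simp add: field_simps power2_eq_square)
    ultimately show "d (m + int N) = d m"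
      unfolding d_def by (simp add: mult.assoc flip: qexp_add)
  qed
qed

text \<open>Euler's coefficient (-1)^k q^(k (k - 1) / 2) / ((1 - q) ... (1 - q^k)), written through
  its successive quotients.\<close>

definition qpoch_coeff :: "complex \<Rightarrow> nat \<Rightarrow> complex" where
  "qpoch_coeff q k = (\<Prod>i<k. - (q ^ i) / (1 - q ^ Suc i))"

text \<open>Euler's expansion of the infinite product of the factors \<open>1 - w q\<^sup>n\<close>, \<open>n \<ge> 0\<close>.
  Working with the power series gives the functional equation and the zeros without any product.\<close>
definition qpoch :: "complex \<Rightarrow> complex \<Rightarrow> complex" where
  "qpoch q w = (\<Sum>k. qpoch_coeff q k * w ^ k)"

lemma qpoch_summable:
  assumes "norm q < 1"
  shows "summable (\<lambda>k. norm (qpoch_coeff q k * w ^ k))"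
proof -
  have "(\<lambda>k. - (q ^ k) / (1 - q ^ Suc k) * w) \<longlonglongrightarrow> - 0 / (1 - 0) * w"
    using assms by (intro tendsto_intros LIMSEQ_Suc[OF LIMSEQ_power_zero] LIMSEQ_power_zero) auto
  then have "(\<lambda>k. norm (- (q ^ k) / (1 - q ^ Suc k) * w)) \<longlonglongrightarrow> 0"
    using tendsto_norm by force
  then have "eventually (\<lambda>k. norm (- (q ^ k) / (1 - q ^ Suc k) * w) < 1/2) sequentially"
    by (rule order_tendstoD) simp
  then obtain K where K: "\<And>k. k \<ge> K \<Longrightarrow> norm (- (q ^ k) / (1 - q ^ Suc k) * w) < 1/2"
    by (auto simp: eventually_sequentially)
  show ?thesis
  proof (rule summable_ratio_test[where c = "1/2" and N = K])
    fix k assume "K \<le> k"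
    have "norm (qpoch_coeff q (Suc k) * w ^ Suc k) = norm (- (q ^ k) / (1 - q ^ Suc k) * w) * norm (qpoch_coeff q k * w ^ k)"
      by (simp add: qpoch_coeff_def norm_mult norm_divide)
    also have "\<dots> \<le> 1/2 * norm (qpoch_coeff q k * w ^ k)"
      using K[OF \<open>K \<le> k\<close>] by (intro mult_right_mono) auto
    finally show "norm (norm (qpoch_coeff q (Suc k) * w ^ Suc k)) \<le> 1/2 * norm (norm (qpoch_coeff q k * w ^ k))"
      by simp
  qed simp
qed

lemma qpoch_sums: "norm q < 1 \<Longrightarrow> (\<lambda>k. qpoch_coeff q k * w ^ k) sums qpoch q w"
  unfolding qpoch_def by (intro summable_sums summable_norm_cancel[OF qpoch_summable])

lemma qpoch_0 [simp]: "qpoch q 0 = 1"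
  using powser_zero[of "qpoch_coeff q"] by (simp add: qpoch_def qpoch_coeff_def)

lemma power_neq_1:
  fixes q :: complex
  assumes "norm q < 1"
  shows "q ^ Suc k \<noteq> 1"
proof
  assume "q ^ Suc k = 1"
  then have "norm q ^ Suc k = 1" by (metis norm_one norm_power)
  then show False using assms power_Suc_less_one[of "norm q" k] by (cases "q = 0") auto
qed

text \<open>Read off from the coefficients a of the series: a (k + 1) (1 - q^(k + 1)) = - a k q^k is
  the relation qpoch(w) - qpoch(q w) = - w qpoch(q w) in degree k + 1.\<close>

lemma qpoch_rec:
  assumes q: "norm q < 1"
  shows "qpoch q w = (1 - w) * qpoch q (q * w)"
proof -
  let ?a = "qpoch_coeff q"
  have "(\<lambda>k. ?a k * w ^ k - ?a k * (q * w) ^ k) sums (qpoch q w - qpoch q (q * w))"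
    by (intro sums_diff qpoch_sums q)
  then have "(\<lambda>k. ?a (Suc k) * w ^ Suc k - ?a (Suc k) * (q * w) ^ Suc k) sums (qpoch q w - qpoch q (q * w))"
    by (subst sums_Suc_iff) simp
  moreover have "?a (Suc k) * w ^ Suc k - ?a (Suc k) * (q * w) ^ Suc k = - w * (?a k * (q * w) ^ k)" for k
  proof -
    have "?a (Suc k) * (1 - q ^ Suc k) = - ?a k * q ^ k"
      using power_neq_1[OF q, of k] by (simp add: qpoch_coeff_def)
    then have "?a (Suc k) * (1 - q ^ Suc k) * w ^ Suc k = - ?a k * q ^ k * w ^ Suc k" by simp
    then show ?thesis by (simp add: algebra_simps power_mult_distrib)
  qed
  ultimately have "(\<lambda>k. - w * (?a k * (q * w) ^ k)) sums (qpoch q w - qpoch q (q * w))" by simp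
  moreover have "(\<lambda>k. - w * (?a k * (q * w) ^ k)) sums (- w * qpoch q (q * w))"
    by (intro sums_mult qpoch_sums q)
  ultimately have "qpoch q w - qpoch q (q * w) = - w * qpoch q (q * w)" by (rule sums_unique2)
  then show ?thesis by (simp add: algebra_simps)
qed

lemma holomorphic_qpoch:
  assumes "norm q < 1"
  shows "qpoch q holomorphic_on UNIV"
proof -
  have "qpoch q holomorphic_on ball 0 r" for r
    by (rule power_series_holomorphic[where a = "qpoch_coeff q"]) (use qpoch_sums[OF assms] in simp)
  then show ?thesis
    unfolding holomorphic_on_def
    by (metis at_within_open dist_0_norm field_differentiable_at_within holomorphic_on_imp_differentiable_at
        less_add_one mem_ball open_ball)
qed

lemma holomorphic_qpoch_compose [holomorphic_intros]:
  assumes "norm q < 1" "f holomorphic_on A"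
  shows "(\<lambda>z. qpoch q (f z)) holomorphic_on A"
  using holomorphic_on_compose_gen[OF assms(2) holomorphic_qpoch[OF assms(1)]] by (simp add: o_def)

lemma continuous_on_qpoch [continuous_intros]:
  assumes "norm q < 1" "continuous_on A f"
  shows "continuous_on A (\<lambda>z. qpoch q (f z))"
  using continuous_on_compose2[OF holomorphic_on_imp_continuous_on[OF holomorphic_qpoch[OF assms(1)]] assms(2)]
  by simp

text \<open>If no factor 1 - w q^k vanishes, the functional equation carries the zero w along w q^k
  to the limit 0, where the function is 1.\<close>

lemma qpoch_eq_0D:
  assumes q: "norm q < 1" and 0: "qpoch q w = 0"
  shows "\<exists>k. w * q ^ k = 1"
proof (rule ccontr)
  assume no: "\<not> ?thesis"
  have z: "qpoch q (w * q ^ k) = 0" for k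
  proof (induction k)
    case (Suc k)
    have "(1 - w * q ^ k) * qpoch q (q * (w * q ^ k)) = 0"
      using Suc qpoch_rec[OF q, of "w * q ^ k"] by simp
    moreover have "1 - w * q ^ k \<noteq> 0" using no by (metis eq_iff_diff_eq_0)
    ultimately show ?case by (simp add: mult_ac)
  qed (use 0 in simp)
  have "(\<lambda>k. w * q ^ k) \<longlonglongrightarrow> w * 0"
    using q by (intro tendsto_intros LIMSEQ_power_zero)
  then have "(\<lambda>k. w * q ^ k) \<longlonglongrightarrow> 0" by simp
  moreover have "isCont (qpoch q) 0"
    using holomorphic_on_imp_continuous_on[OF holomorphic_qpoch[OF q]] by (simp add: continuous_on_eq_continuous_at)
  ultimately have "(\<lambda>k. qpoch q (w * q ^ k)) \<longlonglongrightarrow> qpoch q 0"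
    by (rule isCont_tendsto_compose[rotated])
  then have "qpoch q 0 = 0" unfolding z by (simp add: LIMSEQ_const_iff)
  then show False by simp
qed

text \<open>The sign \<epsilon> decides on which half of the integers the coefficients live; the
  triple product takes one series of each kind.\<close>

lemma fourier_qpoch:
  fixes \<epsilon> :: int
  assumes q: "norm q < 1" and \<epsilon>: "\<epsilon> = 1 \<or> \<epsilon> = -1"
  shows "\<exists>c. fourier 0 c (\<lambda>v. qpoch q (b * qexp (of_int \<epsilon> * v)))"
proof -
  let ?h = "\<lambda>k. \<epsilon> * int k"
  define c where "c m = (if m \<in> range ?h then qpoch_coeff q (nat (\<epsilon> * m)) * b ^ nat (\<epsilon> * m) else 0)" for m
  have \<epsilon>\<epsilon>: "\<epsilon> * (\<epsilon> * m) = m" for m using \<epsilon> by auto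
  have "fourier 0 c (\<lambda>v. qpoch q (b * qexp (of_int \<epsilon> * v)))"
    unfolding fourier_def
  proof
    fix v
    have "((\<lambda>k. qpoch_coeff q k * (b * qexp (of_int \<epsilon> * v)) ^ k) has_sum qpoch q (b * qexp (of_int \<epsilon> * v))) UNIV"
      by (rule norm_summable_imp_has_sum[OF qpoch_summable[OF q] qpoch_sums[OF q]])
    also have "(\<lambda>k. qpoch_coeff q k * (b * qexp (of_int \<epsilon> * v)) ^ k) = (\<lambda>m. c m * qexp (of_int m * v)) \<circ> ?h"
    proof
      fix k
      have "?h k \<in> range ?h" by blast
      then have "c (?h k) = qpoch_coeff q k * b ^ k" by (simp add: c_def \<epsilon>\<epsilon>)
      moreover have "qexp (of_int (?h k) * v) = qexp (of_int \<epsilon> * v) ^ k"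
        by (simp add: mult_ac flip: qexp_of_nat_mult)
      ultimately show "qpoch_coeff q k * (b * qexp (of_int \<epsilon> * v)) ^ k = ((\<lambda>m. c m * qexp (of_int m * v)) \<circ> ?h) k"
        by (simp add: power_mult_distrib)
    qed
    finally have "((\<lambda>m. c m * qexp (of_int m * v)) has_sum qpoch q (b * qexp (of_int \<epsilon> * v))) (range ?h)"
      by (subst has_sum_reindex) (use \<epsilon> in \<open>auto simp: inj_on_def o_def\<close>)
    then have "((\<lambda>m. c m * qexp (of_int m * v)) has_sum qpoch q (b * qexp (of_int \<epsilon> * v))) UNIV"
      by (rule has_sum_cong_neutral[THEN iffD1, rotated -1]) (auto simp: c_def)
    then show "((\<lambda>m. c m * qexp ((of_int m + 0) * v)) has_sum qpoch q (b * qexp (of_int \<epsilon> * v))) UNIV"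
      by simp
  qed
  then show ?thesis by blast
qed

text \<open>With q = \<open>qexp \<tau>\<close> and w = \<open>qexp v\<close> this is the product
  over n >= 0 of (1 + q^(n + 1/2) w) (1 + q^(n + 1/2) / w): Jacobi's triple product without the
  factors that are free of w.\<close>

definition jtheta_prod :: "complex \<Rightarrow> complex \<Rightarrow> complex" where
  "jtheta_prod \<tau> v = qpoch (qexp \<tau>) (- qexp (\<tau> / 2) * qexp v) * qpoch (qexp \<tau>) (- qexp (\<tau> / 2) * qexp (- v))"

lemma norm_qexp_less_1: "Im \<tau> > 0 \<Longrightarrow> norm (qexp \<tau>) < 1"
  by (simp add: norm_qexp)

text \<open>Replacing w by q w shifts both products by one factor: the first loses 1 + q^(1/2) w,
  the second gains 1 + q^(-1/2) / w, and the quotient of these two is a monomial.\<close>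

lemma jtheta_prod_quasi:
  assumes \<tau>: "Im \<tau> > 0"
  shows "jtheta_prod \<tau> (v + \<tau>) = qexp (- v - \<tau> / 2) * jtheta_prod \<tau> v"
proof -
  let ?q = "qexp \<tau>" and ?r = "qexp (\<tau> / 2)" and ?w = "qexp v"
  have q: "norm ?q < 1" using \<tau> by (rule norm_qexp_less_1)
  have q2: "?q = ?r * ?r" by (simp flip: qexp_add)
  have "- ?r * qexp (- (v + \<tau>)) = - inverse (?r * ?w)"
    by (simp only: qexp_minus qexp_add q2) (simp add: field_simps)
  then have "jtheta_prod \<tau> (v + \<tau>) = qpoch ?q (?q * (- ?r * ?w)) * qpoch ?q (- inverse (?r * ?w))"
    by (simp add: jtheta_prod_def qexp_add mult_ac)
  also have "qpoch ?q (- inverse (?r * ?w)) = (1 + inverse (?r * ?w)) * qpoch ?q (- ?r * qexp (- v))"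
    by (subst qpoch_rec[OF q]) (simp add: q2 qexp_minus field_simps)
  also have "1 + inverse (?r * ?w) = inverse (?r * ?w) * (1 - (- ?r * ?w))"
    by (simp add: field_simps)
  finally have "jtheta_prod \<tau> (v + \<tau>)
      = inverse (?r * ?w) * ((1 - (- ?r * ?w)) * qpoch ?q (?q * (- ?r * ?w))) * qpoch ?q (- ?r * qexp (- v))"
    by (simp only: mult_ac)
  also have "\<dots> = inverse (?r * ?w) * jtheta_prod \<tau> v"
    by (simp only: qpoch_rec[OF q, of "- ?r * ?w", symmetric]) (simp add: jtheta_prod_def)
  also have "inverse (?r * ?w) = qexp (- v - \<tau> / 2)"
    by (simp only: qexp_diff qexp_minus) (simp add: field_simps)
  finally show ?thesis .
qed

text \<open>Jacobi's triple product, up to the value of the constant: the product has the quasi-periodicity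
  that determines its Fourier coefficients from a single one.\<close>
lemma jtheta_has_sum_prod:
  assumes \<tau>: "Im \<tau> > 0"
  shows "\<exists>C. C \<noteq> 0 \<and> (\<forall>v. ((\<lambda>n::int. qexp (\<tau> * (of_int n)\<^sup>2 / 2 + of_int n * v)) has_sum C * jtheta_prod \<tau> v) UNIV)"
proof -
  let ?q = "qexp \<tau>" and ?r = "qexp (\<tau> / 2)"
  have q: "norm ?q < 1" using \<tau> by (rule norm_qexp_less_1)
  obtain c1 c2 where "fourier 0 c1 (\<lambda>v. qpoch ?q (- ?r * qexp v))" "fourier 0 c2 (\<lambda>v. qpoch ?q (- ?r * qexp (- v)))"
    using fourier_qpoch[OF q, of 1 "- ?r"] fourier_qpoch[OF q, of "-1" "- ?r"] by auto
  then obtain b where b: "fourier 0 b (jtheta_prod \<tau>)"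
    using fourier_mult[of 0 _ _ 0] unfolding jtheta_prod_def[abs_def] by fastforce
  obtain d where d: "\<And>m. d (m + int 1) = d m" and bd: "\<And>m. b m = d m * qexp (\<tau> * (of_int m + 0)\<^sup>2 / (2 * of_nat 1))"
    using fourier_quasi_periodic[OF b, of 1 \<tau>] jtheta_prod_quasi[OF \<tau>] by auto
  have "d m = d 0" for m
    by (induction m rule: int_induct[where k = 0]) (use d d[of "i - 1" for i] in simp_all)
  with bd have b': "b m = d 0 * qexp (\<tau> * (of_int m)\<^sup>2 / 2)" for m by simp
  have sum: "((\<lambda>n. d 0 * qexp (\<tau> * (of_int n)\<^sup>2 / 2 + of_int n * v)) has_sum jtheta_prod \<tau> v) UNIV" for v
    using fourierD[OF b, of v] by (simp add: b' qexp_add mult.assoc)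
  have "norm (?r) < 1" using \<tau> by (intro norm_qexp_less_1) simp
  then have ne: "- ?r * ?q ^ k \<noteq> 1" for k
  proof -
    have "norm (- ?r * ?q ^ k) < 1 * 1" unfolding norm_mult norm_minus_cancel norm_power
      using \<open>norm ?r < 1\<close> q by (intro mult_less_le_imp_less power_le_one) auto
    then show ?thesis by (metis mult_1 norm_one less_irrefl)
  qed
  \<comment> \<open>At v = 0 no factor of the product vanishes, so the one free coefficient
    \<open>d 0\<close> cannot be 0.\<close>
  have "jtheta_prod \<tau> 0 \<noteq> 0"
    using qpoch_eq_0D[OF q, of "- ?r"] ne by (auto simp: jtheta_prod_def)
  then have "d 0 \<noteq> 0"
    using has_sum_unique[OF sum[of 0], of 0] by auto
  moreover have "((\<lambda>n. qexp (\<tau> * (of_int n)\<^sup>2 / 2 + of_int n * v)) has_sum inverse (d 0) * jtheta_prod \<tau> v) UNIV" for v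
    using has_sum_cmult_right[OF sum[of v], of "inverse (d 0)"] \<open>d 0 \<noteq> 0\<close> by (simp add: mult.assoc[symmetric])
  ultimately show ?thesis by (intro exI[of _ "inverse (d 0)"]) auto
qed

text \<open>The series of theta_3, with its exponents collected in one \<open>qexp\<close>.\<close>

definition jtheta :: "complex \<Rightarrow> complex \<Rightarrow> complex" where
  "jtheta \<tau> v = infsum (\<lambda>n::int. qexp (\<tau> * (of_int n)\<^sup>2 / 2 + of_int n * v)) UNIV"

text \<open>Classically the product of all 1 - q^n, n >= 1, with q =
  \<open>qexp \<tau>\<close>.\<close>

definition jtheta_const :: "complex \<Rightarrow> complex" where
  "jtheta_const \<tau> = (SOME C. C \<noteq> 0 \<and> (\<forall>v. ((\<lambda>n::int. qexp (\<tau> * (of_int n)\<^sup>2 / 2 + of_int n * v)) has_sum C * jtheta_prod \<tau> v) UNIV))"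

lemma
  assumes "Im \<tau> > 0"
  shows jtheta_const_nonzero: "jtheta_const \<tau> \<noteq> 0"
    and jtheta_conv_prod: "jtheta \<tau> v = jtheta_const \<tau> * jtheta_prod \<tau> v"
    and jtheta_has_sum: "((\<lambda>n::int. qexp (\<tau> * (of_int n)\<^sup>2 / 2 + of_int n * v)) has_sum jtheta \<tau> v) UNIV"
proof -
  note * = someI_ex[OF jtheta_has_sum_prod[OF assms], folded jtheta_const_def]
  show "jtheta_const \<tau> \<noteq> 0" using * by blast
  have 1: "((\<lambda>n::int. qexp (\<tau> * (of_int n)\<^sup>2 / 2 + of_int n * v)) has_sum jtheta_const \<tau> * jtheta_prod \<tau> v) UNIV"
    using * by blast
  then show 2: "jtheta \<tau> v = jtheta_const \<tau> * jtheta_prod \<tau> v"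
    unfolding jtheta_def by (rule infsumI)
  show "((\<lambda>n::int. qexp (\<tau> * (of_int n)\<^sup>2 / 2 + of_int n * v)) has_sum jtheta \<tau> v) UNIV"
    using 1 2 by simp
qed

lemma continuous_on_jtheta [continuous_intros]:
  assumes "Im \<tau> > 0" "continuous_on A f"
  shows "continuous_on A (\<lambda>v. jtheta \<tau> (f v))"
  unfolding jtheta_conv_prod[OF assms(1)] jtheta_prod_def
  by (intro continuous_intros assms norm_qexp_less_1)

text \<open>A vanishing factor means q^(k + 1/2) w = -1 or q^(k + 1/2) / w = -1, and taking absolute
  values leaves the height of v. Heights are enough both for strips free of zeros and for null
  sets.\<close>

lemma jtheta_eq_0D:
  assumes \<tau>: "Im \<tau> > 0" and 0: "jtheta \<tau> v = 0"
  shows "\<exists>k::int. Im v = (of_int k + 1/2) * Im \<tau>"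
proof -
  have q: "norm (qexp \<tau>) < 1" using \<tau> by (rule norm_qexp_less_1)
  have *: "\<exists>k::int. Im u = (of_int k + 1/2) * Im \<tau>" if u: "qpoch (qexp \<tau>) (- qexp (\<tau> / 2) * qexp u) = 0" for u
  proof -
    obtain k where "- qexp (\<tau> / 2) * qexp u * qexp \<tau> ^ k = 1"
      using qpoch_eq_0D[OF q u] by blast
    then have "- qexp (\<tau> / 2 + u + of_nat k * \<tau>) = 1"
      by (simp add: qexp_add qexp_of_nat_mult)
    then have "norm (qexp (\<tau> / 2 + u + of_nat k * \<tau>)) = 1" by (metis norm_minus_cancel norm_one)
    then have "Im \<tau> / 2 + Im u + real k * Im \<tau> = 0" by (simp add: norm_qexp)
    then have "Im u = (of_int (- int k - 1) + 1/2) * Im \<tau>" by (simp add: algebra_simps)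
    then show ?thesis by blast
  qed
  from 0 have "qpoch (qexp \<tau>) (- qexp (\<tau> / 2) * qexp v) = 0 \<or> qpoch (qexp \<tau>) (- qexp (\<tau> / 2) * qexp (- v)) = 0"
    by (simp add: jtheta_conv_prod[OF \<tau>] jtheta_const_nonzero[OF \<tau>] jtheta_prod_def)
  then show ?thesis
  proof
    assume "qpoch (qexp \<tau>) (- qexp (\<tau> / 2) * qexp (- v)) = 0"
    then obtain k :: int where "Im (- v) = (of_int k + 1/2) * Im \<tau>" using * by blast
    then have "Im v = (of_int (- k - 1) + 1/2) * Im \<tau>" by (simp add: algebra_simps)
    then show ?thesis by blast
  qed (rule *)
qed

subsection \<open>Theta functions\<close>

abbreviation btheta_exponent :: "nat \<Rightarrow> complex \<Rightarrow> complex \<Rightarrow> int \<Rightarrow> complex \<Rightarrow> complex" where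
  "btheta_exponent n \<tau> \<rho> k v \<equiv> \<tau> * (\<rho> + of_nat n * of_int k)\<^sup>2 / (2 * of_nat n) + (\<rho> + of_nat n * of_int k) * v"

text \<open>The theta function of degree n whose frequencies are the residue class of \<rho> modulo
  n. The n classes with a common offset modulo 1 span the functions with that offset and f(v + tau)
  = qexp(- n v - n tau / 2) f(v).\<close>

definition btheta :: "nat \<Rightarrow> complex \<Rightarrow> complex \<Rightarrow> complex \<Rightarrow> complex" where
  "btheta n \<tau> \<rho> v = infsum (\<lambda>k::int. qexp (btheta_exponent n \<tau> \<rho> k v)) UNIV"

text \<open>Completing the square reduces a residue class to the full series at n tau, from which
  convergence and continuity are inherited.\<close>

lemma
  assumes \<tau>: "Im \<tau> > 0" and n: "0 < n"
  shows btheta_has_sum: "((\<lambda>k::int. qexp (btheta_exponent n \<tau> \<rho> k v)) has_sum btheta n \<tau> \<rho> v) UNIV"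
    and btheta_conv_jtheta: "btheta n \<tau> \<rho> v
            = qexp (\<tau> * \<rho>\<^sup>2 / (2 * of_nat n) + \<rho> * v) * jtheta (of_nat n * \<tau>) (of_nat n * v + \<rho> * \<tau>)"
proof -
  have "Im (of_nat n * \<tau>) > 0" using \<tau> n by simp
  from has_sum_cmult_right[OF jtheta_has_sum[OF this, of "of_nat n * v + \<rho> * \<tau>"], of "qexp (\<tau> * \<rho>\<^sup>2 / (2 * of_nat n) + \<rho> * v)"]
  have 0: "((\<lambda>k::int. qexp ((\<tau> * \<rho>\<^sup>2 / (2 * of_nat n) + \<rho> * v) + (of_nat n * \<tau> * (of_int k)\<^sup>2 / 2 + of_int k * (of_nat n * v + \<rho> * \<tau>))))
     has_sum qexp (\<tau> * \<rho>\<^sup>2 / (2 * of_nat n) + \<rho> * v) * jtheta (of_nat n * \<tau>) (of_nat n * v + \<rho> * \<tau>)) UNIV"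
    by (simp only: qexp_add[of "\<tau> * \<rho>\<^sup>2 / (2 * of_nat n) + \<rho> * v"])
  have eq: "(\<tau> * \<rho>\<^sup>2 / (2 * of_nat n) + \<rho> * v) + (of_nat n * \<tau> * (of_int k)\<^sup>2 / 2 + of_int k * (of_nat n * v + \<rho> * \<tau>))
      = btheta_exponent n \<tau> \<rho> k v" for k :: int
    using n by (simp add: field_simps power2_eq_square)
  have 1: "((\<lambda>k::int. qexp (btheta_exponent n \<tau> \<rho> k v))
     has_sum qexp (\<tau> * \<rho>\<^sup>2 / (2 * of_nat n) + \<rho> * v) * jtheta (of_nat n * \<tau>) (of_nat n * v + \<rho> * \<tau>)) UNIV"
    using 0 unfolding eq .
  then show 2: "btheta n \<tau> \<rho> v
            = qexp (\<tau> * \<rho>\<^sup>2 / (2 * of_nat n) + \<rho> * v) * jtheta (of_nat n * \<tau>) (of_nat n * v + \<rho> * \<tau>)"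
    unfolding btheta_def by (rule infsumI)
  show "((\<lambda>k::int. qexp (btheta_exponent n \<tau> \<rho> k v)) has_sum btheta n \<tau> \<rho> v) UNIV"
    using 1 2 by simp
qed

lemma continuous_on_btheta [continuous_intros]:
  assumes "Im \<tau> > 0" "0 < n" "continuous_on A f"
  shows "continuous_on A (\<lambda>v. btheta n \<tau> \<rho> (f v))"
proof -
  have "Im (of_nat n * \<tau>) > 0" using assms by simp
  then show ?thesis
    unfolding btheta_conv_jtheta[OF assms(1,2)] by (intro continuous_intros assms)
qed

lemma btheta_add_period: "btheta n \<tau> (\<rho> + of_nat n) v = btheta n \<tau> \<rho> v"
  unfolding btheta_def
  by (rule infsum_reindex_bij_witness[where i = "\<lambda>k. k - 1" and j = "\<lambda>k. k + 1"]) (auto simp: algebra_simps)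

lemma btheta_add_int_period: "btheta n \<tau> (\<rho> + of_int k * of_nat n) v = btheta n \<tau> \<rho> v"
proof (induction k rule: int_induct[where k = 0])
  case (step1 i)
  then show ?case using btheta_add_period[of n \<tau> "\<rho> + of_int i * of_nat n" v] by (simp add: algebra_simps)
next
  case (step2 i)
  then show ?case using btheta_add_period[of n \<tau> "\<rho> + of_int (i - 1) * of_nat n" v] by (simp add: algebra_simps)
qed simp

lemma btheta_minus: "btheta n \<tau> \<rho> (- v) = btheta n \<tau> (- \<rho>) v"
  unfolding btheta_def
proof (rule infsum_reindex_bij_witness[where i = uminus and j = uminus])
  fix k :: int
  have "(- \<rho> + of_nat n * of_int (- k)) = - (\<rho> + of_nat n * of_int k)" by simp
  then show "qexp (\<tau> * (- \<rho> + of_nat n * of_int (- k))\<^sup>2 / (2 * of_nat n) + (- \<rho> + of_nat n * of_int (- k)) * v)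
     = qexp (\<tau> * (\<rho> + of_nat n * of_int k)\<^sup>2 / (2 * of_nat n) + (\<rho> + of_nat n * of_int k) * - v)"
    by (simp only: power2_minus mult_minus_left mult_minus_right)
qed auto

lemma btheta_plus_tau:
  assumes "0 < n"
  shows "btheta n \<tau> \<rho> (v + \<tau>) = qexp (- (of_nat n * v) - of_nat n * \<tau> / 2) * btheta n \<tau> \<rho> v"
  unfolding btheta_def infsum_cmult_right'[symmetric]
proof (rule infsum_reindex_bij_witness[where i = "\<lambda>k. k - 1" and j = "\<lambda>k. k + 1"])
  fix k :: int
  have "- (of_nat n * v) - of_nat n * \<tau> / 2 + (\<tau> * (\<rho> + of_nat n * of_int (k + 1))\<^sup>2 / (2 * of_nat n) + (\<rho> + of_nat n * of_int (k + 1)) * v)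
      = \<tau> * (\<rho> + of_nat n * of_int k)\<^sup>2 / (2 * of_nat n) + (\<rho> + of_nat n * of_int k) * (v + \<tau>)"
    using assms by (simp add: field_simps power2_eq_square)
  then show "qexp (- (of_nat n * v) - of_nat n * \<tau> / 2) * qexp (\<tau> * (\<rho> + of_nat n * of_int (k + 1))\<^sup>2 / (2 * of_nat n) + (\<rho> + of_nat n * of_int (k + 1)) * v)
     = qexp (\<tau> * (\<rho> + of_nat n * of_int k)\<^sup>2 / (2 * of_nat n) + (\<rho> + of_nat n * of_int k) * (v + \<tau>))"
    by (simp only: qexp_add[symmetric])
qed auto

lemma btheta_plus_1: "btheta n \<tau> \<rho> (v + 1) = qexp \<rho> * btheta n \<tau> \<rho> v"
  unfolding btheta_def infsum_cmult_right'[symmetric]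
proof (rule infsum_cong)
  fix k :: int
  have "qexp (of_int (int n * k)) = 1" by (rule qexp_of_int)
  then have "qexp (\<rho> + of_nat n * of_int k) = qexp \<rho>" by (simp add: qexp_add)
  moreover have "\<tau> * (\<rho> + of_nat n * of_int k)\<^sup>2 / (2 * of_nat n) + (\<rho> + of_nat n * of_int k) * (v + 1)
     = (\<rho> + of_nat n * of_int k) + (btheta_exponent n \<tau> \<rho> k v)"
    by (simp add: algebra_simps)
  ultimately show "qexp (\<tau> * (\<rho> + of_nat n * of_int k)\<^sup>2 / (2 * of_nat n) + (\<rho> + of_nat n * of_int k) * (v + 1))
     = qexp \<rho> * qexp (btheta_exponent n \<tau> \<rho> k v)"
    by (simp only: qexp_add[of "\<rho> + of_nat n * of_int k"])
qed

text \<open>Completing the square: the half-integers in theta_2 move the residue class from J to J -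
  n / 2. The Gaussian in J left over squares to the factor e_j of h_j, so it will cancel in the
  kernel.\<close>

lemma theta2_conv_btheta:
  assumes "0 < n"
  shows "qexp (J * v) * theta2 (J * \<tau> + of_nat n * v) (of_nat n * \<tau>)
       = qexp (- (\<tau> * J\<^sup>2 / (2 * of_nat n))) * btheta n \<tau> (J - of_nat n / 2) v"
  unfolding theta2_def btheta_def infsum_cmult_right'[symmetric]
proof (rule infsum_cong)
  fix k :: int
  have "J * v + (of_nat n * \<tau> * (of_int k - 1/2)\<^sup>2 / 2 + (of_int k - 1/2) * (J * \<tau> + of_nat n * v))
     = - (\<tau> * J\<^sup>2 / (2 * of_nat n)) + (\<tau> * (J - of_nat n / 2 + of_nat n * of_int k)\<^sup>2 / (2 * of_nat n) + (J - of_nat n / 2 + of_nat n * of_int k) * v)"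
    using assms by (simp add: field_simps power2_eq_square)
  then have "qexp (J * v) * qexp (of_nat n * \<tau> * (of_int k - 1/2)\<^sup>2 / 2 + (of_int k - 1/2) * (J * \<tau> + of_nat n * v))
     = qexp (- (\<tau> * J\<^sup>2 / (2 * of_nat n))) * qexp (\<tau> * (J - of_nat n / 2 + of_nat n * of_int k)\<^sup>2 / (2 * of_nat n) + (J - of_nat n / 2 + of_nat n * of_int k) * v)"
    by (simp only: qexp_add[symmetric])
  moreover have "qexp (of_nat n * \<tau> * (of_int k - 1/2)\<^sup>2 / 2 + (of_int k - 1/2) * (J * \<tau> + of_nat n * v))
     = exp (pi * \<i> * (of_nat n * \<tau>) * (of_int k - 1/2)\<^sup>2) * exp ((2 * of_int k - 1) * pi * \<i> * (J * \<tau> + of_nat n * v))"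
    unfolding qexp_def exp_add[symmetric] by (rule arg_cong[where f = exp]) (simp add: algebra_simps)
  ultimately show "qexp (J * v) * (exp (pi * \<i> * (of_nat n * \<tau>) * (of_int k - 1/2)\<^sup>2) * exp ((2 * of_int k - 1) * pi * \<i> * (J * \<tau> + of_nat n * v)))
     = qexp (- (\<tau> * J\<^sup>2 / (2 * of_nat n))) * qexp (\<tau> * (J - of_nat n / 2 + of_nat n * of_int k)\<^sup>2 / (2 * of_nat n) + (J - of_nat n / 2 + of_nat n * of_int k) * v)"
    by simp
qed

lemma qexp_half_int: "qexp (of_int k / 2) = (-1) powi k"
proof -
  have "qexp (of_int k / 2) = exp (of_int k * (pi * \<i>))"
    by (simp add: qexp_def mult_ac)
  also have "\<dots> = exp (pi * \<i>) powi k" by (simp only: exp_power_int)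
  also have "exp (pi * \<i>) = -1" by (metis exp_pi_i mult.commute)
  finally show ?thesis .
qed

lemma qexp_half: "qexp (1 / 2) = -1"
  using qexp_half_int[of 1] by simp

lemma theta0_conv_btheta: "theta0 v \<tau> = btheta 1 \<tau> 0 (v + 1/2)"
  unfolding theta0_def btheta_def
proof (rule infsum_cong)
  fix k :: int
  have "\<tau> * (0 + of_nat 1 * of_int k)\<^sup>2 / (2 * of_nat 1) + (0 + of_nat 1 * of_int k) * (v + 1/2)
      = of_int k / 2 + (\<tau> * (of_int k)\<^sup>2 / 2 + of_int k * v)" by (simp add: algebra_simps)
  then have "qexp (\<tau> * (0 + of_nat 1 * of_int k)\<^sup>2 / (2 * of_nat 1) + (0 + of_nat 1 * of_int k) * (v + 1/2))
      = (-1) powi k * (qexp (\<tau> * (of_int k)\<^sup>2 / 2) * qexp (of_int k * v))"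
    by (simp only: qexp_add qexp_half_int)
  also have "\<dots> = (-1) powi k * exp (pi * \<i> * \<tau> * (of_int k)\<^sup>2) * exp (2 * pi * \<i> * of_int k * v)"
    by (simp add: qexp_def mult_ac)
  finally show "(-1) powi k * exp (pi * \<i> * \<tau> * (of_int k)\<^sup>2) * exp (2 * pi * \<i> * of_int k * v)
     = qexp (\<tau> * (0 + of_nat 1 * of_int k)\<^sup>2 / (2 * of_nat 1) + (0 + of_nat 1 * of_int k) * (v + 1/2))" ..
qed

text \<open>The alternating sign is produced by the shift of v by 1/2, up to the constant -i from
  the half-integer frequencies, which the factor i of \<open>theta1\<close> turns into a
  sign.\<close>

lemma theta1_conv_btheta: "theta1 v \<tau> = - btheta 1 \<tau> (- 1/2) (v + 1/2)"
proof -
  have "theta1 v \<tau> = (- 1) * btheta 1 \<tau> (- 1/2) (v + 1/2)"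
    unfolding theta1_def btheta_def infsum_cmult_right'[symmetric]
  proof (rule infsum_cong)
    fix k :: int
    have i: "qexp (- (1/4)) = - \<i>"
    proof -
      have "qexp (- (1/4)) = exp (\<i> * of_real (- (pi / 2)))" by (simp add: qexp_def)
      also have "\<dots> = - \<i>" by (simp only: exp_i_ne_1 cis_conv_exp[symmetric] cis.ctr) (simp add: complex_eq_iff)
      finally show ?thesis .
    qed
    have "\<tau> * (- 1/2 + of_nat 1 * of_int k)\<^sup>2 / (2 * of_nat 1) + (- 1/2 + of_nat 1 * of_int k) * (v + 1/2)
        = of_int k / 2 + (- (1/4) + (\<tau> * (of_int k - 1/2)\<^sup>2 / 2 + (of_int k - 1/2) * v))"
      by (simp add: algebra_simps)
    then have "- 1 * qexp (\<tau> * (- 1/2 + of_nat 1 * of_int k)\<^sup>2 / (2 * of_nat 1) + (- 1/2 + of_nat 1 * of_int k) * (v + 1/2))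
        = \<i> * ((-1) powi k * (qexp (\<tau> * (of_int k - 1/2)\<^sup>2 / 2) * qexp ((of_int k - 1/2) * v)))"
      by (simp only: qexp_add qexp_half_int i) simp
    also have "qexp (\<tau> * (of_int k - 1/2)\<^sup>2 / 2) = exp (pi * \<i> * \<tau> * (of_int k - 1/2)\<^sup>2)"
      by (simp add: qexp_def mult_ac)
    also have "qexp ((of_int k - 1/2) * v) = exp ((2 * of_int k - 1) * pi * \<i> * v)"
      unfolding qexp_def by (rule arg_cong[where f = exp]) (simp add: algebra_simps)
    finally show "\<i> * ((-1) powi k * exp (pi * \<i> * \<tau> * (of_int k - 1/2)\<^sup>2) * exp ((2 * of_int k - 1) * pi * \<i> * v))
      = - 1 * qexp (\<tau> * (- 1/2 + of_nat 1 * of_int k)\<^sup>2 / (2 * of_nat 1) + (- 1/2 + of_nat 1 * of_int k) * (v + 1/2))"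
      by (simp only: mult.assoc)
  qed
  then show ?thesis by simp
qed

lemma theta1_plus_tau: "theta1 (v + \<tau>) \<tau> = - qexp (- v - \<tau> / 2) * theta1 v \<tau>"
proof -
  have "qexp (- (v + 1/2) - \<tau> / 2) = - qexp (- v - \<tau> / 2)"
  proof -
    have "- v - \<tau> / 2 = (- (v + 1/2) - \<tau> / 2) + 1/2" by simp
    then have "qexp (- v - \<tau> / 2) = qexp (- (v + 1/2) - \<tau> / 2) * qexp (1/2)" by (simp only: qexp_add)
    then show ?thesis by (simp add: qexp_half)
  qed
  then show ?thesis
    using btheta_plus_tau[of 1 \<tau> "- 1/2" "v + 1/2"] unfolding theta1_conv_btheta by (simp add: add_ac)
qed

lemma theta1_minus: "theta1 (- v) \<tau> = - theta1 v \<tau>"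
proof -
  have "btheta 1 \<tau> (- 1/2) (- v + 1/2) = btheta 1 \<tau> (1/2) (v - 1/2)"
    using btheta_minus[of 1 \<tau> "- 1/2" "v - 1/2"] by simp
  also have "\<dots> = btheta 1 \<tau> (- 1/2) (v - 1/2)"
    using btheta_add_period[of 1 \<tau> "- 1/2" "v - 1/2"] by simp
  also have "\<dots> = - btheta 1 \<tau> (- 1/2) (v + 1/2)"
    using btheta_plus_1[of 1 \<tau> "- 1/2" "v - 1/2"] qexp_half qexp_minus[of "1/2"]
    by (simp add: add.commute)
  finally show ?thesis unfolding theta1_conv_btheta by simp
qed

lemma continuous_on_theta1 [continuous_intros]:
  assumes "Im \<tau> > 0" "continuous_on A f"
  shows "continuous_on A (\<lambda>v. theta1 (f v) \<tau>)"
  unfolding theta1_conv_btheta by (intro continuous_intros assms) simp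

text \<open>Up to an exponential, theta_1 is \<open>jtheta\<close> moved by 1/2 - tau / 2, which
  takes the zeros from half-integer to integer multiples of Im tau.\<close>

lemma theta1_eq_0D:
  assumes \<tau>: "Im \<tau> > 0" and 0: "theta1 v \<tau> = 0"
  shows "\<exists>k::int. Im v = of_int k * Im \<tau>"
proof -
  have "jtheta \<tau> (v + 1/2 - \<tau> / 2) = 0"
    using 0 btheta_conv_jtheta[OF \<tau>, of 1 "- 1/2" "v + 1/2"] unfolding theta1_conv_btheta by simp
  from jtheta_eq_0D[OF \<tau> this] obtain k :: int where "Im (v + 1/2 - \<tau> / 2) = (of_int k + 1/2) * Im \<tau>" by blast
  then have "Im v = of_int (k + 1) * Im \<tau>" by (simp add: algebra_simps)
  then show ?thesis by blast
qed

lemma fourier_btheta_1: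
  assumes "Im \<tau> > 0"
  shows "fourier \<rho> (\<lambda>k. qexp (\<tau> * (\<rho> + of_int k)\<^sup>2 / 2)) (btheta 1 \<tau> \<rho>)"
  unfolding fourier_def
  using btheta_has_sum[OF assms, of 1 \<rho>] by (auto simp: qexp_add ac_simps)

lemma fourier_theta1:
  assumes "Im \<tau> > 0"
  shows "\<exists>c. fourier (- 1/2) c (\<lambda>v. theta1 (v + a) \<tau>)"
  using fourier_cmult[OF fourier_translate[OF fourier_btheta_1[OF assms, of "- 1/2"], of "a + 1/2"], of "-1"]
  unfolding theta1_conv_btheta by (auto simp: add.assoc)

text \<open>By quasi-periodicity the coefficients are a sequence periodic modulo n times a Gaussian;
  sorting the frequencies by residues modulo n leaves one \<open>btheta\<close> per residue.\<close>

lemma quasi_periodic_span: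
  assumes c: "fourier s c f" and n: "0 < n" and \<tau>: "Im \<tau> > 0"
    and f: "\<And>v. f (v + \<tau>) = qexp (- (of_nat n * v) - of_nat n * \<tau> / 2) * f v"
  shows "\<exists>d. \<forall>v. f v = (\<Sum>r<n. d r * btheta n \<tau> (s + of_nat r) v)"
proof -
  obtain d where d: "\<And>m. d (m + int n) = d m"
    and cd: "\<And>m. c m = d m * qexp (\<tau> * (of_int m + s)\<^sup>2 / (2 * of_nat n))"
    using fourier_quasi_periodic[OF c n f] by blast
  have dk: "d (m + k * int n) = d m" for m k
  proof (induction k rule: int_induct[where k = 0])
    case (step1 i)
    then show ?case using d[of "m + i * int n"] by (simp add: algebra_simps)
  next
    case (step2 i)
    then show ?case using d[of "m + (i - 1) * int n"] by (simp add: algebra_simps)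
  qed simp
  have bij: "bij_betw (\<lambda>(r, k). int r + int n * k) ({..<n} \<times> UNIV) UNIV"
    by (rule bij_betw_byWitness[where f' = "\<lambda>m. (nat (m mod int n), m div int n)"])
       (use n in \<open>auto simp: nat_less_iff\<close>)
  have "f v = (\<Sum>r<n. d (int r) * btheta n \<tau> (s + of_nat r) v)" for v
  proof -
    let ?g = "\<lambda>m. c m * qexp ((of_int m + s) * v)"
    have g: "?g (int r + int n * k) = d (int r) * qexp (\<tau> * (s + of_nat r + of_nat n * of_int k)\<^sup>2 / (2 * of_nat n)
            + (s + of_nat r + of_nat n * of_int k) * v)" for r k
      using dk[of "int r" k] by (simp add: cd qexp_add ac_simps)
    have "((\<lambda>(r, k). ?g (int r + int n * k)) has_sum f v) ({..<n} \<times> UNIV)"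
      using has_sum_reindex_bij_betw[OF bij, of ?g "f v"] fourierD[OF c, of v] by (simp add: case_prod_unfold)
    then have "((\<lambda>r. d (int r) * btheta n \<tau> (s + of_nat r) v) has_sum f v) {..<n}"
    proof (rule has_sum_SigmaD)
      fix r
      show "((\<lambda>k. case (r, k) of (r, k) \<Rightarrow> ?g (int r + int n * k)) has_sum d (int r) * btheta n \<tau> (s + of_nat r) v) UNIV"
        unfolding case_prod_conv g by (intro has_sum_cmult_right btheta_has_sum \<tau> n)
    qed
    then show ?thesis by (rule has_sum_unique) (rule has_sum_finite, simp)
  qed
  then show ?thesis by (intro exI[of _ "\<lambda>r. d (int r)"] allI)
qed

subsection \<open>Orthogonality on the torus\<close>

lemma measurable_Complex [measurable (raw)]:
  "f \<in> borel_measurable M \<Longrightarrow> g \<in> borel_measurable M \<Longrightarrow> (\<lambda>x. Complex (f x) (g x)) \<in> borel_measurable M"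
  by (simp add: borel_measurable_complex_iff)

text \<open>Makes Fubini and Tonelli available, so that integrals over \<open>Lambda\<close> can be
  sliced into horizontal lines.\<close>

lemma lborel_complex: "(lborel :: complex measure) = distr (lborel \<Otimes>\<^sub>M lborel) borel (\<lambda>(x, y). Complex x y)"
proof (rule lborel_eqI)
  show "sets (distr (lborel \<Otimes>\<^sub>M lborel) borel (\<lambda>(x, y). Complex x y)) = sets borel" by simp
  fix l u :: complex
  assume le: "\<And>b. b \<in> Basis \<Longrightarrow> l \<bullet> b \<le> u \<bullet> b"
  have [measurable]: "(\<lambda>(x, y). Complex x y) \<in> borel \<Otimes>\<^sub>M borel \<rightarrow>\<^sub>M borel"
    unfolding case_prod_beta by measurable
  have "Re l \<le> Re u" "Im l \<le> Im u" using le[of 1] le[of \<i>] by (auto simp: Basis_complex_def)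
  have "(\<lambda>(x, y). Complex x y) -` box l u \<inter> space (lborel \<Otimes>\<^sub>M lborel) = {Re l<..<Re u} \<times> {Im l<..<Im u}"
    by (auto simp: space_pair_measure box_def Basis_complex_def)
  then have "emeasure (distr (lborel \<Otimes>\<^sub>M lborel) borel (\<lambda>(x, y). Complex x y)) (box l u)
      = emeasure (lborel \<Otimes>\<^sub>M lborel) ({Re l<..<Re u} \<times> {Im l<..<Im u})"
    by (subst emeasure_distr) auto
  also have "\<dots> = ennreal (Re u - Re l) * ennreal (Im u - Im l)"
    using \<open>Re l \<le> Re u\<close> \<open>Im l \<le> Im u\<close> by (simp add: lborel.emeasure_pair_measure_Times)
  also have "\<dots> = ennreal (\<Prod>b\<in>Basis. (u - l) \<bullet> b)"
    using \<open>Re l \<le> Re u\<close> \<open>Im l \<le> Im u\<close> by (simp add: Basis_complex_def ennreal_mult complex_i_not_one)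
  finally show "emeasure (distr (lborel \<Otimes>\<^sub>M lborel) borel (\<lambda>(x, y). Complex x y)) (box l u) = ennreal (\<Prod>b\<in>Basis. (u - l) \<bullet> b)" .
qed

lemma Lambda_sets [measurable]: "Lambda L W \<in> sets borel"
proof -
  have "Lambda L W = {z \<in> space borel. 0 \<le> Re z \<and> Re z < L \<and> 0 \<le> Im z \<and> Im z < W}"
    by (simp add: Lambda_def)
  also have "\<dots> \<in> sets borel" by measurable
  finally show ?thesis .
qed

text \<open>The nonnegative version is the one that can establish integrability of a logarithm with
  singularities; \<open>set_integral_Lambda\<close> presupposes it.\<close>

lemma nn_integral_Lambda:
  assumes [measurable]: "f \<in> borel_measurable borel"
  shows "(\<integral>\<^sup>+z\<in>Lambda L W. f z \<partial>lborel) = (\<integral>\<^sup>+y\<in>{0..<W}. (\<integral>\<^sup>+x\<in>{0..<L}. f (Complex x y) \<partial>lborel) \<partial>lborel)"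
proof -
  have "(\<integral>\<^sup>+z\<in>Lambda L W. f z \<partial>lborel) = (\<integral>\<^sup>+p. (case p of (x, y) \<Rightarrow> f (Complex x y) * indicator (Lambda L W) (Complex x y)) \<partial>(lborel \<Otimes>\<^sub>M lborel))"
    by (subst lborel_complex, subst nn_integral_distr) (auto simp: case_prod_unfold)
  also have "\<dots> = (\<integral>\<^sup>+y. \<integral>\<^sup>+x. f (Complex x y) * indicator (Lambda L W) (Complex x y) \<partial>lborel \<partial>lborel)"
    by (subst lborel_pair.nn_integral_snd[symmetric]) (auto simp: case_prod_unfold)
  also have "\<dots> = (\<integral>\<^sup>+y. \<integral>\<^sup>+x. f (Complex x y) * indicator {0..<L} x * indicator {0..<W} y \<partial>lborel \<partial>lborel)"
    by (intro nn_integral_cong) (auto simp: Lambda_def indicator_def)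
  also have "\<dots> = (\<integral>\<^sup>+y\<in>{0..<W}. (\<integral>\<^sup>+x\<in>{0..<L}. f (Complex x y) \<partial>lborel) \<partial>lborel)"
    by (intro nn_integral_cong nn_integral_multc) auto
  finally show ?thesis .
qed

lemma emeasure_Lambda:
  assumes "0 < L" "0 < W"
  shows "emeasure lborel (Lambda L W) = ennreal (L * W)"
proof -
  have "emeasure lborel (Lambda L W) = (\<integral>\<^sup>+z\<in>Lambda L W. 1 \<partial>lborel)" by simp
  also have "\<dots> = (\<integral>\<^sup>+y\<in>{0..<W}. (\<integral>\<^sup>+x\<in>{0..<L}. 1 \<partial>lborel) \<partial>lborel)"
    by (rule nn_integral_Lambda) simp
  also have "\<dots> = ennreal (L * W)"
    using assms by (simp add: nn_integral_cmult ennreal_mult)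
  finally show ?thesis .
qed

lemma set_integral_Lambda:
  fixes f :: "complex \<Rightarrow> 'b::{banach, second_countable_topology}"
  assumes f: "set_integrable lborel (Lambda L W) f"
  shows "(LINT z:Lambda L W|lborel. f z) = (LINT y:{0..<W}|lborel. LINT x:{0..<L}|lborel. f (Complex x y))"
proof -
  let ?g = "\<lambda>z. indicator (Lambda L W) z *\<^sub>R f z"
  have g: "?g \<in> borel_measurable borel" using f by (auto simp: set_integrable_def)
  have i: "integrable (lborel \<Otimes>\<^sub>M lborel) (\<lambda>(x, y). ?g (Complex x y))"
    using f unfolding set_integrable_def
    by (subst (asm) lborel_complex, subst (asm) integrable_distr_eq) (use g in \<open>auto simp: case_prod_unfold\<close>)
  have "(LINT z:Lambda L W|lborel. f z) = (LINT p|(lborel \<Otimes>\<^sub>M lborel). (case p of (x, y) \<Rightarrow> ?g (Complex x y)))"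
    unfolding set_lebesgue_integral_def
    by (subst lborel_complex, subst integral_distr) (use g in \<open>auto simp: case_prod_unfold\<close>)
  also have "\<dots> = (LINT y|lborel. LINT x|lborel. ?g (Complex x y))"
    by (rule lborel_pair.integral_snd[symmetric, OF i])
  also have "\<dots> = (LINT y|lborel. LINT x|lborel. indicator {0..<W} y *\<^sub>R indicator {0..<L} x *\<^sub>R f (Complex x y))"
    by (intro Bochner_Integration.integral_cong) (auto simp: Lambda_def indicator_def)
  also have "\<dots> = (LINT y:{0..<W}|lborel. LINT x:{0..<L}|lborel. f (Complex x y))"
    unfolding set_lebesgue_integral_def by (simp only: Bochner_Integration.integral_scaleR_right)
  finally show ?thesis .
qed

lemma set_integrable_Lambda:
  fixes f :: "complex \<Rightarrow> complex"
  assumes f: "continuous_on UNIV f" and "0 < L" "0 < W"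
  shows "set_integrable lborel (Lambda L W) f"
proof -
  have "set_integrable lborel (cbox 0 (Complex L W)) f"
    unfolding set_integrable_def
    by (rule borel_integrable_compact[OF compact_cbox]) (rule continuous_on_subset[OF f], simp)
  then show ?thesis
    by (rule set_integrable_subset) (auto simp: Lambda_def cbox_def Basis_complex_def)
qed

text \<open>The square of the Gaussian that \<open>Kern\<close> attaches to a point. Multiplied by
  it, |f|^2 is doubly periodic for every \<open>btheta\<close> of degree n with real offset.\<close>

abbreviation background :: "nat \<Rightarrow> real \<Rightarrow> real \<Rightarrow> complex \<Rightarrow> real" where
  "background n L W z \<equiv> exp (- 2 * pi * real n * (Im z)\<^sup>2 / (L * W))"

abbreviation torus_inner :: "nat \<Rightarrow> real \<Rightarrow> real \<Rightarrow> (complex \<Rightarrow> complex) \<Rightarrow> (complex \<Rightarrow> complex) \<Rightarrow> complex" where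
  "torus_inner n L W f g \<equiv>
     (LINT z:Lambda L W|lborel. f (z / of_real L) * cnj (g (z / of_real L)) * of_real (background n L W z))"

text \<open>Modulus on the line Im z = y of the k-th mode of \<open>btheta\<close> times the root of
  the background. Raising k by 1 has the effect of raising y by W.\<close>

abbreviation torus_gauss :: "nat \<Rightarrow> real \<Rightarrow> real \<Rightarrow> real \<Rightarrow> int \<Rightarrow> real \<Rightarrow> real" where
  "torus_gauss n L W \<rho> k y \<equiv> exp (- pi * (W / L) * real n * (of_int k + \<rho> / real n + y / W)\<^sup>2)"

text \<open>On the line \<open>Im z = y\<close> every Fourier term of \<open>btheta\<close>, damped by the background weight, is a
  Gaussian in \<open>y\<close>.\<close>
lemma gaussian_term:
  fixes f L W y :: real and n :: nat
  assumes "0 < L" "0 < W" "0 < n" and \<tau>: "\<tau> = \<i> * of_real (W / L)"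
  shows "qexp (\<tau> * (of_real f)\<^sup>2 / (2 * of_nat n) + of_real f * (Complex x y / of_real L)) * of_real (exp (- pi * n * y\<^sup>2 / (L * W)))
       = qexp (of_real (f * x / L)) * of_real (exp (- pi * (W / L) * n * (f / n + y / W)\<^sup>2))"
proof -
  have "2 * of_real pi * \<i> * (\<tau> * (of_real f)\<^sup>2 / (2 * of_nat n) + of_real f * (Complex x y / of_real L)) + of_real (- pi * n * y\<^sup>2 / (L * W))
    = 2 * of_real pi * \<i> * of_real (f * x / L) + of_real (- pi * (W / L) * n * (f / n + y / W)\<^sup>2)"
    using assms by (simp add: \<tau> complex_eq_iff field_simps power2_eq_square)
  then show ?thesis
    unfolding qexp_def exp_of_real[symmetric] exp_add[symmetric] by (rule arg_cong)
qed

text \<open>The substitution s = k + c + y turns the integrals into those over consecutive unit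
  intervals, which add up to the whole Gaussian integral. The existence of the sum is assumed, and
  its value is found along the exhausting sets {-K..<K}.\<close>

lemma gaussian_tiling:
  fixes a c :: real
  assumes a: "0 < a"
    and sum: "((\<lambda>k::int. LINT y:{0..<1}|lborel. exp (- a * (of_int k + c + y)\<^sup>2)) has_sum S) UNIV"
  shows "S = sqrt (pi / a)"
proof -
  let ?h = "\<lambda>s::real. exp (- a * s\<^sup>2)"
  have h: "has_bochner_integral lborel ?h (sqrt (pi / a))"
  proof -
    have "has_bochner_integral lborel (\<lambda>x. exp (- (0 + sqrt a * x)\<^sup>2)) (sqrt pi /\<^sub>R \<bar>sqrt a\<bar>)"
      using lborel_has_bochner_integral_real_affine_iff[of "sqrt a" "\<lambda>x. exp (- x\<^sup>2)" "sqrt pi" 0] a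
        has_bochner_integral_even_function[OF gaussian_moment_0] by simp
    then show ?thesis using a by (simp add: power_mult_distrib real_sqrt_divide field_simps)
  qed
  then have hi: "integrable lborel ?h" and hv: "integral\<^sup>L lborel ?h = sqrt (pi / a)"
    by (auto simp: has_bochner_integral_iff)
  define I where "I k = {of_int k + c..<of_int k + c + 1}" for k :: int
  have shift: "(LINT y:{0..<1}|lborel. exp (- a * (of_int k + c + y)\<^sup>2)) = (LINT s:I k|lborel. ?h s)" for k
    unfolding set_lebesgue_integral_def
    by (subst lborel_integral_real_affine[where c = 1 and t = "of_int k + c"])
       (auto simp: I_def indicator_def intro!: Bochner_Integration.integral_cong)
  have "(\<lambda>K::nat. LINT s:{c - K..<c + K}|lborel. ?h s) \<longlonglongrightarrow> (LINT s|lborel. ?h s)"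
    unfolding set_lebesgue_integral_def
  proof (rule integral_dominated_convergence[where w = ?h])
    show "AE s in lborel. (\<lambda>K::nat. indicator {c - K..<c + K} s *\<^sub>R ?h s) \<longlonglongrightarrow> ?h s"
    proof (rule AE_I2)
      fix s
      obtain K0 :: nat where "\<bar>s - c\<bar> < K0" using reals_Archimedean2 by blast
      then have "eventually (\<lambda>K::nat. indicator {c - K..<c + K} s *\<^sub>R ?h s = ?h s) sequentially"
        by (intro eventually_sequentiallyI[of K0]) (auto simp: indicator_def abs_less_iff)
      then show "(\<lambda>K::nat. indicator {c - K..<c + K} s *\<^sub>R ?h s) \<longlonglongrightarrow> ?h s"
        by (rule tendsto_eventually)
    qed
  qed (use hi in \<open>auto simp: indicator_def\<close>)
  moreover have "(LINT s:{c - K..<c + K}|lborel. ?h s) = (\<Sum>k\<in>{- int K..<int K}. LINT s:I k|lborel. ?h s)" for K :: nat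
  proof -
    have "(\<Union>k\<in>{- int K..<int K}. I k) = {c - K..<c + K}"
    proof (rule subset_antisym; rule subsetI)
      fix s assume "s \<in> (\<Union>k\<in>{- int K..<int K}. I k)"
      then obtain k where k: "- int K \<le> k" "k + 1 \<le> int K" "s \<in> I k" by auto
      have "- real K \<le> real_of_int k" "real_of_int k + 1 \<le> real K" using k(1,2) by linarith+
      then show "s \<in> {c - real K..<c + real K}" using k(3) by (auto simp: I_def)
    next
      fix s assume "s \<in> {c - real K..<c + real K}"
      then have "- int K \<le> \<lfloor>s - c\<rfloor>" "\<lfloor>s - c\<rfloor> < int K" by (auto simp: le_floor_iff floor_less_iff)
      moreover have "of_int \<lfloor>s - c\<rfloor> \<le> s - c" "s - c < of_int \<lfloor>s - c\<rfloor> + 1" by linarith+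
      then have "s \<in> I \<lfloor>s - c\<rfloor>" unfolding I_def by (simp only: atLeastLessThan_iff) linarith
      ultimately show "s \<in> (\<Union>k\<in>{- int K..<int K}. I k)" by auto
    qed
    moreover have "(LINT s:(\<Union>k\<in>{- int K..<int K}. I k)|lborel. ?h s) = (\<Sum>k\<in>{- int K..<int K}. LINT s:I k|lborel. ?h s)"
    proof (rule set_integral_finite_Union)
      show "disjoint_family_on I {- int K..<int K}"
        unfolding disjoint_family_on_def
      proof (intro ballI impI)
        fix m k :: int assume "m \<noteq> k"
        then have "real_of_int m + 1 \<le> real_of_int k \<or> real_of_int k + 1 \<le> real_of_int m" by linarith
        then show "I m \<inter> I k = {}" by (auto simp: I_def)
      qed
      show "set_integrable lborel (I k) ?h" for k
        unfolding set_integrable_def by (rule integrable_mult_indicator) (use hi in \<open>auto simp: I_def\<close>)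
    qed (auto simp: I_def)
    ultimately show ?thesis by simp
  qed
  ultimately have lim: "(\<lambda>K::nat. \<Sum>k\<in>{- int K..<int K}. LINT s:I k|lborel. ?h s) \<longlonglongrightarrow> sqrt (pi / a)"
    by (simp only: hv)
  \<comment> \<open>Every finite set of integers is eventually contained in {-K..<K}, so convergence
    over finite sets implies convergence of this sequence.\<close>
  have "filterlim (\<lambda>K::nat. {- int K..<int K}) (finite_subsets_at_top UNIV) sequentially"
    unfolding filterlim_finite_subsets_at_top
  proof safe
    fix X :: "int set" assume "finite X"
    define B where "B = Max (insert 0 (abs ` X))"
    have B: "\<bar>x\<bar> \<le> B" if "x \<in> X" for x
      unfolding B_def using \<open>finite X\<close> that by (intro Max_ge) auto
    show "\<forall>\<^sub>F K in sequentially. finite {- int K..<int K} \<and> X \<subseteq> {- int K..<int K} \<and> {- int K..<int K} \<subseteq> UNIV"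
      by (rule eventually_sequentiallyI[of "nat (B + 1)"]) (use B in \<open>fastforce simp: abs_le_iff\<close>)
  qed
  then have "(\<lambda>K::nat. \<Sum>k\<in>{- int K..<int K}. LINT s:I k|lborel. ?h s) \<longlonglongrightarrow> S"
    using sum unfolding has_sum_def shift by (rule filterlim_compose[rotated])
  then show ?thesis using lim by (rule LIMSEQ_unique)
qed


text \<open>Termwise integration of the product of two theta series. The integral over x leaves only
  resonant pairs of modes, the integral over y is one of Gaussians.\<close>

lemma btheta_orthogonal_aux:
  fixes L W \<rho> \<rho>' :: real and n :: nat and d :: int
  assumes L: "0 < L" and W: "0 < W" and n: "0 < n" and \<tau>: "\<tau> = \<i> * of_real (W / L)" and d: "\<rho> - \<rho>' = of_int d"
  shows "((\<lambda>(k, l). of_real (LINT y:{0..<W}|lborel. torus_gauss n L W \<rho> k y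
                * torus_gauss n L W \<rho>' l y)
              * (if d + int n * (k - l) = 0 then of_real L else 0))
        has_sum torus_inner n L W (btheta n \<tau> (of_real \<rho>)) (btheta n \<tau> (of_real \<rho>'))) (UNIV \<times> UNIV)"
proof -
  have \<tau>0: "Im \<tau> > 0" using L W by (simp add: \<tau>)
  define t where "t \<rho> k v = qexp (\<tau> * (of_real \<rho> + of_nat n * of_int k)\<^sup>2 / (2 * of_nat n) + (of_real \<rho> + of_nat n * of_int k) * v)"
    for \<rho> :: real and k :: int and v
  define g where "g z = complex_of_real (exp (- pi * n * (Im z)\<^sup>2 / (L * W)))" for z
  define a where "a \<rho> k z = t \<rho> k (z / of_real L) * g z" for \<rho> k z
  \<comment> \<open>For real frequencies the modulus of a mode is monotone in Im v, so on 0 <= Im v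
    <= Im tau it is at most the sum of its values at the two ends. These are summable because the
    series converges at 0 and at tau.\<close>
  define A where "A \<rho> k = norm (t \<rho> k 0) + norm (t \<rho> k \<tau>)" for \<rho> k
  have t_sum: "((\<lambda>k. t \<rho> k v) has_sum btheta n \<tau> (of_real \<rho>) v) UNIV" for \<rho> v
    unfolding t_def by (rule btheta_has_sum[OF \<tau>0 n])
  have a_sum: "((\<lambda>k. a \<rho> k z) has_sum btheta n \<tau> (of_real \<rho>) (z / of_real L) * g z) UNIV" for \<rho> z
    unfolding a_def by (rule has_sum_cmult_left[OF t_sum])
  have A_sum: "A \<rho> summable_on UNIV" for \<rho>
    unfolding A_def
    by (intro summable_on_add; simp flip: summable_on_iff_abs_summable_on_complex)
       (auto intro: has_sum_imp_summable[OF t_sum])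
  have A_nonneg: "A \<rho> k \<ge> 0" for \<rho> k by (simp add: A_def)
  have a_le: "norm (a \<rho> k z) \<le> A \<rho> k" if z: "z \<in> Lambda L W" for \<rho> k z
  proof -
    let ?f = "\<rho> + n * of_int k"
    have nt: "norm (t \<rho> k v) = norm (t \<rho> k 0) * exp (- 2 * pi * ?f * Im v)" for v
    proof -
      have "(of_real \<rho> + of_nat n * of_int k) = complex_of_real ?f" by simp
      then show ?thesis unfolding t_def qexp_add norm_mult by (simp only: norm_qexp) simp
    qed
    have u: "0 \<le> Im (z / of_real L)" "Im (z / of_real L) \<le> Im \<tau>" using z L W
      by (auto simp: Lambda_def \<tau> divide_right_mono)
    have "exp (- 2 * pi * ?f * Im (z / of_real L)) \<le> 1 + exp (- 2 * pi * ?f * Im \<tau>)"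
    proof (cases "?f \<ge> 0")
      case True
      then have "0 \<le> 2 * pi * ?f * Im (z / of_real L)" by (intro mult_nonneg_nonneg) (use u in auto)
      then have "exp (- 2 * pi * ?f * Im (z / of_real L)) \<le> 1" by (subst exp_le_one_iff) linarith
      then show ?thesis using exp_ge_zero[of "- 2 * pi * ?f * Im \<tau>"] by linarith
    next
      case False
      then have "- 2 * pi * ?f \<ge> 0" by (simp add: mult_nonneg_nonpos)
      then have "- 2 * pi * ?f * Im (z / of_real L) \<le> - 2 * pi * ?f * Im \<tau>" by (rule mult_left_mono[OF u(2)])
      then have "exp (- 2 * pi * ?f * Im (z / of_real L)) \<le> exp (- 2 * pi * ?f * Im \<tau>)" by (simp only: exp_le_cancel_iff)
      then show ?thesis by linarith
    qed
    then have "norm (t \<rho> k (z / of_real L)) \<le> norm (t \<rho> k 0) * (1 + exp (- 2 * pi * ?f * Im \<tau>))"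
      unfolding nt[of "z / of_real L"] by (rule mult_left_mono) simp
    also have "\<dots> = A \<rho> k" unfolding A_def nt[of \<tau>] by (simp add: algebra_simps)
    finally have "norm (t \<rho> k (z / of_real L)) \<le> A \<rho> k" .
    moreover have "norm (g z) \<le> 1" using L W by (simp add: g_def)
    ultimately show ?thesis unfolding a_def norm_mult
      using mult_mono[of "norm (t \<rho> k (z / of_real L))" "A \<rho> k" "norm (g z)" 1] A_nonneg by simp
  qed
  define G where "G z = btheta n \<tau> (of_real \<rho>) (z / of_real L) * g z * cnj (btheta n \<tau> (of_real \<rho>') (z / of_real L) * g z)" for z
  have G: "G z = btheta n \<tau> (of_real \<rho>) (z / of_real L) * cnj (btheta n \<tau> (of_real \<rho>') (z / of_real L))
              * of_real (background n L W z)" for z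
  proof -
    have "exp (- pi * n * (Im z)\<^sup>2 / (L * W)) * exp (- pi * n * (Im z)\<^sup>2 / (L * W)) = background n L W z"
      by (simp flip: exp_add)
    then have "g z * cnj (g z) = of_real (background n L W z)"
      by (simp only: g_def complex_cnj_complex_of_real of_real_mult[symmetric])
    then show ?thesis by (simp add: G_def mult_ac)
  qed
  have cont: "continuous_on UNIV (a \<rho> k)" for \<rho> k
    unfolding a_def t_def g_def by (intro continuous_intros) (use L W in auto)
  have "((\<lambda>p. LINT z:Lambda L W|lborel. (case p of (k, l) \<Rightarrow> a \<rho> k z * cnj (a \<rho>' l z))) has_sum (LINT z:Lambda L W|lborel. G z)) (UNIV \<times> UNIV)"
  proof (rule has_sum_set_integral[where b = "\<lambda>(k, l). A \<rho> k * A \<rho>' l"])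
    show "emeasure lborel (Lambda L W) < \<infinity>" by (simp add: emeasure_Lambda[OF L W])
    show "(\<lambda>z. case p of (k, l) \<Rightarrow> a \<rho> k z * cnj (a \<rho>' l z)) \<in> borel_measurable lborel" for p
      using cont by (auto simp: case_prod_unfold intro!: borel_measurable_continuous_onI continuous_intros)
    show "G \<in> borel_measurable lborel"
      unfolding G_def g_def
      by (auto intro!: borel_measurable_continuous_onI continuous_intros \<tau>0 n simp: L W less_imp_neq[symmetric])
    show "norm (case p of (k, l) \<Rightarrow> a \<rho> k z * cnj (a \<rho>' l z)) \<le> (case p of (k, l) \<Rightarrow> A \<rho> k * A \<rho>' l)"
      if "z \<in> Lambda L W" for p z
      using a_le[OF that] A_nonneg by (auto simp: case_prod_unfold norm_mult intro!: mult_mono)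
    show "(\<lambda>(k, l). A \<rho> k * A \<rho>' l) summable_on UNIV \<times> UNIV"
      by (rule summable_on_SigmaI[where g = "\<lambda>k. A \<rho> k * infsum (A \<rho>') UNIV"])
         (auto intro!: has_sum_cmult_right summable_on_cmult_left A_sum has_sum_infsum mult_nonneg_nonneg A_nonneg)
    show "((\<lambda>p. case p of (k, l) \<Rightarrow> a \<rho> k z * cnj (a \<rho>' l z)) has_sum G z) (UNIV \<times> UNIV)" for z
      unfolding G_def by (rule has_sum_mult_Times[OF a_sum]) (simp only: has_sum_cnj_iff a_sum)
  qed auto
  also have "(\<lambda>p. LINT z:Lambda L W|lborel. (case p of (k, l) \<Rightarrow> a \<rho> k z * cnj (a \<rho>' l z)))
    = (\<lambda>(k, l). of_real (LINT y:{0..<W}|lborel. torus_gauss n L W \<rho> k y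
                * torus_gauss n L W \<rho>' l y)
              * (if d + int n * (k - l) = 0 then of_real L else 0))"
  proof (rule ext)
    fix p :: "int \<times> int"
    obtain k l where p: "p = (k, l)" by (rule prod.exhaust)
    define \<gamma> where "\<gamma> y = torus_gauss n L W \<rho> k y * torus_gauss n L W \<rho>' l y" for y
    have az: "a \<rho> k (Complex x y) = qexp (of_real ((\<rho> + n * of_int k) * x / L)) * of_real (torus_gauss n L W \<rho> k y)"
      for x y and \<rho> :: real and k :: int
    proof -
      have "(of_real \<rho> + of_nat n * of_int k) = complex_of_real (\<rho> + n * of_int k)" by simp
      moreover have "(\<rho> + n * of_int k) / n + y / W = of_int k + \<rho> / n + y / W" using n by (simp add: field_simps)
      ultimately show ?thesis
        using gaussian_term[OF L W n \<tau>, of "\<rho> + n * of_int k" x y] unfolding a_def t_def g_def by simp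
    qed
    have term_eq: "a \<rho> k (Complex x y) * cnj (a \<rho>' l (Complex x y)) = of_real (\<gamma> y) * qexp (of_int (d + int n * (k - l)) * of_real x / of_real L)" for x y
    proof -
      have c: "cnj (qexp (of_real r)) = qexp (- of_real r)" for r
        by (simp add: qexp_def exp_cnj)
      have "(\<rho> + n * of_int k) * x / L + - ((\<rho>' + n * of_int l) * x / L) = ((\<rho> - \<rho>') + n * of_int (k - l)) * x / L"
        by (simp add: algebra_simps diff_divide_distrib add_divide_distrib)
      then have "of_real ((\<rho> + n * of_int k) * x / L) + - of_real ((\<rho>' + n * of_int l) * x / L) = (of_real (((\<rho> - \<rho>') + n * of_int (k - l)) * x / L) :: complex)"
        by (simp only: of_real_add[symmetric] of_real_minus[symmetric])
      also have "\<dots> = of_int (d + int n * (k - l)) * of_real x / of_real L"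
        unfolding d by simp
      finally have "qexp (of_int (d + int n * (k - l)) * of_real x / of_real L)
          = qexp (of_real ((\<rho> + n * of_int k) * x / L)) * qexp (- of_real ((\<rho>' + n * of_int l) * x / L))"
        by (simp only: qexp_add[symmetric])
      then show ?thesis
        unfolding az complex_cnj_mult c \<gamma>_def complex_cnj_complex_of_real of_real_mult by (simp only: mult_ac)
    qed
    have "set_integrable lborel (Lambda L W) (\<lambda>z. a \<rho> k z * cnj (a \<rho>' l z))"
      using cont by (intro set_integrable_Lambda L W continuous_intros)
    from set_integral_Lambda[OF this]
    have "(LINT z:Lambda L W|lborel. a \<rho> k z * cnj (a \<rho>' l z))
        = (LINT y:{0..<W}|lborel. of_real (\<gamma> y) * (if d + int n * (k - l) = 0 then of_real L else 0))"
      by (simp only: term_eq set_integral_mult_right integral_qexp[OF L])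
    also have "\<dots> = of_real (LINT y:{0..<W}|lborel. \<gamma> y) * (if d + int n * (k - l) = 0 then of_real L else 0)"
      by (simp only: set_integral_mult_left set_integral_complex_of_real)
    finally show "(LINT z:Lambda L W|lborel. (case p of (k, l) \<Rightarrow> a \<rho> k z * cnj (a \<rho>' l z)))
       = (case p of (k, l) \<Rightarrow> of_real (LINT y:{0..<W}|lborel. torus_gauss n L W \<rho> k y
                * torus_gauss n L W \<rho>' l y)
              * (if d + int n * (k - l) = 0 then of_real L else 0))"
      unfolding p case_prod_conv \<gamma>_def .
  qed
  finally show ?thesis unfolding G .
qed

lemma btheta_orthogonal:
  fixes L W \<rho> \<rho>' :: real and n :: nat and d :: int
  assumes L: "0 < L" and W: "0 < W" and n: "0 < n" and \<tau>: "\<tau> = \<i> * of_real (W / L)" and d: "\<rho> - \<rho>' = of_int d"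
    and "\<not> int n dvd d"
  shows "torus_inner n L W (btheta n \<tau> (of_real \<rho>)) (btheta n \<tau> (of_real \<rho>')) = 0"
proof -
  have "d + int n * (k - l) \<noteq> 0" for k l :: int
  proof
    assume "d + int n * (k - l) = 0"
    then have "d = int n * (l - k)" by (simp add: algebra_simps)
    then show False using \<open>\<not> int n dvd d\<close> by simp
  qed
  then show ?thesis
    using btheta_orthogonal_aux[OF L W n \<tau> d] by (simp add: case_prod_unfold has_sum_unique[OF _ has_sum_0_simp])
qed

text \<open>Only the modes k = l resonate. Squaring \<open>torus_gauss\<close> doubles the exponent,
  whence the factor 2 in \<open>?a\<close> and under the root of the norm constant.\<close>

lemma btheta_norm:
  fixes L W \<rho> :: real and n :: nat
  assumes L: "0 < L" and W: "0 < W" and n: "0 < n" and \<tau>: "\<tau> = \<i> * of_real (W / L)"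
  shows "torus_inner n L W (btheta n \<tau> (of_real \<rho>)) (btheta n \<tau> (of_real \<rho>)) = of_real (L * W / sqrt (2 * n * (W / L)))"
    (is "?I = _")
proof -
  let ?a = "2 * pi * (W / L) * n"
  let ?J = "\<lambda>k::int. LINT u:{0..<1}|lborel. exp (- ?a * (of_int k + \<rho> / n + u)\<^sup>2)"
  have J: "(LINT y:{0..<W}|lborel. torus_gauss n L W \<rho> k y * torus_gauss n L W \<rho> k y)
      = W * ?J k" for k :: int
  proof -
    have eq: "torus_gauss n L W \<rho> k y * torus_gauss n L W \<rho> k y
       = exp (- ?a * (of_int k + \<rho> / n + y / W)\<^sup>2)" for y
      by (simp flip: exp_add)
    show ?thesis
      unfolding set_lebesgue_integral_def eq using W
      by (subst lborel_integral_real_affine[where c = W and t = 0])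
         (auto simp: indicator_def zero_le_mult_iff intro!: Bochner_Integration.integral_cong)
  qed
  have "((\<lambda>(k, l). of_real (LINT y:{0..<W}|lborel. torus_gauss n L W \<rho> k y
                * torus_gauss n L W \<rho> l y)
              * (if 0 + int n * (k - l) = 0 then of_real L else 0)) has_sum ?I) (UNIV \<times> UNIV)"
    by (rule btheta_orthogonal_aux[OF L W n \<tau>]) simp
  then have "((\<lambda>(k, l). of_real (LINT y:{0..<W}|lborel. torus_gauss n L W \<rho> k y
                * torus_gauss n L W \<rho> l y)
              * (if 0 + int n * (k - l) = 0 then of_real L else 0)) has_sum ?I) (range (\<lambda>k. (k, k)))"
    by (rule has_sum_cong_neutral[THEN iffD1, rotated -1]) (use n in auto)
  then have "((\<lambda>k. of_real (LINT y:{0..<W}|lborel. torus_gauss n L W \<rho> k y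
                * torus_gauss n L W \<rho> k y) * of_real L) has_sum ?I) UNIV"
    by (subst (asm) has_sum_reindex) (auto simp: inj_on_def o_def)
  then have "((\<lambda>k. of_real (W * ?J k) * of_real L) has_sum ?I) UNIV"
    unfolding J .
  then have s: "((\<lambda>k. complex_of_real (L * W * ?J k)) has_sum ?I) UNIV"
    by (simp add: mult_ac)
  \<comment> \<open>The tiling argument is about real sums, so the imaginary part of the inner
    product is dealt with first.\<close>
  have "((\<lambda>k::int. 0) has_sum Im ?I) UNIV" using has_sum_Im[OF s] by simp
  then have Im: "Im ?I = 0" using has_sum_unique has_sum_0_simp by blast
  have "((\<lambda>k. L * W * ?J k) has_sum Re ?I) UNIV" using has_sum_Re[OF s] by simp
  from has_sum_cmult_right[OF this, of "1 / (L * W)"] have "(?J has_sum Re ?I / (L * W)) UNIV"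
    using L W by simp
  then have "Re ?I / (L * W) = sqrt (pi / ?a)"
    by (rule gaussian_tiling[rotated]) (use L W n in simp)
  also have "\<dots> = 1 / sqrt (2 * n * (W / L))"
    by (simp add: real_sqrt_divide mult_ac)
  finally have "Re ?I = L * W / sqrt (2 * n * (W / L))" using L W by (simp add: field_simps)
  then show ?thesis using Im by (simp add: complex_eq_iff)
qed

subsection \<open>Logarithmic potentials\<close>

text \<open>The mean value property of Re log f: without zeros f has a holomorphic logarithm on the
  ball, and the parametrised Cauchy formula for it is the average over the unit circle. R > 1 keeps
  the circle inside the domain.\<close>

lemma has_integral_ln_norm_circle:
  assumes f: "f holomorphic_on ball 0 R" and R: "1 < R" and nz: "\<And>w. w \<in> ball 0 R \<Longrightarrow> f w \<noteq> 0"
  shows "((\<lambda>x. ln (cmod (f (qexp (of_real x))))) has_integral ln (cmod (f 0))) {0..1}"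
proof -
  obtain g where g: "g holomorphic_on ball 0 R" and eg: "\<And>w. w \<in> ball 0 R \<Longrightarrow> exp (g w) = f w"
    using holomorphic_logarithm_exists[of "ball 0 R" f 0] f nz R by auto
  have lnf: "ln (cmod (f w)) = Re (g w)" if "w \<in> ball 0 R" for w
    using eg[OF that, symmetric] by (simp add: norm_exp_eq_Re)
  have "g holomorphic_on cball 0 1" using g by (rule holomorphic_on_subset) (use R in auto)
  then have "((\<lambda>u. g u / (u - 0)) has_contour_integral 2 * of_real pi * \<i> * g 0) (circlepath 0 1)"
    by (rule Cauchy_integral_circlepath_simple) simp
  then have "((\<lambda>x. g (circlepath 0 1 x) / circlepath 0 1 x * vector_derivative (circlepath 0 1) (at x within {0..1}))
      has_integral 2 * of_real pi * \<i> * g 0) {0..1}"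
    by (simp add: has_contour_integral_def)
  then have "((\<lambda>x. 2 * of_real pi * \<i> * g (qexp (of_real x))) has_integral 2 * of_real pi * \<i> * g 0) {0..1}"
  proof (rule has_integral_eq[rotated])
    fix x :: real assume x: "x \<in> {0..1}"
    have "circlepath 0 1 x = qexp (of_real x)" by (simp add: circlepath qexp_def mult_ac)
    moreover have "vector_derivative (circlepath 0 1) (at x within {0..1}) = 2 * of_real pi * \<i> * qexp (of_real x)"
      using x by (simp add: vector_derivative_circlepath01 qexp_def mult_ac)
    ultimately show "g (circlepath 0 1 x) / circlepath 0 1 x * vector_derivative (circlepath 0 1) (at x within {0..1})
        = 2 * of_real pi * \<i> * g (qexp (of_real x))" by simp
  qed
  from has_integral_mult_right[OF this, of "1 / (2 * of_real pi * \<i>)"]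
  have "((\<lambda>x. g (qexp (of_real x))) has_integral g 0) {0..1}" by simp
  from has_integral_linear[OF this bounded_linear_Re]
  have "((\<lambda>x. Re (g (qexp (of_real x)))) has_integral Re (g 0)) {0..1}" by (simp add: o_def)
  then show ?thesis
    by (subst lnf) (use R in simp, rule has_integral_eq[rotated], assumption, use R in \<open>simp add: lnf norm_qexp\<close>)
qed

lemma qpoch_nonzero:
  assumes "norm q < 1" "norm w < 1"
  shows "qpoch q w \<noteq> 0"
proof
  assume "qpoch q w = 0"
  then obtain k where "w * q ^ k = 1" using qpoch_eq_0D[OF assms(1)] by blast
  then have "norm w * norm q ^ k = 1" by (metis norm_mult norm_one norm_power)
  moreover have "norm w * norm q ^ k \<le> norm w * 1"
    using assms by (intro mult_left_mono power_le_one) auto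
  ultimately show False using assms by simp
qed

text \<open>As |a| < 1, the zeros of the series in a w^k stay off a disc larger than the unit disc,
  and the mean is the value ln 1 at the centre. The multiple K accommodates theta_1(2 z / L) and
  reflected arguments.\<close>

lemma has_integral_ln_qpoch:
  fixes K :: int
  assumes q: "norm q < 1" and a: "norm a < 1" and K: "K \<noteq> 0" and L: "0 < L"
  shows "((\<lambda>x. ln (cmod (qpoch q (a * qexp (of_int K * of_real x / of_real L))))) has_integral 0) {0..L}"
proof -
  define k where "k = nat \<bar>K\<bar>"
  have k: "0 < k" using K by (simp add: k_def)
  have 01: "((\<lambda>x. ln (cmod (qpoch q (a * qexp (of_real x) ^ k)))) has_integral 0) {0..1}"
  proof -
    \<comment> \<open>The largest radius that works is the one with |a| R^k = 1; for a = 0 any R > 1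
      will do.\<close>
    obtain R where R: "1 < R" "norm a * R ^ k \<le> 1"
    proof (cases "a = 0")
      case False
      show ?thesis
      proof (rule that[of "root k (1 / norm a)"])
        show "1 < root k (1 / norm a)" using False a k by (simp add: real_root_gt_1_iff)
        show "norm a * root k (1 / norm a) ^ k \<le> 1" using False k by (simp add: real_root_pow_pos2)
      qed
    qed (use that[of 2] in simp)
    have "((\<lambda>x. ln (cmod (qpoch q (a * qexp (of_real x) ^ k)))) has_integral ln (cmod (qpoch q (a * 0 ^ k)))) {0..1}"
    proof (rule has_integral_ln_norm_circle[where R = R and f = "\<lambda>w. qpoch q (a * w ^ k)"])
      show "(\<lambda>w. qpoch q (a * w ^ k)) holomorphic_on ball 0 R" by (intro holomorphic_intros q)
      fix w :: complex assume w: "w \<in> ball 0 R"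
      have "norm (a * w ^ k) < 1"
      proof (cases "a = 0")
        case False
        have "norm w ^ k < R ^ k" using w k by (intro power_strict_mono) auto
        then have "norm a * norm w ^ k < norm a * R ^ k" using False by simp
        then show ?thesis using R by (simp add: norm_mult norm_power)
      qed simp
      then show "qpoch q (a * w ^ k) \<noteq> 0" by (rule qpoch_nonzero[OF q])
    qed (use R in simp)
    then show ?thesis unfolding zero_power[OF k] by simp
  qed
  have img: "(\<lambda>x. L *\<^sub>R x + - (L *\<^sub>R 0)) ` cbox 0 1 = {0..L}" "(\<lambda>x. - L *\<^sub>R x + - (- L *\<^sub>R 1)) ` cbox 0 1 = {0..L}"
  proof -
    show "(\<lambda>x. L *\<^sub>R x + - (L *\<^sub>R 0)) ` cbox 0 1 = {0..L}"
      using L by (simp add: image_mult_atLeastAtMost)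
    have "(\<lambda>x. - L *\<^sub>R x + - (- L *\<^sub>R 1)) ` cbox 0 1 = (\<lambda>x. - L * x + L) ` {0..1}" by simp
    also have "\<dots> = {0..L}" using L by (subst image_affinity_atLeastAtMost) auto
    finally show "(\<lambda>x. - L *\<^sub>R x + - (- L *\<^sub>R 1)) ` cbox 0 1 = {0..L}" .
  qed
  show ?thesis
  proof (cases "K > 0")
    case True
    have "qexp (of_real ((1 / L) *\<^sub>R x + 0)) ^ k = qexp (of_int K * of_real x / of_real L)" for x
      using True by (simp add: k_def flip: qexp_of_nat_mult)
    then show ?thesis
      using has_integral_affinity[of _ 0 0 1 "1 / L" 0, OF 01[folded box_real]] L img(1) by simp
  next
    \<comment> \<open>A negative frequency is the positive one traversed backwards, by the
      substitution 1 - x / L for x.\<close>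
    case False
    have "qexp (of_real (- (1 / L) *\<^sub>R x + 1)) ^ k = qexp (of_int K * of_real x / of_real L)" for x
    proof -
      have "qexp (of_real (- (1 / L) *\<^sub>R x + 1)) ^ k = qexp (of_nat k * (of_real (- (1 / L) *\<^sub>R x + 1)))"
        by (simp only: qexp_of_nat_mult)
      also have "of_nat k * (of_real (- (1 / L) *\<^sub>R x + 1)) = of_int K * of_real x / of_real L + complex_of_int (int k)"
        using False by (simp add: k_def algebra_simps)
      finally show ?thesis by (simp only: qexp_add qexp_of_int mult_1_right)
    qed
    then show ?thesis
      using has_integral_affinity[of _ 0 0 1 "- (1 / L)" 1, OF 01[folded box_real]] L img(2) by simp
  qed
qed

text \<open>In the strip |Im v| < Im tau / 2 both factors of the triple product have arguments
  inside the unit disc, so their logarithms average to 0.\<close>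

lemma has_integral_ln_jtheta:
  fixes K :: int
  assumes \<tau>: "Im \<tau> > 0" and v0: "\<bar>Im v0\<bar> < Im \<tau> / 2" and K: "K \<noteq> 0" and L: "0 < L"
  shows "((\<lambda>x. ln (cmod (jtheta \<tau> (v0 + of_int K * of_real x / of_real L)))) has_integral L * ln (cmod (jtheta_const \<tau>))) {0..L}"
proof -
  let ?q = "qexp \<tau>" and ?r = "qexp (\<tau> / 2)"
  have q: "norm ?q < 1" using \<tau> by (rule norm_qexp_less_1)
  have small: "norm (- ?r * qexp v) < 1" if "\<bar>Im v\<bar> < Im \<tau> / 2" for v
  proof -
    have "norm (- ?r * qexp v) = exp (- 2 * pi * (Im \<tau> / 2 + Im v))"
      by (simp add: norm_mult norm_qexp distrib_left flip: exp_add)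
    also have "\<dots> < 1" using that by (simp add: abs_less_iff)
    finally show ?thesis .
  qed
  let ?v = "\<lambda>x. v0 + of_int K * of_real x / of_real L"
  have Imv: "Im (?v x) = Im v0" for x using L by simp
  have "((\<lambda>x. ln (cmod (jtheta_const \<tau>)) + ln (cmod (qpoch ?q (- ?r * qexp v0 * qexp (of_int K * of_real x / of_real L))))
        + ln (cmod (qpoch ?q (- ?r * qexp (- v0) * qexp (of_int (- K) * of_real x / of_real L)))))
      has_integral L * ln (cmod (jtheta_const \<tau>)) + 0 + 0) {0..L}"
    using L K v0 has_integral_const_real[of "ln (cmod (jtheta_const \<tau>))" 0 L]
    by (intro has_integral_add has_integral_ln_qpoch q small) auto
  moreover have "ln (cmod (jtheta_const \<tau>)) + ln (cmod (qpoch ?q (- ?r * qexp v0 * qexp (of_int K * of_real x / of_real L))))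
        + ln (cmod (qpoch ?q (- ?r * qexp (- v0) * qexp (of_int (- K) * of_real x / of_real L))))
      = ln (cmod (jtheta \<tau> (?v x)))" for x
  proof -
    have 1: "- ?r * qexp v0 * qexp (of_int K * of_real x / of_real L) = - ?r * qexp (?v x)"
      by (simp add: qexp_add)
    have 2: "- ?r * qexp (- v0) * qexp (of_int (- K) * of_real x / of_real L) = - ?r * qexp (- ?v x)"
    proof -
      have "- v0 + of_int (- K) * of_real x / of_real L = - ?v x" by simp
      then show ?thesis by (simp only: mult.assoc qexp_add[symmetric])
    qed
    have n1: "qpoch ?q (- ?r * qexp (?v x)) \<noteq> 0"
      by (rule qpoch_nonzero[OF q small]) (use v0 Imv[of x] in simp)
    have n2: "qpoch ?q (- ?r * qexp (- ?v x)) \<noteq> 0"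
      by (rule qpoch_nonzero[OF q small]) (use v0 Imv[of x] in simp)
    show ?thesis
      unfolding 1 2 jtheta_conv_prod[OF \<tau>] jtheta_prod_def norm_mult
      using n1 n2 jtheta_const_nonzero[OF \<tau>] by (simp add: ln_mult)
  qed
  ultimately show ?thesis by simp
qed

text \<open>The mean of ln |theta_1| on the lines of the strip 0 < Im v < Im tau, extrapolated to
  height 0. The second term comes from the factor q^(1/8), q = \<open>qexp \<tau>\<close>, that
  separates theta_1 from \<open>jtheta\<close>.\<close>

definition theta1_mean :: "complex \<Rightarrow> real" where
  "theta1_mean \<tau> = ln (cmod (jtheta_const \<tau>)) - pi * Im \<tau> / 4"

lemma theta1_nonzero:
  assumes "Im \<tau> > 0" "0 < Im v" "Im v < Im \<tau>"
  shows "theta1 v \<tau> \<noteq> 0"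
proof
  assume "theta1 v \<tau> = 0"
  then obtain k :: int where k: "Im v = of_int k * Im \<tau>" using theta1_eq_0D[OF assms(1)] by blast
  then have "0 < real_of_int k" "real_of_int k * Im \<tau> < 1 * Im \<tau>" using assms by (auto simp: zero_less_mult_iff)
  then have "0 < real_of_int k" "real_of_int k < 1" using assms(1) by simp_all
  then show False by simp
qed

lemma ln_norm_theta1:
  assumes "Im \<tau> > 0" "0 < Im v" "Im v < Im \<tau>"
  shows "ln (cmod (theta1 v \<tau>)) = pi * Im v - pi * Im \<tau> / 4 + ln (cmod (jtheta \<tau> (v + 1/2 - \<tau> / 2)))"
proof -
  have eq: "theta1 v \<tau> = - (qexp (\<tau> / 8 - (v + 1/2) / 2) * jtheta \<tau> (v + 1/2 - \<tau> / 2))"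
    using btheta_conv_jtheta[OF assms(1), of 1 "- 1/2" "v + 1/2"] unfolding theta1_conv_btheta
    by (simp add: power2_eq_square)
  then have "jtheta \<tau> (v + 1/2 - \<tau> / 2) \<noteq> 0" using theta1_nonzero[OF assms] by auto
  then show ?thesis unfolding eq by (simp add: norm_mult norm_qexp ln_mult algebra_simps)
qed

text \<open>On this strip theta_1 is an exponential times \<open>jtheta\<close> at a point lowered
  by Im tau / 2, which lies in the central strip; the exponential contributes the slope pi.\<close>

lemma has_integral_ln_theta1_strip:
  fixes K :: int
  assumes \<tau>: "Im \<tau> > 0" and v0: "0 < Im v0" "Im v0 < Im \<tau>" and K: "K \<noteq> 0" and L: "0 < L"
  shows "((\<lambda>x. ln (cmod (theta1 (v0 + of_int K * of_real x / of_real L) \<tau>))) has_integral L * (theta1_mean \<tau> + pi * Im v0)) {0..L}"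
proof -
  let ?v = "\<lambda>x. v0 + of_int K * of_real x / of_real L"
  have "((\<lambda>x. (pi * Im v0 - pi * Im \<tau> / 4) + ln (cmod (jtheta \<tau> ((v0 + 1/2 - \<tau> / 2) + of_int K * of_real x / of_real L))))
     has_integral L * (pi * Im v0 - pi * Im \<tau> / 4) + L * ln (cmod (jtheta_const \<tau>))) {0..L}"
    using has_integral_const_real[of "pi * Im v0 - pi * Im \<tau> / 4" 0 L] L v0
    by (intro has_integral_add has_integral_ln_jtheta \<tau> K L) (auto simp: abs_if)
  moreover have "(pi * Im v0 - pi * Im \<tau> / 4) + ln (cmod (jtheta \<tau> ((v0 + 1/2 - \<tau> / 2) + of_int K * of_real x / of_real L)))
      = ln (cmod (theta1 (?v x) \<tau>))" for x
  proof -
    have j: "jtheta \<tau> (?v x + 1/2 - \<tau> / 2) = jtheta \<tau> ((v0 + 1/2 - \<tau> / 2) + of_int K * of_real x / of_real L)"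
      by (rule arg_cong) simp
    have "Im (?v x) = Im v0" using L by simp
    then show ?thesis using ln_norm_theta1[OF \<tau>, of "?v x"] v0 unfolding j by simp
  qed
  ultimately show ?thesis by (simp add: theta1_mean_def algebra_simps)
qed

text \<open>Mean of \<open>ln \<bar>\<theta>\<^sub>1\<bar>\<close> over a period of the line \<open>Im v = u\<close>, relative to the value at \<open>u = 0\<close>;
  its slope jumps by \<open>2 \<pi>\<close> at each line carrying zeros.\<close>
definition theta1_profile :: "real \<Rightarrow> real \<Rightarrow> real" where
  "theta1_profile t u = pi * (u + 2 * max 0 (- u) + 2 * max 0 (u - t))"

text \<open>These are the heights that occur for (z - w) / L, (z + w) / L and 2 z / L with z, w in
  \<open>Lambda\<close>. Oddness brings the lower strip and quasi-periodicity the upper strip back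
  to 0 < Im v < Im tau.\<close>

lemma has_integral_ln_theta1:
  fixes K :: int
  assumes \<tau>: "Im \<tau> > 0" and u: "- Im \<tau> < Im v0" "Im v0 < 2 * Im \<tau>" "Im v0 \<noteq> 0" "Im v0 \<noteq> Im \<tau>"
    and K: "K \<noteq> 0" and L: "0 < L"
  shows "((\<lambda>x. ln (cmod (theta1 (v0 + of_int K * of_real x / of_real L) \<tau>))) has_integral
      L * (theta1_mean \<tau> + theta1_profile (Im \<tau>) (Im v0))) {0..L}"
proof -
  consider "Im v0 < 0" | "0 < Im v0" "Im v0 < Im \<tau>" | "Im \<tau> < Im v0" using u by linarith
  then show ?thesis
  proof cases
    case 1
    have "((\<lambda>x. ln (cmod (theta1 (- v0 + of_int (- K) * of_real x / of_real L) \<tau>))) has_integral L * (theta1_mean \<tau> + pi * Im (- v0))) {0..L}"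
      by (rule has_integral_ln_theta1_strip) (use 1 u K L \<tau> in auto)
    moreover have "- v0 + of_int (- K) * of_real x / of_real L = - (v0 + of_int K * of_real x / of_real L)" for x
      by simp
    ultimately show ?thesis using 1 \<tau> by (simp only: theta1_minus norm_minus_cancel) (simp add: theta1_profile_def)
  next
    case 2
    then show ?thesis using has_integral_ln_theta1_strip[OF \<tau> 2 K L] by (simp add: theta1_profile_def)
  next
    case 3
    let ?v = "\<lambda>x. (v0 - \<tau>) + of_int K * of_real x / of_real L"
    have "((\<lambda>x. (2 * pi * (Im v0 - Im \<tau> / 2)) + ln (cmod (theta1 (?v x) \<tau>))) has_integral
        L * (2 * pi * (Im v0 - Im \<tau> / 2)) + L * (theta1_mean \<tau> + pi * Im (v0 - \<tau>))) {0..L}"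
      using has_integral_const_real[of "2 * pi * (Im v0 - Im \<tau> / 2)" 0 L] 3 u L
      by (intro has_integral_add has_integral_ln_theta1_strip \<tau> K L) auto
    moreover have "(2 * pi * (Im v0 - Im \<tau> / 2)) + ln (cmod (theta1 (?v x) \<tau>))
        = ln (cmod (theta1 (v0 + of_int K * of_real x / of_real L) \<tau>))" for x
    proof -
      have nz: "theta1 (?v x) \<tau> \<noteq> 0" by (rule theta1_nonzero[OF \<tau>]) (use 3 u L in auto)
      have A: "ln (cmod (- qexp (- ?v x - \<tau> / 2) * T)) = 2 * pi * (Im v0 - Im \<tau> / 2) + ln (cmod T)" if "T \<noteq> 0" for T
        using that L by (simp add: norm_mult norm_qexp ln_mult algebra_simps)
      have B: "theta1 (v0 + of_int K * of_real x / of_real L) \<tau> = - qexp (- ?v x - \<tau> / 2) * theta1 (?v x) \<tau>"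
      proof -
        have e: "?v x + \<tau> = v0 + of_int K * of_real x / of_real L" by simp
        show ?thesis using theta1_plus_tau[of "?v x" \<tau>] unfolding e .
      qed
      show ?thesis unfolding B by (rule A[OF nz, symmetric])
    qed
    ultimately show ?thesis using 3 \<tau> by (simp add: theta1_profile_def algebra_simps)
  qed
qed

lemma borel_measurable_theta1 [measurable]:
  assumes "Im \<tau> > 0"
  shows "(\<lambda>v. theta1 v \<tau>) \<in> borel_measurable borel"
  by (intro borel_measurable_continuous_onI continuous_intros assms)

text \<open>Logarithmic singularities rule out a bound from below. But ln |theta_1| is at most a
  constant M on the compact rectangle, and its means over horizontal lines are bounded below, so
  Tonelli applied to M - ln |theta_1| gives integrability, and Fubini then gives the value.\<close>

lemma
  fixes K :: int and L W :: real
  assumes L: "0 < L" and W: "0 < W" and \<tau>: "\<tau> = \<i> * of_real (W / L)" and K: "K \<noteq> 0"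
    and range: "\<And>y. 0 \<le> y \<Longrightarrow> y < W \<Longrightarrow> - (W / L) < Im v0 + of_int K * y / L \<and> Im v0 + of_int K * y / L < 2 * (W / L)"
  shows set_integrable_ln_theta1: "set_integrable lborel (Lambda L W) (\<lambda>z. ln (cmod (theta1 (v0 + of_int K * z / of_real L) \<tau>)))"
    and set_integral_ln_theta1: "(LINT z:Lambda L W|lborel. ln (cmod (theta1 (v0 + of_int K * z / of_real L) \<tau>)))
      = (LINT y:{0..<W}|lborel. L * (theta1_mean \<tau> + theta1_profile (W / L) (Im v0 + of_int K * y / L)))"
proof -
  have Im\<tau>: "Im \<tau> = W / L" by (simp add: \<tau>)
  then have \<tau>0: "Im \<tau> > 0" using L W by simp
  note [measurable] = borel_measurable_theta1[OF \<tau>0]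
  let ?A = "\<lambda>z. v0 + of_int K * z / of_real L"
  define f where "f z = ln (cmod (theta1 (?A z) \<tau>))" for z
  have [measurable]: "f \<in> borel_measurable borel" unfolding f_def by measurable
  define m where "m y = L * (theta1_mean \<tau> + theta1_profile (W / L) (Im v0 + of_int K * y / L))" for y
  have [measurable]: "m \<in> borel_measurable borel" unfolding m_def theta1_profile_def by measurable
  have "compact ((\<lambda>z. theta1 (?A z) \<tau>) ` cbox 0 (Complex L W))"
    by (intro compact_continuous_image compact_cbox continuous_intros \<tau>0) (use L in auto)
  then obtain B where B: "B > 0" "\<And>z. z \<in> cbox 0 (Complex L W) \<Longrightarrow> cmod (theta1 (?A z) \<tau>) \<le> B"
    using compact_imp_bounded[of "(\<lambda>z. theta1 (?A z) \<tau>) ` cbox 0 (Complex L W)"] unfolding bounded_pos by auto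
  \<comment> \<open>The maximum with 0 covers the zeros of theta_1, where
    \<open>ln 0 = 0\<close>.\<close>
  define M where "M = max 0 (ln B)"
  have fM: "f z \<le> M" if "z \<in> Lambda L W" for z
  proof (cases "theta1 (?A z) \<tau> = 0")
    case False
    have "z \<in> cbox 0 (Complex L W)" using that by (auto simp: Lambda_def cbox_def Basis_complex_def)
    then have "ln (cmod (theta1 (?A z) \<tau>)) \<le> ln B" using B False by (intro ln_mono) auto
    then show ?thesis by (simp add: f_def M_def)
  qed (simp add: f_def M_def)
  \<comment> \<open>Lines free of zeros; at most two values of y are lost.\<close>
  define good where "good y \<longleftrightarrow> Im v0 + of_int K * y / L \<noteq> 0 \<and> Im v0 + of_int K * y / L \<noteq> W / L" for y
  have good_ae: "AE y in lborel. good y"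
  proof (rule AE_I')
    have "{y. \<not> good y} \<subseteq> {- Im v0 * L / of_int K, (W / L - Im v0) * L / of_int K}"
      using L K by (auto simp: good_def field_simps)
    then have "finite {y. \<not> good y}" by (rule finite_subset) auto
    then show "{y. \<not> good y} \<in> null_sets lborel" by (rule finite_imp_null_set_lborel)
  qed auto
  have slice: "set_integrable lborel {0..<L} (\<lambda>x. f (Complex x y))" "(LINT x:{0..<L}|lborel. f (Complex x y)) = m y"
    if y: "y \<in> {0..<W}" and g: "good y" for y
  proof -
    let ?w = "v0 + of_int K * (\<i> * of_real y) / of_real L"
    have w: "Im ?w = Im v0 + of_int K * y / L" by simp
    have r: "- Im \<tau> < Im ?w" "Im ?w < 2 * Im \<tau>" "Im ?w \<noteq> 0" "Im ?w \<noteq> Im \<tau>"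
      using range[of y] y g unfolding w Im\<tau> good_def by auto
    have eq: "?A (Complex x y) = ?w + of_int K * of_real x / of_real L" for x
      by (simp add: Complex_eq algebra_simps add_divide_distrib)
    have nz: "theta1 (?w + of_int K * of_real x / of_real L) \<tau> \<noteq> 0" for x
    proof
      assume "theta1 (?w + of_int K * of_real x / of_real L) \<tau> = 0"
      then obtain j :: int where j: "Im ?w = of_int j * Im \<tau>" using theta1_eq_0D[OF \<tau>0] by force
      have "- 1 * Im \<tau> < of_int j * Im \<tau>" "of_int j * Im \<tau> < 2 * Im \<tau>" using r(1,2) unfolding j by auto
      then have "- 1 < real_of_int j" "real_of_int j < 2" using \<tau>0 by (auto simp only: mult_less_cancel_right_pos)
      then have "j = 0 \<or> j = 1" by linarith
      then show False using r(3,4) j by auto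
    qed
    have cont: "continuous_on {0..L} (\<lambda>x. f (Complex x y))"
      unfolding f_def eq by (intro continuous_intros \<tau>0) (use L nz in auto)
    have int: "((\<lambda>x. f (Complex x y)) has_integral m y) {0..L}"
      using has_integral_ln_theta1[OF \<tau>0 r K L] unfolding f_def eq m_def w Im\<tau> .
    show "set_integrable lborel {0..<L} (\<lambda>x. f (Complex x y))" "(LINT x:{0..<L}|lborel. f (Complex x y)) = m y"
      by (rule has_integral_Ico[OF cont int])+
  qed
  \<comment> \<open>Nonnegativity of the profile is what bounds the means over lines from
    below.\<close>
  have "0 \<le> theta1_profile t u" for t u
    unfolding theta1_profile_def by (rule mult_nonneg_nonneg) (auto simp: max_def)
  then have m_ge: "m y \<ge> L * theta1_mean \<tau>" for y
    unfolding m_def using L by (intro mult_left_mono) auto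
  have "set_integrable lborel (Lambda L W) (\<lambda>z. M - f z)"
    unfolding set_integrable_def
  proof (rule integrableI_nonneg)
    show "AE z in lborel. 0 \<le> indicator (Lambda L W) z *\<^sub>R (M - f z)"
      using fM by (auto simp: indicator_def)
    have "(\<integral>\<^sup>+z. ennreal (indicator (Lambda L W) z *\<^sub>R (M - f z)) \<partial>lborel) = (\<integral>\<^sup>+z\<in>Lambda L W. ennreal (M - f z) \<partial>lborel)"
      by (intro nn_integral_cong) (auto simp: indicator_def)
    also have "\<dots> = (\<integral>\<^sup>+y\<in>{0..<W}. (\<integral>\<^sup>+x\<in>{0..<L}. ennreal (M - f (Complex x y)) \<partial>lborel) \<partial>lborel)"
      by (rule nn_integral_Lambda) measurable
    also have "\<dots> \<le> (\<integral>\<^sup>+y\<in>{0..<W}. ennreal (L * M - L * theta1_mean \<tau>) \<partial>lborel)"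
    proof (rule nn_integral_mono_AE, use good_ae in eventually_elim)
      case (elim y)
      show ?case
      proof (cases "y \<in> {0..<W}")
        case True
        have cM: "set_integrable lborel {0..<L} (\<lambda>_. M)" "(LINT x:{0..<L}|lborel. M) = L * M"
          using has_integral_Ico[of 0 L "\<lambda>_. M" "L * M"] has_integral_const_real[of M 0 L] L by auto
        note i = set_integral_diff(1)[OF cM(1) slice(1)[OF True elim]]
        have "(\<integral>\<^sup>+x\<in>{0..<L}. ennreal (M - f (Complex x y)) \<partial>lborel) = (\<integral>\<^sup>+x. ennreal (indicator {0..<L} x *\<^sub>R (M - f (Complex x y))) \<partial>lborel)"
          by (intro nn_integral_cong) (auto simp: indicator_def)
        also have "\<dots> = ennreal (LINT x:{0..<L}|lborel. M - f (Complex x y))"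
          unfolding set_lebesgue_integral_def
          by (rule nn_integral_eq_integral)
             (use i True fM in \<open>auto simp: set_integrable_def indicator_def Lambda_def\<close>)
        also have "(LINT x:{0..<L}|lborel. M - f (Complex x y)) = L * M - m y"
          by (simp only: set_integral_diff(2)[OF cM(1) slice(1)[OF True elim]] cM(2) slice(2)[OF True elim])
        finally show ?thesis using m_ge[of y] True by (simp add: ennreal_leI)
      qed simp
    qed
    also have "\<dots> = ennreal (L * M - L * theta1_mean \<tau>) * ennreal W"
      using W by (simp add: nn_integral_cmult_indicator)
    also have "\<dots> < \<infinity>" by (simp add: ennreal_mult_less_top)
    finally show "(\<integral>\<^sup>+z. ennreal (indicator (Lambda L W) z *\<^sub>R (M - f z)) \<partial>lborel) < \<infinity>" .
  qed measurable
  moreover have "set_integrable lborel (Lambda L W) (\<lambda>_. M)"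
    unfolding set_integrable_def by (intro integrable_scaleR_left integrable_real_indicator) (simp_all add: emeasure_Lambda[OF L W])
  ultimately have "set_integrable lborel (Lambda L W) (\<lambda>z. M - (M - f z))" by (rule set_integral_diff(1)[rotated])
  then have i: "set_integrable lborel (Lambda L W) f" by simp
  then show "set_integrable lborel (Lambda L W) (\<lambda>z. ln (cmod (theta1 (v0 + of_int K * z / of_real L) \<tau>)))"
    unfolding f_def .
  have "(LINT z:Lambda L W|lborel. f z) = (LINT y:{0..<W}|lborel. LINT x:{0..<L}|lborel. f (Complex x y))"
    by (rule set_integral_Lambda[OF i])
  also have "\<dots> = (LINT y:{0..<W}|lborel. m y)"
    unfolding set_lebesgue_integral_def
  proof (rule integral_cong_AE)
    show "AE y in lborel. indicator {0..<W} y *\<^sub>R (LINT x|lborel. indicator {0..<L} x *\<^sub>R f (Complex x y)) = indicator {0..<W} y *\<^sub>R m y"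
      using good_ae by eventually_elim (use slice(2) in \<open>auto simp: indicator_def set_lebesgue_integral_def\<close>)
  qed measurable
  finally show "(LINT z:Lambda L W|lborel. ln (cmod (theta1 (v0 + of_int K * z / of_real L) \<tau>)))
      = (LINT y:{0..<W}|lborel. L * (theta1_mean \<tau> + theta1_profile (W / L) (Im v0 + of_int K * y / L)))"
    unfolding f_def m_def .
qed

lemma has_integral_pos_part:
  fixes a b c :: real
  assumes "a \<le> c" "c \<le> b"
  shows "((\<lambda>s. max 0 (s - c)) has_integral (b - c)\<^sup>2 / 2) {a..b}"
proof -
  have "((\<lambda>s. max 0 (s - c)) has_integral 0) {a..c}"
    by (rule has_integral_is_0) auto
  moreover have "((\<lambda>s. s - c) has_integral ((b - c)\<^sup>2 / 2 - (c - c)\<^sup>2 / 2)) {c..b}"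
    by (rule fundamental_theorem_of_calculus)
       (use assms in \<open>auto intro!: derivative_eq_intros simp flip: has_real_derivative_iff_has_vector_derivative\<close>)
  then have "((\<lambda>s. s - c) has_integral (b - c)\<^sup>2 / 2) {c..b}" by simp
  then have "((\<lambda>s. max 0 (s - c)) has_integral (b - c)\<^sup>2 / 2) {c..b}"
    by (rule has_integral_eq[rotated]) (auto simp: max_def)
  ultimately show ?thesis using has_integral_combine[OF assms] by fastforce
qed

text \<open>The integrand has its kink at s = y for differences and at s = W - y for sums. The
  quadratic terms agree and become the Gaussian, the linear terms are opposite.\<close>

lemma
  fixes L W y :: real
  assumes L: "0 < L" and W: "0 < W" and y: "0 \<le> y" "y < W"
  shows profile_integral_minus: "(LINT s:{0..<W}|lborel. L * (C + theta1_profile (W / L) (y / L + of_int (- 1) * s / L)))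
         = L * W * C + pi * W\<^sup>2 / 2 + pi * (y\<^sup>2 - W * y)"
    and profile_integral_plus: "(LINT s:{0..<W}|lborel. L * (C + theta1_profile (W / L) (y / L + of_int 1 * s / L)))
         = L * W * C + pi * W\<^sup>2 / 2 + pi * (y\<^sup>2 + W * y)"
proof -
  have id: "((\<lambda>s. s) has_integral (W\<^sup>2 / 2)) {0..W}"
    using ident_has_integral[of 0 W] W by simp
  have c: "((\<lambda>s. k) has_integral W * k) {0..W}" for k :: real
    using has_integral_const_real[of k 0 W] W by simp
  have m: "L * (C + theta1_profile (W / L) (y / L + of_int (- 1) * s / L))
       = (L * C + pi * y) - pi * s + 2 * pi * max 0 (s - y)" if "s \<in> {0..W}" for s
  proof -
    have 1: "max 0 (- (y / L + of_int (- 1) * s / L)) = max 0 (s - y) / L"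
      using L by (simp add: max_def field_simps)
    have "y / L + of_int (- 1) * s / L - W / L = (y - s - W) / L" using L by (simp add: field_simps)
    moreover have "(y - s - W) / L \<le> 0" using L y that by (intro divide_nonpos_pos) auto
    ultimately have 2: "max 0 (y / L + of_int (- 1) * s / L - W / L) = 0" by simp
    show ?thesis unfolding theta1_profile_def 1 2 using L by (simp add: field_simps)
  qed
  have "((\<lambda>s. (L * C + pi * y) - pi * s + 2 * pi * max 0 (s - y)) has_integral
      W * (L * C + pi * y) - pi * (W\<^sup>2 / 2) + 2 * pi * ((W - y)\<^sup>2 / 2)) {0..W}"
    using y by (intro has_integral_add has_integral_diff has_integral_mult_right id c has_integral_pos_part) auto
  then have m_int: "((\<lambda>s. L * (C + theta1_profile (W / L) (y / L + of_int (- 1) * s / L))) has_integral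
      W * (L * C + pi * y) - pi * (W\<^sup>2 / 2) + 2 * pi * ((W - y)\<^sup>2 / 2)) {0..W}"
    by (rule has_integral_eq[rotated]) (use m in simp)
  have m_cont: "continuous_on {0..W} (\<lambda>s. L * (C + theta1_profile (W / L) (y / L + of_int (- 1) * s / L)))"
    unfolding theta1_profile_def using L by (intro continuous_intros) auto
  show "(LINT s:{0..<W}|lborel. L * (C + theta1_profile (W / L) (y / L + of_int (- 1) * s / L)))
         = L * W * C + pi * W\<^sup>2 / 2 + pi * (y\<^sup>2 - W * y)"
    by (subst has_integral_Ico(2)[OF m_cont m_int]) (simp add: power2_eq_square field_simps)
  have p: "L * (C + theta1_profile (W / L) (y / L + of_int 1 * s / L))
       = (L * C + pi * y) + pi * s + 2 * pi * max 0 (s - (W - y))" if "s \<in> {0..W}" for s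
  proof -
    have "y / L + of_int 1 * s / L - W / L = (s - (W - y)) / L" by (simp add: diff_divide_distrib add_divide_distrib)
    moreover have "max 0 (x / L) = max 0 x / L" for x using L by (simp add: max_def divide_le_0_iff zero_le_divide_iff)
    ultimately have 1: "max 0 (y / L + of_int 1 * s / L - W / L) = max 0 (s - (W - y)) / L" by simp
    have "- (y / L + of_int 1 * s / L) = - ((y + s) / L)" using L by (simp add: field_simps)
    moreover have "0 \<le> (y + s) / L" using L y that by auto
    ultimately have 2: "max 0 (- (y / L + of_int 1 * s / L)) = 0" by simp
    show ?thesis unfolding theta1_profile_def 1 2 using L by (simp add: field_simps)
  qed
  have "((\<lambda>s. (L * C + pi * y) + pi * s + 2 * pi * max 0 (s - (W - y))) has_integral
      W * (L * C + pi * y) + pi * (W\<^sup>2 / 2) + 2 * pi * ((W - (W - y))\<^sup>2 / 2)) {0..W}"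
    using y by (intro has_integral_add has_integral_diff has_integral_mult_right id c has_integral_pos_part) auto
  then have p_int: "((\<lambda>s. L * (C + theta1_profile (W / L) (y / L + of_int 1 * s / L))) has_integral
      W * (L * C + pi * y) + pi * (W\<^sup>2 / 2) + 2 * pi * ((W - (W - y))\<^sup>2 / 2)) {0..W}"
    by (rule has_integral_eq[rotated]) (use p in simp)
  have p_cont: "continuous_on {0..W} (\<lambda>s. L * (C + theta1_profile (W / L) (y / L + of_int 1 * s / L)))"
    unfolding theta1_profile_def using L by (intro continuous_intros) auto
  show "(LINT s:{0..<W}|lborel. L * (C + theta1_profile (W / L) (y / L + of_int 1 * s / L)))
         = L * W * C + pi * W\<^sup>2 / 2 + pi * (y\<^sup>2 + W * y)"
    by (subst has_integral_Ico(2)[OF p_cont p_int]) (simp add: power2_eq_square field_simps)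
qed

subsection \<open>Background potentials and pair products\<close>

lemma V_bg_minus:
  assumes L: "0 < L" and W: "0 < W" and \<tau>: "\<tau> = \<i> * of_real (W / L)"
  shows "\<exists>k. \<forall>z\<in>Lambda L W. V_bg (Phi_minus L \<tau>) L W Nm z = k + pi * real Nm / (L * W) * ((Im z)\<^sup>2 - W * Im z)"
proof -
  define \<kappa> where "\<kappa> = 3 * ln (cmod (eta \<tau>)) + ln (2 * pi / L)"
  let ?C = "theta1_mean \<tau>"
  have const: "set_integrable lborel (Lambda L W) (\<lambda>_. \<kappa>)" "(LINT w:Lambda L W|lborel. \<kappa>) = L * W * \<kappa>"
    unfolding set_integrable_def set_lebesgue_integral_def
    using L W by (auto simp: emeasure_Lambda[OF L W] measure_def intro!: integrable_scaleR_left integrable_real_indicator)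
  have "V_bg (Phi_minus L \<tau>) L W Nm z = real Nm / (L * W) * (L * W * ?C + pi * W\<^sup>2 / 2 - L * W * \<kappa>)
          + pi * real Nm / (L * W) * ((Im z)\<^sup>2 - W * Im z)" if z: "z \<in> Lambda L W" for z
  proof -
    have y: "0 \<le> Im z" "Im z < W" using z by (auto simp: Lambda_def)
    have range: "- (W / L) < Im (z / of_real L) + of_int (- 1) * y / L \<and> Im (z / of_real L) + of_int (- 1) * y / L < 2 * (W / L)"
      if "0 \<le> y" "y < W" for y
    proof -
      have "(- W) / L < (Im z - y) / L" "(Im z - y) / L < (2 * W) / L"
        using that y W L by (intro divide_strict_right_mono; linarith)+
      then show ?thesis by (simp add: diff_divide_distrib)
    qed
    have e: "(z - w) / of_real L = z / of_real L + of_int (- 1) * w / of_real L" for w by (simp add: diff_divide_distrib)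
    have I: "set_integrable lborel (Lambda L W) (\<lambda>w. ln (cmod (theta1 ((z - w) / of_real L) \<tau>)))"
      unfolding e by (rule set_integrable_ln_theta1[OF L W \<tau> _ range]) simp_all
    have "(LINT w:Lambda L W|lborel. ln (cmod (theta1 ((z - w) / of_real L) \<tau>)))
        = (LINT s:{0..<W}|lborel. L * (?C + theta1_profile (W / L) (Im z / L + of_int (- 1) * s / L)))"
      unfolding e by (subst set_integral_ln_theta1[OF L W \<tau> _ range]) simp_all
    also have "\<dots> = L * W * ?C + pi * W\<^sup>2 / 2 + pi * ((Im z)\<^sup>2 - W * Im z)"
      by (rule profile_integral_minus[OF L W y])
    finally have J: "(LINT w:Lambda L W|lborel. ln (cmod (theta1 ((z - w) / of_real L) \<tau>))) = \<dots>" .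
    have "Phi_minus L \<tau> z w = \<kappa> - ln (cmod (theta1 ((z - w) / of_real L) \<tau>))" for w
      by (simp add: Phi_minus_def \<kappa>_def)
    then have "(LINT w:Lambda L W|lborel. Phi_minus L \<tau> z w) = (LINT w:Lambda L W|lborel. \<kappa> - ln (cmod (theta1 ((z - w) / of_real L) \<tau>)))"
      by (simp only:)
    also have "\<dots> = L * W * \<kappa> - (L * W * ?C + pi * W\<^sup>2 / 2 + pi * ((Im z)\<^sup>2 - W * Im z))"
      using set_integral_diff(2)[OF const(1) I] by (simp only: const(2) J)
    finally have X: "(LINT w:Lambda L W|lborel. Phi_minus L \<tau> z w) = \<dots>" .
    show ?thesis unfolding V_bg_def X using L W by (simp add: field_simps power2_eq_square)
  qed
  then show ?thesis by blast
qed

text \<open>The linear terms of the difference and the sum cancel and the quadratic ones double. Of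
  the half logarithms, the one in the integration variable gives a constant, the other survives with
  the factor -Nm / 2.\<close>

lemma V_bg_pm:
  assumes L: "0 < L" and W: "0 < W" and \<tau>: "\<tau> = \<i> * of_real (W / L)"
  shows "\<exists>k. \<forall>z\<in>Lambda L W. V_bg (Phi_pm L \<tau>) L W Nm z
           = k + 2 * pi * real Nm / (L * W) * (Im z)\<^sup>2 - real Nm / 2 * ln (cmod (theta1 (2 * z / of_real L) \<tau>))"
proof -
  define \<kappa> where "\<kappa> = 3 * ln (cmod (eta \<tau>)) + ln (2 * pi / L)"
  define l where "l z = ln (cmod (theta1 (2 * z / of_real L) \<tau>))" for z
  define I2 where "I2 = (LINT w:Lambda L W|lborel. l w)"
  let ?C = "theta1_mean \<tau>"
  have const: "set_integrable lborel (Lambda L W) (\<lambda>_. k)" "(LINT w:Lambda L W|lborel. k) = L * W * k" for k :: real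
    unfolding set_integrable_def set_lebesgue_integral_def
    using L W by (auto simp: emeasure_Lambda[OF L W] measure_def intro!: integrable_scaleR_left integrable_real_indicator)
  have l: "set_integrable lborel (Lambda L W) l"
  proof -
    have range: "- (W / L) < Im 0 + of_int 2 * y / L \<and> Im 0 + of_int 2 * y / L < 2 * (W / L)" if "0 \<le> y" "y < W" for y
    proof -
      have "0 \<le> 2 * y / L" "0 < W / L" "2 * y / L < 2 * W / L" using that L W by (auto intro: divide_strict_right_mono)
      then show ?thesis by (simp only: zero_complex.sel of_int_numeral add_0 times_divide_eq_right simp_thms)
    qed
    show ?thesis unfolding l_def
      using set_integrable_ln_theta1[OF L W \<tau> _ range] by simp
  qed
  have "V_bg (Phi_pm L \<tau>) L W Nm z = real Nm / (L * W) * (2 * L * W * ?C + pi * W\<^sup>2 - L * W * \<kappa> - I2 / 2)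
          + 2 * pi * real Nm / (L * W) * (Im z)\<^sup>2 - real Nm / 2 * l z" if z: "z \<in> Lambda L W" for z
  proof -
    have y: "0 \<le> Im z" "Im z < W" using z by (auto simp: Lambda_def)
    have range: "- (W / L) < Im (z / of_real L) + of_int (- 1) * y / L \<and> Im (z / of_real L) + of_int (- 1) * y / L < 2 * (W / L)"
      if "0 \<le> y" "y < W" for y
    proof -
      have "(- W) / L < (Im z - y) / L" "(Im z - y) / L < (2 * W) / L"
        using that y W L by (intro divide_strict_right_mono; linarith)+
      then show ?thesis by (simp add: diff_divide_distrib)
    qed
    have range': "- (W / L) < Im (z / of_real L) + of_int 1 * y / L \<and> Im (z / of_real L) + of_int 1 * y / L < 2 * (W / L)"
      if "0 \<le> y" "y < W" for y
    proof -
      have "(- W) / L < (Im z + y) / L" "(Im z + y) / L < (2 * W) / L"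
        using that y W L by (intro divide_strict_right_mono; linarith)+
      then show ?thesis by (simp add: add_divide_distrib)
    qed
    have e: "(z - w) / of_real L = z / of_real L + of_int (- 1) * w / of_real L"
      "(z + w) / of_real L = z / of_real L + of_int 1 * w / of_real L" for w
      by (simp_all add: diff_divide_distrib add_divide_distrib)
    have I: "set_integrable lborel (Lambda L W) (\<lambda>w. ln (cmod (theta1 ((z - w) / of_real L) \<tau>)))"
      unfolding e by (rule set_integrable_ln_theta1[OF L W \<tau> _ range]) simp_all
    have I': "set_integrable lborel (Lambda L W) (\<lambda>w. ln (cmod (theta1 ((z + w) / of_real L) \<tau>)))"
      unfolding e by (rule set_integrable_ln_theta1[OF L W \<tau> _ range']) simp_all
    have J: "(LINT w:Lambda L W|lborel. ln (cmod (theta1 ((z - w) / of_real L) \<tau>))) = L * W * ?C + pi * W\<^sup>2 / 2 + pi * ((Im z)\<^sup>2 - W * Im z)"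
      unfolding e profile_integral_minus[OF L W y, symmetric]
      by (subst set_integral_ln_theta1[OF L W \<tau> _ range]) simp_all
    have J': "(LINT w:Lambda L W|lborel. ln (cmod (theta1 ((z + w) / of_real L) \<tau>))) = L * W * ?C + pi * W\<^sup>2 / 2 + pi * ((Im z)\<^sup>2 + W * Im z)"
      unfolding e profile_integral_plus[OF L W y, symmetric]
      by (subst set_integral_ln_theta1[OF L W \<tau> _ range']) simp_all
    have "(LINT w:Lambda L W|lborel. Phi_pm L \<tau> z w) = (LINT w:Lambda L W|lborel. ((\<kappa> + l z / 2) + 1 / 2 * l w)
         - ln (cmod (theta1 ((z + w) / of_real L) \<tau>)) - ln (cmod (theta1 ((z - w) / of_real L) \<tau>)))"
      unfolding Phi_pm_def \<kappa>_def l_def by (rule arg_cong[where f = "set_lebesgue_integral _ _"]) (simp add: fun_eq_iff)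
    also have "\<dots> = (L * W * (\<kappa> + l z / 2) + 1 / 2 * I2) - (L * W * ?C + pi * W\<^sup>2 / 2 + pi * ((Im z)\<^sup>2 + W * Im z))
         - (L * W * ?C + pi * W\<^sup>2 / 2 + pi * ((Im z)\<^sup>2 - W * Im z))"
      using const(1) l I I'
      by (simp only: set_integral_diff set_integral_add set_integrable_mult_right set_integral_mult_right const(2) J J' I2_def)
    finally have X: "(LINT w:Lambda L W|lborel. Phi_pm L \<tau> z w) = \<dots>" .
    show ?thesis unfolding V_bg_def X using L W by (simp add: field_simps power2_eq_square)
  qed
  then show ?thesis unfolding l_def by blast
qed

text \<open>The zeros of theta_1 lie on countably many horizontal lines, and each line is a null
  set.\<close>

lemma AE_theta1_nonzero:
  assumes L: "0 < L" and W: "0 < W" and \<tau>: "\<tau> = \<i> * of_real (W / L)" and K: "K \<noteq> 0"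
  shows "AE b in lborel. theta1 ((a + of_real K * b) / of_real L) \<tau> \<noteq> 0"
proof -
  have null: "AE b in lborel. Im b \<noteq> r" for r
  proof (rule AE_I)
    have "emeasure lborel {b. Im b = r} = emeasure (lborel \<Otimes>\<^sub>M lborel) ((\<lambda>(x, y). Complex x y) -` {b. Im b = r} \<inter> space (lborel \<Otimes>\<^sub>M lborel))"
      by (subst lborel_complex, subst emeasure_distr) (auto simp: case_prod_unfold)
    also have "(\<lambda>(x, y). Complex x y) -` {b. Im b = r} \<inter> space (lborel \<Otimes>\<^sub>M lborel) = UNIV \<times> {r}"
      by (auto simp: space_pair_measure)
    also have "emeasure (lborel \<Otimes>\<^sub>M lborel) (UNIV \<times> {r}) = 0"
      by (subst lborel.emeasure_pair_measure_Times) auto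
    finally show "emeasure lborel {b. Im b = r} = 0" .
    show "{b. Im b = r} \<in> sets lborel" by simp
  qed auto
  have "AE b in lborel. \<forall>k::int. Im b \<noteq> (of_int k * W - Im a) / K"
    by (subst AE_all_countable) (use null in simp)
  then show ?thesis
  proof eventually_elim
    case (elim b)
    show ?case
    proof
      assume "theta1 ((a + of_real K * b) / of_real L) \<tau> = 0"
      moreover have "Im \<tau> > 0" using L W by (simp add: \<tau>)
      ultimately obtain k :: int where "Im ((a + of_real K * b) / of_real L) = of_int k * Im \<tau>"
        using theta1_eq_0D by blast
      then have "Im a + K * Im b = of_int k * W" using L by (simp add: \<tau> field_simps)
      then have "Im b = (of_int k * W - Im a) / K" using K by (simp add: field_simps)
      then show False using elim by blast
    qed
  qed
qed

text \<open>The product of the factors g is symmetric in the points, so F times it is still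
  antisymmetric and in each slot spanned by the functions \<open>\<phi>\<close>; hence it is a
  multiple of their determinant. The point \<open>z0\<close> makes this multiple nonzero.\<close>

lemma plasma_determinantal:
  fixes b :: "nat \<Rightarrow> complex \<Rightarrow> complex" and g :: "complex \<Rightarrow> real" and F :: "(nat \<Rightarrow> complex) \<Rightarrow> complex"
  defines "\<phi> \<equiv> \<lambda>m z. complex_of_real (g z) * b m z"
  assumes int: "\<And>j k. j < N \<Longrightarrow> k < N \<Longrightarrow> set_integrable lborel S (\<lambda>z. \<phi> j z * cnj (\<phi> k z))"
    and orth: "\<And>j k. j < N \<Longrightarrow> k < N \<Longrightarrow>
                 (LINT z:S|lborel. \<phi> j z * cnj (\<phi> k z)) = (if j = k then 1 else 0)"
    and S: "S \<in> sets borel"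
    and \<phi>: "\<And>j. j < N \<Longrightarrow> \<phi> j \<in> borel_measurable borel"
    and g: "\<And>z. g z > 0"
    and span: "\<And>z i. i < N \<Longrightarrow> \<exists>c. \<forall>w. F (z(i := w)) = (\<Sum>m<N. c m * b m w)"
    and anti: "\<And>z i j. i < N \<Longrightarrow> j < N \<Longrightarrow> i \<noteq> j \<Longrightarrow> F (z \<circ> Transposition.transpose i j) = - F z"
    and loc: "\<And>z z'. (\<And>i. i < N \<Longrightarrow> z i = z' i) \<Longrightarrow> F z = F z'"
    and nz: "F z0 \<noteq> 0"
    and w_meas: "\<And>(M :: (nat \<Rightarrow> complex) measure) g. (\<And>i. i < N \<Longrightarrow> (\<lambda>\<omega>. g \<omega> i) \<in> borel_measurable M) \<Longrightarrow>
        (\<lambda>\<omega>. (\<Prod>i<N. indicator S (g \<omega> i)) * w (g \<omega>)) \<in> borel_measurable M"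
    and P: "Measurable.pred (borel \<Otimes>\<^sub>M borel) (\<lambda>(a, b). P a b)" and P_ae: "\<And>a. AE b in lborel. P a b"
    and R: "Measurable.pred borel R" and R_ae: "AE b in lborel. R b"
    and w: "\<And>z. (\<And>i. i < N \<Longrightarrow> z i \<in> S \<and> R (z i)) \<Longrightarrow> (\<And>j k. j < k \<Longrightarrow> k < N \<Longrightarrow> P (z j) (z k)) \<Longrightarrow>
        w z = C * ((\<Prod>i<N. g (z i)) * cmod (F z))\<^sup>2"
    and C: "C > 0"
    and K: "\<And>x y. K x y = (\<Sum>m<N. \<phi> m x * cnj (\<phi> m y))"
  shows "determinantal S N w K"
proof -
  obtain p where p: "detn N (\<lambda>i m. \<phi> m (p i)) \<noteq> 0"
    using ex_detn_nonzero[OF int orth] by blast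
  define F' where "F' z = complex_of_real (\<Prod>i<N. g (z i)) * F z" for z
  have "\<exists>C'. \<forall>z. F' z = C' * detn N (\<lambda>i m. \<phi> m (z i))"
  proof (rule antisym_multispan_conv_detn[where \<phi> = \<phi> and p = p, OF p])
    fix z i assume i: "i < N"
    obtain c where c: "\<And>w. F (z(i := w)) = (\<Sum>m<N. c m * b m w)" using span[OF i] by blast
    define a where "a = (\<Prod>j\<in>{..<N} - {i}. g (z j))"
    have "(\<Prod>j<N. g ((z(i := w)) j)) = g w * a" for w
      using i unfolding a_def by (subst prod.remove[of _ i]) auto
    then have "F' (z(i := w)) = (\<Sum>m<N. (of_real a * c m) * \<phi> m w)" for w
      unfolding F'_def c \<phi>_def by (simp add: sum_distrib_left mult_ac)
    then show "\<exists>c. \<forall>w. F' (z(i := w)) = (\<Sum>m<N. c m * \<phi> m w)" by (intro exI[of _ "\<lambda>m. of_real a * c m"]) simp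
  next
    fix z i j assume ij: "i < N" "j < N" "i \<noteq> j"
    have t: "Transposition.transpose i j permutes {..<N}" using ij by (simp add: permutes_swap_id)
    have "(\<Prod>k<N. g ((z \<circ> Transposition.transpose i j) k)) = (\<Prod>k<N. g (z k))"
      by (subst prod.permute[OF t, of "\<lambda>k. g (z k)"]) (simp add: o_def)
    then show "F' (z \<circ> Transposition.transpose i j) = - F' z"
      by (simp only: F'_def anti[OF ij] mult_minus_right)
  next
    fix z z' :: "nat \<Rightarrow> complex" assume "\<And>i. i < N \<Longrightarrow> z i = z' i"
    then show "F' z = F' z'" using loc[of z z'] by (simp add: F'_def)
  qed
  then obtain C' where C': "\<And>z. F' z = C' * detn N (\<lambda>i m. \<phi> m (z i))" by blast
  have "(\<Prod>i<N. g (z0 i)) > 0" using g by (intro prod_pos) auto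
  then have "(\<Prod>i<N. g (z0 i)) \<noteq> 0" by linarith
  then have "F' z0 \<noteq> 0" using nz unfolding F'_def by (simp only: mult_eq_0_iff of_real_eq_0_iff simp_thms)
  then have "C' \<noteq> 0" using C'[of z0] by auto
  show ?thesis
  proof (rule determinantalI[OF int orth S \<phi> w_meas P P_ae R R_ae _ _ K])
    show "C * (cmod C')\<^sup>2 \<noteq> 0" using C \<open>C' \<noteq> 0\<close> by simp
    fix z assume "\<And>i. i < N \<Longrightarrow> z i \<in> S \<and> R (z i)" "\<And>j k. j < k \<Longrightarrow> k < N \<Longrightarrow> P (z j) (z k)"
    then have "w z = C * ((\<Prod>i<N. g (z i)) * cmod (F z))\<^sup>2" by (rule w)
    also have "(\<Prod>i<N. g (z i)) * cmod (F z) = cmod (F' z)"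
    proof -
      have "(\<Prod>i<N. g (z i)) \<ge> 0" using g by (intro prod_nonneg) (auto intro: less_imp_le)
      then show ?thesis by (simp only: F'_def norm_mult norm_of_real abs_of_nonneg)
    qed
    also have "cmod (F' z) = cmod C' * cmod (detn N (\<lambda>i m. \<phi> m (z i)))" by (simp add: C' norm_mult)
    finally show "w z = C * (cmod C')\<^sup>2 * (cmod (detn N (\<lambda>i m. \<phi> m (z i))))\<^sup>2"
      by (simp add: power_mult_distrib)
  qed
qed

text \<open>\<open>V_bg\<close> is itself an integral. It is replaced by its closed form v, which is
  valid on \<open>Lambda\<close> only; outside, the indicators annihilate the weight.\<close>

lemma Q_plasma_measurable:
  assumes \<Phi>: "(\<lambda>(a, b). \<Phi> a b) \<in> borel_measurable (borel \<Otimes>\<^sub>M borel)"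
    and V: "\<And>z. z \<in> Lambda L W \<Longrightarrow> V_bg \<Phi> L W Nm z = v z" and v: "v \<in> borel_measurable borel"
    and g: "\<And>i. i < N \<Longrightarrow> (\<lambda>\<omega>. g \<omega> i) \<in> borel_measurable M"
    and h: "(\<lambda>\<omega>. h (g \<omega>)) \<in> borel_measurable M"
  shows "(\<lambda>\<omega>. (\<Prod>i<N. indicator (Lambda L W) (g \<omega> i)) * (h (g \<omega>) * Q_plasma \<Phi> L W N Nm \<beta> (g \<omega>)) :: real) \<in> borel_measurable M"
proof -
  have eq: "(\<Prod>i<N. indicator (Lambda L W) (g \<omega> i)) * (h (g \<omega>) * Q_plasma \<Phi> L W N Nm \<beta> (g \<omega>)) =
     (\<Prod>i<N. indicator (Lambda L W) (g \<omega> i)) * (h (g \<omega>) * exp (- \<beta> * (E_pp \<Phi> N (g \<omega>) + (\<Sum>j<N. v (g \<omega> j)) + E_bb \<Phi> L W Nm)) :: real)" for \<omega>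
  proof (cases "\<forall>i<N. g \<omega> i \<in> Lambda L W")
    case True
    then have "E_pb \<Phi> L W N Nm (g \<omega>) = (\<Sum>j<N. v (g \<omega> j))" by (simp add: E_pb_def V)
    then show ?thesis by (simp add: Q_plasma_def)
  next
    case False
    then have "(\<Prod>i<N. indicator (Lambda L W) (g \<omega> i) :: real) = 0" by (force simp: indicator_def)
    then show ?thesis by simp
  qed
  have [measurable]: "(\<lambda>\<omega>. E_pp \<Phi> N (g \<omega>)) \<in> borel_measurable M"
    unfolding E_pp_def
  proof (intro borel_measurable_sum)
    fix k j assume "k \<in> {..<N}" "j \<in> {..<k}"
    then have "(\<lambda>\<omega>. (g \<omega> k, g \<omega> j)) \<in> M \<rightarrow>\<^sub>M borel \<Otimes>\<^sub>M borel" using g by (intro measurable_Pair) auto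
    from measurable_compose[OF this \<Phi>] show "(\<lambda>\<omega>. \<Phi> (g \<omega> k) (g \<omega> j)) \<in> borel_measurable M" by simp
  qed
  have [measurable]: "(\<lambda>\<omega>. \<Sum>j<N. v (g \<omega> j)) \<in> borel_measurable M"
    by (intro borel_measurable_sum measurable_compose[OF g v]) auto
  have [measurable]: "(\<lambda>\<omega>. \<Prod>i<N. indicator (Lambda L W) (g \<omega> i) :: real) \<in> borel_measurable M"
  proof (intro borel_measurable_prod)
    fix i assume "i \<in> {..<N}"
    then show "(\<lambda>\<omega>. indicator (Lambda L W) (g \<omega> i) :: real) \<in> borel_measurable M"
      using measurable_compose[OF g, of i "indicator (Lambda L W)" borel] by simp
  qed
  note [measurable] = h
  show ?thesis unfolding eq by measurable
qed

section \<open>Antisymmetric products over pairs\<close>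

definition pair_prod :: "('a \<Rightarrow> 'a \<Rightarrow> complex) \<Rightarrow> nat \<Rightarrow> (nat \<Rightarrow> 'a) \<Rightarrow> complex" where
  "pair_prod a N z = (\<Prod>k<N. \<Prod>j<k. a (z k) (z j))"

text \<open>The factors that do not involve slot i are constant in w, and those with w in the second
  argument are turned round at the cost of a sign; all this goes into K.\<close>

lemma pair_prod_slot:
  assumes a: "\<And>x y. a x y = - a y x" and "i < N"
  shows "\<exists>K. \<forall>w. pair_prod a N (z(i := w)) = K * (\<Prod>j\<in>{..<N} - {i}. a w (z j))"
  using \<open>i < N\<close>
proof (induction N)
  case (Suc n)
  show ?case
  proof (cases "i = n")
    case True
    have "pair_prod a n (z(n := w)) = pair_prod a n z" for w
      unfolding pair_prod_def by (intro prod.cong) auto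
    moreover have "(\<Prod>j<n. a w ((z(n := w)) j)) = (\<Prod>j<n. a w (z j))" for w
      by (intro prod.cong) auto
    ultimately have "pair_prod a (Suc n) (z(n := w)) = pair_prod a n z * (\<Prod>j<n. a w (z j))" for w
      by (simp add: pair_prod_def)
    moreover have "{..<Suc n} - {n} = {..<n}" by auto
    ultimately have "\<forall>w. pair_prod a (Suc n) (z(i := w)) = pair_prod a n z * (\<Prod>j\<in>{..<Suc n} - {i}. a w (z j))"
      unfolding True by (simp only: simp_thms)
    then show ?thesis by (rule exI)
  next
    case False
    then have "i < n" using Suc by simp
    then obtain K where K: "\<And>w. pair_prod a n (z(i := w)) = K * (\<Prod>j\<in>{..<n} - {i}. a w (z j))"
      using Suc by blast
    have "(\<Prod>j<n. a (z n) ((z(i := w)) j)) = a (z n) w * (\<Prod>j\<in>{..<n} - {i}. a (z n) (z j))" for w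
      using \<open>i < n\<close> by (subst prod.remove[of _ i]) auto
    then have "pair_prod a (Suc n) (z(i := w)) = (K * - (\<Prod>j\<in>{..<n} - {i}. a (z n) (z j))) * (a w (z n) * (\<Prod>j\<in>{..<n} - {i}. a w (z j)))" for w
      using K[of w] \<open>i < n\<close> a[of "z n" w] by (simp add: pair_prod_def)
    moreover have "a w (z n) * (\<Prod>j\<in>{..<n} - {i}. a w (z j)) = (\<Prod>j\<in>{..<Suc n} - {i}. a w (z j))" for w
    proof -
      have "{..<Suc n} - {i} = insert n ({..<n} - {i})" using \<open>i < n\<close> by auto
      then show ?thesis by simp
    qed
    ultimately have "\<forall>w. pair_prod a (Suc n) (z(i := w)) = (K * - (\<Prod>j\<in>{..<n} - {i}. a (z n) (z j))) * (\<Prod>j\<in>{..<Suc n} - {i}. a w (z j))"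
      by (simp only: simp_thms)
    then show ?thesis by (rule exI)
  qed
qed simp

text \<open>Exchanging neighbours permutes the factors, with the exception of the factor of the two
  neighbours themselves, which changes sign.\<close>

lemma pair_prod_adjacent:
  assumes a: "\<And>x y. a x y = - a y x" and i: "Suc i < N"
  shows "pair_prod a N (z \<circ> Transposition.transpose i (Suc i)) = - pair_prod a N z"
proof -
  let ?t = "Transposition.transpose i (Suc i)"
  have row: "(\<Prod>j<k. a (z k) (z (?t j))) = (\<Prod>j<k. a (z k) (z j))" if "k \<noteq> i" "k \<noteq> Suc i" for k
  proof (cases "k < i")
    case True
    then show ?thesis by (intro prod.cong refl) (auto simp: Transposition.transpose_def)
  next
    case False
    then have "?t permutes {..<k}" using that by (intro permutes_swap_id) auto
    from prod.permute[OF this, of "\<lambda>j. a (z k) (z j)"] show ?thesis by (simp add: o_def)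
  qed
  have split: "pair_prod a N u = (\<Prod>j<i. a (u i) (u j)) * (a (u (Suc i)) (u i) * (\<Prod>j<i. a (u (Suc i)) (u j)))
      * (\<Prod>k\<in>{..<N} - {i} - {Suc i}. \<Prod>j<k. a (u k) (u j))" for u
    using i unfolding pair_prod_def by (subst prod.remove[of _ i], simp, simp, subst prod.remove[of _ "Suc i"]) (auto simp: mult_ac)
  have low: "(\<Prod>j<i. a x (z (?t j))) = (\<Prod>j<i. a x (z j))" for x
    by (intro prod.cong refl) (auto simp: Transposition.transpose_def)
  have rest: "(\<Prod>k\<in>{..<N} - {i} - {Suc i}. \<Prod>j<k. a (z (?t k)) (z (?t j))) = (\<Prod>k\<in>{..<N} - {i} - {Suc i}. \<Prod>j<k. a (z k) (z j))"
  proof (rule prod.cong[OF refl])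
    fix k assume "k \<in> {..<N} - {i} - {Suc i}"
    then show "(\<Prod>j<k. a (z (?t k)) (z (?t j))) = (\<Prod>j<k. a (z k) (z j))"
      using row[of k] by (simp add: Transposition.transpose_def[of i "Suc i" k])
  qed
  show ?thesis
    unfolding split o_def rest low using a[of "z i" "z (Suc i)"] by simp
qed

lemma pair_prod_antisym:
  fixes a :: "'a \<Rightarrow> 'a \<Rightarrow> complex" and z :: "nat \<Rightarrow> 'a"
  assumes a: "\<And>x y. a x y = - a y x" and ij: "i < N" "j < N" "i \<noteq> j"
  shows "pair_prod a N (z \<circ> Transposition.transpose i j) = - pair_prod a N z"
proof -
  have *: "pair_prod a N (z \<circ> Transposition.transpose i (Suc (i + d))) = - pair_prod a N z" if "Suc (i + d) < N" for i d and z :: "nat \<Rightarrow> 'a"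
    using that
  proof (induction d arbitrary: z)
    case 0
    show ?case unfolding add_0_right by (rule pair_prod_adjacent[OF a]) (use 0 in simp)
  next
    case (Suc d)
    let ?s = "Transposition.transpose (Suc (i + d)) (Suc (Suc (i + d)))" and ?t = "Transposition.transpose i (Suc (i + d))"
    \<comment> \<open>Conjugation by a transposition of neighbours shortens the distance by one, and
      the three signs multiply to a minus.\<close>
    have "Transposition.transpose i (Suc (i + Suc d)) = ?s \<circ> ?t \<circ> ?s"
      by (auto simp: fun_eq_iff Transposition.transpose_def)
    then have "pair_prod a N (z \<circ> Transposition.transpose i (Suc (i + Suc d))) = pair_prod a N (((z \<circ> ?s) \<circ> ?t) \<circ> ?s)"
      by (simp add: o_assoc)
    also have "\<dots> = - pair_prod a N ((z \<circ> ?s) \<circ> ?t)"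
      using Suc.prems by (intro pair_prod_adjacent a) simp
    also have "pair_prod a N ((z \<circ> ?s) \<circ> ?t) = - pair_prod a N (z \<circ> ?s)"
      by (rule Suc.IH) (use Suc.prems in simp)
    also have "- (- pair_prod a N (z \<circ> ?s)) = pair_prod a N (z \<circ> ?s)" by simp
    also have "\<dots> = - pair_prod a N z"
      using Suc.prems by (intro pair_prod_adjacent a) simp
    finally show ?case .
  qed
  show ?thesis
  proof (cases "i < j")
    case True
    then obtain d where "j = Suc (i + d)" using less_imp_Suc_add by blast
    then show ?thesis using * ij by blast
  next
    case False
    then obtain d where "i = Suc (j + d)" using less_imp_Suc_add ij by (metis linorder_neqE_nat)
    then show ?thesis using *[of j d z] ij by (simp add: Transposition.transpose_commute)
  qed
qed

lemma fourier_prod: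
  assumes "finite I" "\<And>i. i \<in> I \<Longrightarrow> \<exists>c. fourier s c (f i)"
  shows "\<exists>c. fourier (of_nat (card I) * s) c (\<lambda>v. \<Prod>i\<in>I. f i v)"
  using assms
proof (induction I)
  case empty
  have "fourier 0 (\<lambda>m. if m = 0 then 1 else 0) (\<lambda>_. 1)"
    unfolding fourier_def by (intro allI has_sum_finite_neutralI[of "{0}"]) auto
  then show ?case by auto
next
  case (insert x I)
  have "\<exists>c. fourier s c (f x)" using insert.prems by blast
  then obtain c where c: "fourier s c (f x)" by blast
  have "\<exists>d. fourier (of_nat (card I) * s) d (\<lambda>v. \<Prod>i\<in>I. f i v)" using insert.IH insert.prems by blast
  then obtain d where "fourier (of_nat (card I) * s) d (\<lambda>v. \<Prod>i\<in>I. f i v)" by blast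
  from fourier_mult[OF c this] show ?case using insert by (simp add: distrib_right)
qed

section \<open>Inner products of theta functions and their symmetrisations\<close>

lemma btheta_inner:
  fixes L W \<rho> \<rho>' :: real and n :: nat and d :: int
  assumes L: "0 < L" and W: "0 < W" and n: "0 < n" and \<tau>: "\<tau> = \<i> * of_real (W / L)" and d: "\<rho> - \<rho>' = of_int d"
  shows "torus_inner n L W (btheta n \<tau> (of_real \<rho>)) (btheta n \<tau> (of_real \<rho>'))
         = (if int n dvd d then of_real (L * W / sqrt (2 * n * (W / L))) else 0)"
proof (cases "int n dvd d")
  case True
  then obtain k where k: "d = int n * k" by (auto elim: dvdE)
  have "complex_of_real \<rho> = of_real (\<rho>' + (\<rho> - \<rho>'))" by simp
  also have "\<dots> = of_real \<rho>' + of_int k * of_nat n" unfolding d k by simp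
  finally have "btheta n \<tau> (of_real \<rho>) v = btheta n \<tau> (of_real \<rho>') v" for v
    by (simp only: btheta_add_int_period)
  then show ?thesis using True by (simp only: btheta_norm[OF L W n \<tau>] if_True)
next
  case False
  then show ?thesis by (simp only: btheta_orthogonal[OF L W n \<tau> d False] if_False)
qed

lemma set_integrable_btheta_inner:
  fixes L W \<rho> \<rho>' :: real and n :: nat
  assumes L: "0 < L" and W: "0 < W" and n: "0 < n" and \<tau>: "\<tau> = \<i> * of_real (W / L)"
  shows "set_integrable lborel (Lambda L W) (\<lambda>z. btheta n \<tau> \<rho> (z / of_real L) * cnj (btheta n \<tau> \<rho>' (z / of_real L))
              * of_real (background n L W z))"
proof -
  have "Im \<tau> > 0" using L W by (simp add: \<tau>)
  then show ?thesis
    by (intro set_integrable_Lambda L W continuous_intros n) (use L W in auto)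
qed

text \<open>Of the four inner products, \<rho> with \<rho>' and -\<rho> with -\<rho>' depend on the
  difference d, the mixed ones on the sum s. On the diagonal the mixed ones count only if n divides
  2 \<rho>, which is what doubles the end norms in type D.\<close>

lemma btheta_pm_inner:
  fixes L W \<rho> \<rho>' \<epsilon> :: real and n :: nat and d s :: int
  assumes L: "0 < L" and W: "0 < W" and n: "0 < n" and \<tau>: "\<tau> = \<i> * of_real (W / L)"
    and d: "\<rho> - \<rho>' = of_int d" and s: "\<rho> + \<rho>' = of_int s" and \<epsilon>: "\<epsilon> * \<epsilon> = 1"
  defines "\<psi> \<equiv> \<lambda>\<rho> v. btheta n \<tau> (complex_of_real \<rho>) v + of_real \<epsilon> * btheta n \<tau> (of_real (- \<rho>)) v"
    and "c \<equiv> L * W / sqrt (2 * n * (W / L))"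
  shows "torus_inner n L W (\<psi> \<rho>) (\<psi> \<rho>')
         = of_real (2 * ((if int n dvd d then c else 0) + \<epsilon> * (if int n dvd s then c else 0)))"
proof -
  define f where "f a b z = btheta n \<tau> (complex_of_real a) (z / of_real L) * cnj (btheta n \<tau> (of_real b) (z / of_real L))
              * of_real (background n L W z)" for a b z
  have int: "set_integrable lborel (Lambda L W) (f a b)" for a b
    unfolding f_def by (rule set_integrable_btheta_inner[OF L W n \<tau>])
  have val: "(LINT z:Lambda L W|lborel. f a b z) = (if int n dvd k then of_real c else 0)" if "a - b = of_int k" for a b k
    unfolding f_def c_def by (rule btheta_inner[OF L W n \<tau> that])
  have e: "complex_of_real \<epsilon> * of_real \<epsilon> = 1" using \<epsilon> by (simp flip: of_real_mult)
  have "\<psi> \<rho> (z / of_real L) * cnj (\<psi> \<rho>' (z / of_real L)) * of_real (background n L W z)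
      = (f \<rho> \<rho>' z + of_real \<epsilon> * f \<rho> (- \<rho>') z) + (of_real \<epsilon> * f (- \<rho>) \<rho>' z + (of_real \<epsilon> * of_real \<epsilon>) * f (- \<rho>) (- \<rho>') z)" for z
    unfolding \<psi>_def f_def complex_cnj_add complex_cnj_mult complex_cnj_complex_of_real by (simp only: distrib_left distrib_right mult_ac add_ac)
  then have "torus_inner n L W (\<psi> \<rho>) (\<psi> \<rho>')
      = (LINT z:Lambda L W|lborel. (f \<rho> \<rho>' z + of_real \<epsilon> * f \<rho> (- \<rho>') z) + (of_real \<epsilon> * f (- \<rho>) \<rho>' z + f (- \<rho>) (- \<rho>') z))"
    by (simp only: e mult_1)
  also have "\<dots> = ((LINT z:Lambda L W|lborel. f \<rho> \<rho>' z) + of_real \<epsilon> * (LINT z:Lambda L W|lborel. f \<rho> (- \<rho>') z))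
      + (of_real \<epsilon> * (LINT z:Lambda L W|lborel. f (- \<rho>) \<rho>' z) + (LINT z:Lambda L W|lborel. f (- \<rho>) (- \<rho>') z))"
    using int by (simp only: set_integral_add set_integrable_mult_right set_integral_mult_right)
  also have "(LINT z:Lambda L W|lborel. f \<rho> \<rho>' z) = (if int n dvd d then of_real c else 0)" by (rule val[OF d])
  also have "(LINT z:Lambda L W|lborel. f \<rho> (- \<rho>') z) = (if int n dvd s then of_real c else 0)"
    by (rule val) (use s in simp)
  also have "(LINT z:Lambda L W|lborel. f (- \<rho>) \<rho>' z) = (if int n dvd - s then of_real c else 0)"
    by (rule val) (use s in simp)
  also have "(LINT z:Lambda L W|lborel. f (- \<rho>) (- \<rho>') z) = (if int n dvd - d then of_real c else 0)"
    by (rule val) (use d in simp)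
  finally show ?thesis by (simp only: dvd_minus_iff) (simp add: algebra_simps)
qed

text \<open>What the three cases share. The constant c is the common norm of the
  \<open>btheta\<close>, and \<mu> is the multiplicity 1, 2 or 4 in h. The orthonormal functions are
  the \<psi> with the Gaussian in Im z, divided by the root of \<mu> c; the Gaussian in J cancels
  because each M carries it once and h carries its square.\<close>

lemma plasma_kernel:
  fixes L W :: real and N n :: nat and \<psi> :: "nat \<Rightarrow> complex \<Rightarrow> complex" and \<mu> :: "nat \<Rightarrow> real"
  assumes L: "0 < L" and W: "0 < W" and \<tau>: "\<tau> = \<i> * of_real (W / L)" and n: "n = calN R N"
    and c: "c = L * W / sqrt (2 * n * (W / L))"
    and cont: "\<And>m. m < N \<Longrightarrow> continuous_on UNIV (\<psi> m)"
    and M: "\<And>m z. m < N \<Longrightarrow> Mf R L \<tau> N (Suc m) z = of_real (exp (pi * (W / L) * (Jf R (Suc m))\<^sup>2 / n)) * \<psi> m (z / of_real L)"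
    and h: "\<And>m. m < N \<Longrightarrow> hf R L W \<tau> N (Suc m) = of_real (\<mu> m * c * (exp (pi * (W / L) * (Jf R (Suc m))\<^sup>2 / n))\<^sup>2)"
    and \<mu>: "\<And>m. m < N \<Longrightarrow> 0 < \<mu> m * c"
    and inner: "\<And>j k. j < N \<Longrightarrow> k < N \<Longrightarrow> torus_inner n L W (\<psi> j) (\<psi> k) = (if j = k then of_real (\<mu> j * c) else 0)"
    and span: "\<And>z i. i < N \<Longrightarrow> \<exists>d. \<forall>w. F (z(i := w)) = (\<Sum>m<N. d m * \<psi> m (w / of_real L))"
    and anti: "\<And>z i j. i < N \<Longrightarrow> j < N \<Longrightarrow> i \<noteq> j \<Longrightarrow> F (z \<circ> Transposition.transpose i j) = - F z"
    and loc: "\<And>z z'. (\<And>i. i < N \<Longrightarrow> z i = z' i) \<Longrightarrow> F z = F z'"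
    and nz: "F z0 \<noteq> 0"
    and w_meas: "\<And>(M :: (nat \<Rightarrow> complex) measure) g. (\<And>i. i < N \<Longrightarrow> (\<lambda>\<omega>. g \<omega> i) \<in> borel_measurable M) \<Longrightarrow>
        (\<lambda>\<omega>. (\<Prod>i<N. indicator (Lambda L W) (g \<omega> i)) * w (g \<omega>)) \<in> borel_measurable M"
    and P: "Measurable.pred (borel \<Otimes>\<^sub>M borel) (\<lambda>(a, b). P a b)" and P_ae: "\<And>a. AE b in lborel. P a b"
    and Q: "Measurable.pred borel Q" and Q_ae: "AE b in lborel. Q b"
    and w: "\<And>z. (\<And>i. i < N \<Longrightarrow> z i \<in> Lambda L W \<and> Q (z i)) \<Longrightarrow> (\<And>j k. j < k \<Longrightarrow> k < N \<Longrightarrow> P (z j) (z k)) \<Longrightarrow>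
        w z = C * ((\<Prod>i<N. exp (- pi * n * (Im (z i))\<^sup>2 / (L * W))) * cmod (F z))\<^sup>2"
    and C: "C > 0"
  shows "determinantal (Lambda L W) N w (Kern R L W \<tau> N)"
proof -
  define g where "g z = exp (- pi * n * (Im z)\<^sup>2 / (L * W))" for z
  define b where "b m z = of_real (1 / sqrt (\<mu> m * c)) * \<psi> m (z / of_real L)" for m z
  let ?\<phi> = "\<lambda>m z. complex_of_real (g z) * b m z"
  have bcont: "continuous_on UNIV (b m)" if "m < N" for m
    unfolding b_def using cont[OF that] L
    by (intro continuous_intros continuous_on_compose2[OF cont[OF that]]) auto
  have gcont: "continuous_on UNIV (\<lambda>z. complex_of_real (g z))"
    unfolding g_def using L W by (intro continuous_intros) auto
  have gg: "g z * g z = background n L W z" for z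
    by (simp add: g_def flip: exp_add)
  have phi: "?\<phi> j z * cnj (?\<phi> k z) = of_real (1 / sqrt (\<mu> j * c)) * of_real (1 / sqrt (\<mu> k * c)) *
      (\<psi> j (z / of_real L) * cnj (\<psi> k (z / of_real L)) * of_real (background n L W z))" for j k z
    unfolding gg[symmetric] b_def complex_cnj_mult complex_cnj_complex_of_real of_real_mult by (simp only: mult_ac)
  have sq: "1 / sqrt (\<mu> m * c) * (1 / sqrt (\<mu> m * c)) * (\<mu> m * c) = 1" if "m < N" for m
    
  proof -
    have "1 / sqrt x * (1 / sqrt x) * x = 1" if "0 < x" for x :: real using that by simp
    then show ?thesis using \<mu>[OF that] .
  qed
  show ?thesis
  proof (rule plasma_determinantal[where g = g and b = b and F = F and P = P and R = Q and C = C, OF _ _ _ _ _ _ _ _ nz])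
    fix j k assume jk: "j < N" "k < N"
    show "set_integrable lborel (Lambda L W) (\<lambda>z. ?\<phi> j z * cnj (?\<phi> k z))"
      using bcont jk gcont by (intro set_integrable_Lambda L W continuous_intros) auto
    show "(LINT z:Lambda L W|lborel. ?\<phi> j z * cnj (?\<phi> k z)) = (if j = k then 1 else 0)"
    proof (cases "j = k")
      case True
      have "complex_of_real (1 / sqrt (\<mu> j * c)) * of_real (1 / sqrt (\<mu> j * c)) * of_real (\<mu> j * c) = 1"
        using sq[OF jk(1)] by (simp only: of_real_mult[symmetric] of_real_1)
      then show ?thesis
        unfolding phi set_integral_mult_right inner[OF jk] by (simp only: True[symmetric] if_True simp_thms)
    next
      case False
      then show ?thesis unfolding phi by (simp only: set_integral_mult_right inner[OF jk] if_False mult_zero_right)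
    qed
  next
    show "?\<phi> j \<in> borel_measurable borel" if "j < N" for j
      by (intro borel_measurable_continuous_onI continuous_on_mult gcont bcont that)
  next
    fix z i assume "i < N"
    then obtain d where d: "\<And>w. F (z(i := w)) = (\<Sum>m<N. d m * \<psi> m (w / of_real L))" using span by blast
    have s: "complex_of_real (sqrt x) * of_real (1 / sqrt x) = 1" if "0 < x" for x
      using that by (simp flip: of_real_mult)
    have "d m * \<psi> m v = (d m * of_real (sqrt (\<mu> m * c))) * (of_real (1 / sqrt (\<mu> m * c)) * \<psi> m v)" if "m < N" for m v
    proof -
      have "(d m * of_real (sqrt (\<mu> m * c))) * (of_real (1 / sqrt (\<mu> m * c)) * \<psi> m v)
          = d m * (of_real (sqrt (\<mu> m * c)) * of_real (1 / sqrt (\<mu> m * c))) * \<psi> m v" by (simp only: mult.assoc)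
      then show ?thesis unfolding s[OF \<mu>[OF that]] by simp
    qed
    then have "F (z(i := w)) = (\<Sum>m<N. (d m * of_real (sqrt (\<mu> m * c))) * b m w)" for w
      unfolding d b_def by (intro sum.cong) auto
    then show "\<exists>d. \<forall>w. F (z(i := w)) = (\<Sum>m<N. d m * b m w)"
      by (intro exI[of _ "\<lambda>m. d m * of_real (sqrt (\<mu> m * c))"] allI)
  next
    fix z assume "\<And>i. i < N \<Longrightarrow> z i \<in> Lambda L W \<and> Q (z i)" "\<And>j k. j < k \<Longrightarrow> k < N \<Longrightarrow> P (z j) (z k)"
    then show "w z = C * ((\<Prod>i<N. g (z i)) * cmod (F z))\<^sup>2"
      unfolding g_def by (rule w)
  next
    fix x y
    define E where "E m = exp (pi * (W / L) * (Jf R (Suc m))\<^sup>2 / n)" for m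
    have "Kern R L W \<tau> N x y = of_real (g x) * of_real (g y) * (\<Sum>m<N. Mf R L \<tau> N (Suc m) x * cnj (Mf R L \<tau> N (Suc m) y) / hf R L W \<tau> N (Suc m))"
    proof -
      have "exp (- pi * real (calN R N) * ((Im x)\<^sup>2 + (Im y)\<^sup>2) / (L * W)) = g x * g y"
        unfolding g_def n by (simp add: distrib_left add_divide_distrib diff_divide_distrib flip: exp_add)
      moreover have "(\<Sum>m = 1..N. f m) = (\<Sum>m<N. f (Suc m))" for f :: "nat \<Rightarrow> complex"
        by (rule sum.reindex_bij_witness[where i = Suc and j = "\<lambda>m. m - 1"]) auto
      ultimately show ?thesis unfolding Kern_def by simp
    qed
    also have "\<dots> = (\<Sum>m<N. ?\<phi> m x * cnj (?\<phi> m y))"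
      unfolding sum_distrib_left
    proof (intro sum.cong refl)
      fix m assume "m \<in> {..<N}"
      then have m: "m < N" by simp
      have E: "E m > 0" by (simp add: E_def)
      have "Mf R L \<tau> N (Suc m) x * cnj (Mf R L \<tau> N (Suc m) y) / hf R L W \<tau> N (Suc m)
          = (of_real (E m) * \<psi> m (x / of_real L)) * (of_real (E m) * cnj (\<psi> m (y / of_real L))) / of_real (\<mu> m * c * (E m)\<^sup>2)"
        unfolding M[OF m] h[OF m] E_def[symmetric] by simp
      also have "\<dots> = \<psi> m (x / of_real L) * cnj (\<psi> m (y / of_real L)) * of_real (1 / (\<mu> m * c))"
        using E \<mu>[OF m] by (simp add: field_simps power2_eq_square)
      also have "1 / (\<mu> m * c) = 1 / sqrt (\<mu> m * c) * (1 / sqrt (\<mu> m * c))"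
        using \<mu>[OF m] by simp
      finally show "of_real (g x) * of_real (g y) * (Mf R L \<tau> N (Suc m) x * cnj (Mf R L \<tau> N (Suc m) y) / hf R L W \<tau> N (Suc m))
          = ?\<phi> m x * cnj (?\<phi> m y)"
        unfolding b_def complex_cnj_mult complex_cnj_complex_of_real of_real_mult by (simp only: mult_ac)
    qed
    finally show "Kern R L W \<tau> N x y = (\<Sum>m<N. ?\<phi> m x * cnj (?\<phi> m y))" .
  next
    show "0 < g z" for z by (simp add: g_def)
    show "F (z \<circ> Transposition.transpose i j) = - F z" if "i < N" "j < N" "i \<noteq> j" for z i j
      by (rule anti[OF that])
    show "F z = F z'" if "\<And>i. i < N \<Longrightarrow> z i = z' i" for z z'
      by (rule loc[OF that])
    show "(\<lambda>\<omega>. (\<Prod>i<N. indicator (Lambda L W) (g \<omega> i)) * w (g \<omega>)) \<in> borel_measurable M"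
      if "\<And>i. i < N \<Longrightarrow> (\<lambda>\<omega>. g \<omega> i) \<in> borel_measurable M" for M :: "(nat \<Rightarrow> complex) measure" and g
      by (rule w_meas[OF that])
    show "Lambda L W \<in> sets borel" by (rule Lambda_sets)
  qed (rule P P_ae Q Q_ae C)+
qed

lemma qexp_real:
  assumes "\<tau> = \<i> * of_real t"
  shows "qexp (- (\<tau> * (of_real J)\<^sup>2 / (2 * of_nat n))) = of_real (exp (pi * t * J\<^sup>2 / n))"
proof -
  have "2 * of_real pi * \<i> * - (\<tau> * (of_real J)\<^sup>2 / (2 * of_nat n)) = complex_of_real (pi * t * J\<^sup>2 / n)"
    by (simp add: assms)
  then show ?thesis unfolding qexp_def by (simp only: exp_of_real)
qed

text \<open>The second product is the first at -z, and reflection changes the sign of the residue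
  class.\<close>

lemma Mf_term:
  assumes "0 < n" and \<tau>: "\<tau> = \<i> * of_real t" and \<rho>: "\<rho> = J - real n / 2"
  shows "exp (2 * pi * \<i> * of_real J * z / of_real L) * theta2 (of_real J * \<tau> + of_nat n * z / of_real L) (of_nat n * \<tau>)
      = of_real (exp (pi * t * J\<^sup>2 / n)) * btheta n \<tau> (of_real \<rho>) (z / of_real L)"
    and "exp (- 2 * pi * \<i> * of_real J * z / of_real L) * theta2 (of_real J * \<tau> - of_nat n * z / of_real L) (of_nat n * \<tau>)
      = of_real (exp (pi * t * J\<^sup>2 / n)) * btheta n \<tau> (of_real (- \<rho>)) (z / of_real L)"
proof -
  have r: "of_real \<rho> = of_real J - of_nat n / (2::complex)" by (simp add: \<rho>)
  show "exp (2 * pi * \<i> * of_real J * z / of_real L) * theta2 (of_real J * \<tau> + of_nat n * z / of_real L) (of_nat n * \<tau>)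
      = of_real (exp (pi * t * J\<^sup>2 / n)) * btheta n \<tau> (of_real \<rho>) (z / of_real L)"
    using theta2_conv_btheta[OF \<open>0 < n\<close>, of "of_real J" "z / of_real L" \<tau>]
    unfolding qexp_real[OF \<tau>] r by (simp add: qexp_def mult_ac)
  have "btheta n \<tau> (of_real \<rho>) (- (z / of_real L)) = btheta n \<tau> (of_real (- \<rho>)) (z / of_real L)"
    unfolding btheta_minus of_real_minus ..
  then show "exp (- 2 * pi * \<i> * of_real J * z / of_real L) * theta2 (of_real J * \<tau> - of_nat n * z / of_real L) (of_nat n * \<tau>)
      = of_real (exp (pi * t * J\<^sup>2 / n)) * btheta n \<tau> (of_real (- \<rho>)) (z / of_real L)"
    using theta2_conv_btheta[OF \<open>0 < n\<close>, of "of_real J" "- (z / of_real L)" \<tau>]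
    unfolding qexp_real[OF \<tau>] r[symmetric] by (simp add: qexp_def mult_ac)
qed

lemma hf_exp:
  assumes "\<tau> = \<i> * of_real t"
  shows "exp (- 2 * \<tau> * pi * \<i> * (of_real J)\<^sup>2 / of_nat n) = complex_of_real ((exp (pi * t * J\<^sup>2 / n))\<^sup>2)"
proof -
  have "- 2 * \<tau> * pi * \<i> * (of_real J)\<^sup>2 / of_nat n = complex_of_real (2 * (pi * t * J\<^sup>2 / n))"
    by (simp add: assms complex_eq_iff power2_eq_square)
  then show ?thesis by (simp only: exp_of_real exp_double)
qed

subsection \<open>Weights and slots\<close>

lemma square_prod_conv_exp:
  fixes a :: "nat \<Rightarrow> nat \<Rightarrow> real"
  assumes "\<And>j k. j < k \<Longrightarrow> k < N \<Longrightarrow> 0 < a k j"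
  shows "(\<Prod>k<N. \<Prod>j<k. a k j)\<^sup>2 = exp (2 * (\<Sum>k<N. \<Sum>j<k. ln (a k j)))"
proof -
  have "(\<Prod>k<N. \<Prod>j<k. a k j) = exp (\<Sum>k<N. \<Sum>j<k. ln (a k j))"
    using assms by (simp add: exp_sum)
  then show ?thesis by (simp add: exp_double)
qed

text \<open>Each index belongs to N - 1 pairs; this is the N - 1 in the exponent of |theta_1(2 z /
  L)|.\<close>

lemma sum_pairs:
  fixes l :: "nat \<Rightarrow> real"
  shows "(\<Sum>k<N. \<Sum>j<k. l k + l j) = (real N - 1) * (\<Sum>k<N. l k)"
  by (induction N) (simp_all add: sum.distrib algebra_simps)

lemma Q_plasma_minus:
  assumes L: "0 < L" and W: "0 < W" and \<tau>: "\<tau> = \<i> * of_real (W / L)"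
  shows "\<exists>C>0. \<forall>z. (\<forall>i<N. z i \<in> Lambda L W) \<longrightarrow> (\<forall>j k. j < k \<longrightarrow> k < N \<longrightarrow> theta1 ((z k - z j) / of_real L) \<tau> \<noteq> 0) \<longrightarrow>
     Q_plasma (Phi_minus L \<tau>) L W N N 2 z
       = C * (\<Prod>k<N. \<Prod>j<k. cmod (theta1 ((z k - z j) / of_real L) \<tau>))\<^sup>2
           * (\<Prod>k<N. exp (- 2 * pi * N / (L * W) * ((Im (z k))\<^sup>2 - W * Im (z k))))"
proof -
  define \<kappa> where "\<kappa> = 3 * ln (cmod (eta \<tau>)) + ln (2 * pi / L)"
  obtain v where v: "\<And>z. z \<in> Lambda L W \<Longrightarrow> V_bg (Phi_minus L \<tau>) L W N z = v + pi * real N / (L * W) * ((Im z)\<^sup>2 - W * Im z)"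
    using V_bg_minus[OF L W \<tau>, of N] by blast
  define B where "B = (\<Sum>k<N. \<Sum>j<k. \<kappa>) + (\<Sum>j<N. v) + E_bb (Phi_minus L \<tau>) L W N"
  have "Q_plasma (Phi_minus L \<tau>) L W N N 2 z = exp (- 2 * B) * (\<Prod>k<N. \<Prod>j<k. cmod (theta1 ((z k - z j) / of_real L) \<tau>))\<^sup>2
           * (\<Prod>k<N. exp (- 2 * pi * N / (L * W) * ((Im (z k))\<^sup>2 - W * Im (z k))))"
    if z: "\<forall>i<N. z i \<in> Lambda L W" and nz: "\<forall>j k. j < k \<longrightarrow> k < N \<longrightarrow> theta1 ((z k - z j) / of_real L) \<tau> \<noteq> 0" for z
  proof -
    let ?S = "\<Sum>k<N. \<Sum>j<k. ln (cmod (theta1 ((z k - z j) / of_real L) \<tau>))"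
    let ?Y = "\<Sum>k<N. - 2 * pi * N / (L * W) * ((Im (z k))\<^sup>2 - W * Im (z k))"
    have "E_pp (Phi_minus L \<tau>) N z = (\<Sum>k<N. \<Sum>j<k. \<kappa>) - ?S"
      unfolding E_pp_def Phi_minus_def \<kappa>_def sum_subtractf[symmetric] by (intro sum.cong refl) simp
    moreover have "E_pb (Phi_minus L \<tau>) L W N N z = (\<Sum>j<N. v) + (\<Sum>k<N. pi * real N / (L * W) * ((Im (z k))\<^sup>2 - W * Im (z k)))"
      unfolding E_pb_def sum.distrib[symmetric] using z v by (intro sum.cong refl) auto
    moreover have "?Y = - 2 * (\<Sum>k<N. pi * real N / (L * W) * ((Im (z k))\<^sup>2 - W * Im (z k)))"
      unfolding sum_distrib_left by (intro sum.cong refl) simp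
    ultimately have "- 2 * (E_pp (Phi_minus L \<tau>) N z + E_pb (Phi_minus L \<tau>) L W N N z + E_bb (Phi_minus L \<tau>) L W N)
       = - 2 * B + 2 * ?S + ?Y" unfolding B_def by argo
    then have "Q_plasma (Phi_minus L \<tau>) L W N N 2 z = exp (- 2 * B) * exp (2 * ?S) * exp ?Y"
      unfolding Q_plasma_def by (simp only: exp_add)
    also have "exp (2 * ?S) = (\<Prod>k<N. \<Prod>j<k. cmod (theta1 ((z k - z j) / of_real L) \<tau>))\<^sup>2"
      by (rule square_prod_conv_exp[symmetric]) (use nz in simp)
    also have "exp ?Y = (\<Prod>k<N. exp (- 2 * pi * N / (L * W) * ((Im (z k))\<^sup>2 - W * Im (z k))))"
      by (rule exp_sum) simp
    finally show ?thesis .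
  qed
  then show ?thesis by (intro exI[of _ "exp (- 2 * B)"]) simp
qed

text \<open>The exponent of the last factor collects Nm from the background and -(N - 1) from the
  pairs. It stays in the form exp of ln, so that configurations with theta_1(2 z / L) = 0 are still
  covered here.\<close>

lemma Q_plasma_pm:
  assumes L: "0 < L" and W: "0 < W" and \<tau>: "\<tau> = \<i> * of_real (W / L)"
  shows "\<exists>C>0. \<forall>z. (\<forall>i<N. z i \<in> Lambda L W) \<longrightarrow> (\<forall>j k. j < k \<longrightarrow> k < N \<longrightarrow>
        theta1 ((z k + z j) / of_real L) \<tau> \<noteq> 0 \<and> theta1 ((z k - z j) / of_real L) \<tau> \<noteq> 0) \<longrightarrow>
     Q_plasma (Phi_pm L \<tau>) L W N Nm 2 z
       = C * (\<Prod>k<N. \<Prod>j<k. cmod (theta1 ((z k + z j) / of_real L) \<tau> * theta1 ((z k - z j) / of_real L) \<tau>))\<^sup>2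
           * (\<Prod>k<N. exp (- 4 * pi * Nm / (L * W) * (Im (z k))\<^sup>2))
           * exp ((real Nm - real N + 1) * (\<Sum>k<N. ln (cmod (theta1 (2 * z k / of_real L) \<tau>))))"
proof -
  define \<kappa> where "\<kappa> = 3 * ln (cmod (eta \<tau>)) + ln (2 * pi / L)"
  define l where "l z = ln (cmod (theta1 (2 * z / of_real L) \<tau>))" for z
  obtain v where v: "\<And>z. z \<in> Lambda L W \<Longrightarrow> V_bg (Phi_pm L \<tau>) L W Nm z = v + 2 * pi * real Nm / (L * W) * (Im z)\<^sup>2 - real Nm / 2 * l z"
    using V_bg_pm[OF L W \<tau>, of Nm] unfolding l_def by blast
  define B where "B = (\<Sum>k<N. \<Sum>j<k. \<kappa>) + (\<Sum>j<N. v) + E_bb (Phi_pm L \<tau>) L W Nm"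
  have "Q_plasma (Phi_pm L \<tau>) L W N Nm 2 z = exp (- 2 * B)
           * (\<Prod>k<N. \<Prod>j<k. cmod (theta1 ((z k + z j) / of_real L) \<tau> * theta1 ((z k - z j) / of_real L) \<tau>))\<^sup>2
           * (\<Prod>k<N. exp (- 4 * pi * Nm / (L * W) * (Im (z k))\<^sup>2))
           * exp ((real Nm - real N + 1) * (\<Sum>k<N. l (z k)))"
    if z: "\<forall>i<N. z i \<in> Lambda L W" and nz: "\<forall>j k. j < k \<longrightarrow> k < N \<longrightarrow>
        theta1 ((z k + z j) / of_real L) \<tau> \<noteq> 0 \<and> theta1 ((z k - z j) / of_real L) \<tau> \<noteq> 0" for z
  proof -
    let ?S = "\<Sum>k<N. \<Sum>j<k. ln (cmod (theta1 ((z k + z j) / of_real L) \<tau> * theta1 ((z k - z j) / of_real L) \<tau>))"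
    let ?Y = "\<Sum>k<N. - 4 * pi * Nm / (L * W) * (Im (z k))\<^sup>2"
    let ?l = "\<Sum>k<N. l (z k)"
    have "E_pp (Phi_pm L \<tau>) N z = (\<Sum>k<N. \<Sum>j<k. \<kappa>) - ?S + 1 / 2 * (\<Sum>k<N. \<Sum>j<k. l (z k) + l (z j))"
      unfolding E_pp_def sum_distrib_left sum_subtractf[symmetric] sum.distrib[symmetric]
    proof (intro sum.cong refl)
      fix k j assume "k \<in> {..<N}" "j \<in> {..<k}"
      then show "Phi_pm L \<tau> (z k) (z j) = \<kappa> - ln (cmod (theta1 ((z k + z j) / of_real L) \<tau> * theta1 ((z k - z j) / of_real L) \<tau>))
          + 1 / 2 * (l (z k) + l (z j))"
        using nz by (simp add: Phi_pm_def \<kappa>_def l_def norm_mult ln_mult)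
    qed
    moreover have "E_pb (Phi_pm L \<tau>) L W N Nm z = (\<Sum>j<N. v) + (\<Sum>k<N. 2 * pi * real Nm / (L * W) * (Im (z k))\<^sup>2) - real Nm / 2 * ?l"
      unfolding E_pb_def sum_distrib_left sum.distrib[symmetric] sum_subtractf[symmetric] using z v by (intro sum.cong refl) auto
    moreover have "?Y = - 2 * (\<Sum>k<N. 2 * pi * real Nm / (L * W) * (Im (z k))\<^sup>2)"
      unfolding sum_distrib_left by (intro sum.cong refl) simp
    moreover have "(\<Sum>k<N. \<Sum>j<k. l (z k) + l (z j)) = (real N - 1) * ?l"
      by (rule sum_pairs)
    moreover have "(real Nm - real N + 1) * ?l = real Nm * ?l - (real N - 1) * ?l"
      by (simp add: algebra_simps)
    ultimately have "- 2 * (E_pp (Phi_pm L \<tau>) N z + E_pb (Phi_pm L \<tau>) L W N Nm z + E_bb (Phi_pm L \<tau>) L W Nm)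
       = - 2 * B + 2 * ?S + ?Y + (real Nm - real N + 1) * ?l" unfolding B_def by simp
    then have "Q_plasma (Phi_pm L \<tau>) L W N Nm 2 z = exp (- 2 * B) * exp (2 * ?S) * exp ?Y * exp ((real Nm - real N + 1) * ?l)"
      unfolding Q_plasma_def by (simp only: exp_add)
    also have "exp (2 * ?S) = (\<Prod>k<N. \<Prod>j<k. cmod (theta1 ((z k + z j) / of_real L) \<tau> * theta1 ((z k - z j) / of_real L) \<tau>))\<^sup>2"
      by (rule square_prod_conv_exp[symmetric]) (use nz in simp)
    also have "exp ?Y = (\<Prod>k<N. exp (- 4 * pi * Nm / (L * W) * (Im (z k))\<^sup>2))"
      by (rule exp_sum) simp
    finally show ?thesis .
  qed
  then show ?thesis unfolding l_def by (intro exI[of _ "exp (- 2 * B)"]) simp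
qed

section \<open>The centre-of-mass factor\<close>

lemma btheta_minus_nat: "btheta 1 \<tau> 0 (v - of_nat m) = btheta 1 \<tau> 0 v"
proof (induction m)
  case (Suc m)
  then show ?case using btheta_plus_1[of 1 \<tau> 0 "v - of_nat (Suc m)"] by (simp add: algebra_simps)
qed simp

lemma btheta_minus_tau_nat:
  "btheta 1 \<tau> 0 (v - of_nat m * \<tau>) = qexp (of_nat m * v - \<tau> * (of_nat m)\<^sup>2 / 2) * btheta 1 \<tau> 0 v"
proof (induction m)
  case (Suc m)
  let ?u = "v - of_nat (Suc m) * \<tau>"
  have e: "?u + \<tau> = v - of_nat m * \<tau>" by (simp add: algebra_simps)
  have "btheta 1 \<tau> 0 (?u + \<tau>) = qexp (- ?u - \<tau> / 2) * btheta 1 \<tau> 0 ?u"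
    using btheta_plus_tau[of 1 \<tau> 0 ?u] by simp
  then have "btheta 1 \<tau> 0 (v - of_nat m * \<tau>) = qexp (- ?u - \<tau> / 2) * btheta 1 \<tau> 0 ?u"
    unfolding e .
  then have "btheta 1 \<tau> 0 ?u = qexp (?u + \<tau> / 2) * btheta 1 \<tau> 0 (v - of_nat m * \<tau>)"
    by (simp only: mult.assoc[symmetric] qexp_add[symmetric]) simp
  also have "\<dots> = qexp ((?u + \<tau> / 2) + (of_nat m * v - \<tau> * (of_nat m)\<^sup>2 / 2)) * btheta 1 \<tau> 0 v"
    by (simp only: Suc.IH qexp_add mult.assoc)
  also have "(?u + \<tau> / 2) + (of_nat m * v - \<tau> * (of_nat m)\<^sup>2 / 2) = of_nat (Suc m) * v - \<tau> * (of_nat (Suc m))\<^sup>2 / 2"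
    by (simp add: field_simps power2_eq_square)
  finally show ?case .
qed simp

text \<open>A shift by 1/2 turns theta_3 into theta_0 and reverses the sign of its factor under
  translation by tau. For even N this offsets the N - 1 minus signs from the factors theta_1 in a
  slot.\<close>

definition half_shift :: "nat \<Rightarrow> complex" where
  "half_shift N = (if even N then 1/2 else 0)"

text \<open>Moving the argument of \<open>\<theta>\<^sub>0\<close> resp. \<open>\<theta>\<^sub>1\<close> by \<open>N (1 + \<tau>) / 2\<close> turns it into \<open>\<theta>\<^sub>0\<close> resp. \<open>\<theta>\<^sub>3\<close> times an
  exponential, which is what compensates the linear part of the background potential.\<close>
lemma norm_theta_center_of_mass:
  assumes \<tau>: "Im \<tau> > 0"
  shows "\<exists>C>0. \<forall>S. cmod ((if even N then theta0 else theta1) (S - of_nat N * (1 / 2 + \<tau> / 2)) \<tau>)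
      = C * exp (- pi * N * Im S) * cmod (btheta 1 \<tau> 0 (S + half_shift N))"
proof (cases "even N")
  case True
  then obtain m where m: "N = 2 * m" by (auto elim: evenE)
  have "cmod (theta0 (S - of_nat N * (1 / 2 + \<tau> / 2)) \<tau>) = exp (pi * Im \<tau> * (real m)\<^sup>2) * exp (- pi * N * Im S) * cmod (btheta 1 \<tau> 0 (S + 1/2))" for S
  proof -
    \<comment> \<open>For N = 2 m the centre is m + m tau: the m steps by tau produce the
      exponential, the m steps by 1 have no effect.\<close>
    have "S - of_nat N * (1 / 2 + \<tau> / 2) + 1/2 = (S + 1/2 - of_nat m * \<tau>) - of_nat m"
      by (simp add: m algebra_simps)
    then have "theta0 (S - of_nat N * (1 / 2 + \<tau> / 2)) \<tau> = qexp (of_nat m * (S + 1/2) - \<tau> * (of_nat m)\<^sup>2 / 2) * btheta 1 \<tau> 0 (S + 1/2)"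
      unfolding theta0_conv_btheta by (simp only: btheta_minus_nat btheta_minus_tau_nat)
    moreover have "cmod (qexp (of_nat m * (S + 1/2) - \<tau> * (of_nat m)\<^sup>2 / 2)) = exp (pi * Im \<tau> * (real m)\<^sup>2) * exp (- pi * N * Im S)"
      unfolding norm_qexp exp_add[symmetric] by (rule arg_cong[where f = exp]) (simp add: m power2_eq_square algebra_simps flip: of_nat_mult)
    ultimately show ?thesis by (simp only: norm_mult)
  qed
  then show ?thesis using True by (intro exI[of _ "exp (pi * Im \<tau> * (real m)\<^sup>2)"]) (simp add: half_shift_def)
next
  case False
  then obtain m where m: "N = 2 * m + 1" by (auto elim: oddE)
  define k where "k = - 2 * pi * (Im \<tau> / 8 + (real m + 1/2) * Im \<tau> / 2 - Im \<tau> * (real m + 1)\<^sup>2 / 2)"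
  have "cmod (theta1 (S - of_nat N * (1 / 2 + \<tau> / 2)) \<tau>) = exp k * exp (- pi * N * Im S) * cmod (btheta 1 \<tau> 0 S)" for S
  proof -
    let ?y = "S - of_nat N * (1 / 2 + \<tau> / 2) + 1/2"
    have "btheta 1 \<tau> (- 1/2) ?y = qexp (\<tau> / 8 - ?y / 2) * jtheta \<tau> (?y - \<tau> / 2)"
      using btheta_conv_jtheta[OF \<tau>, of 1 "- 1/2" ?y] by (simp add: power2_eq_square)
    also have "jtheta \<tau> (?y - \<tau> / 2) = btheta 1 \<tau> 0 (?y - \<tau> / 2)"
      using btheta_conv_jtheta[OF \<tau>, of 1 0 "?y - \<tau> / 2"] by simp
    \<comment> \<open>Up to an exponential theta_1 is theta_3 moved by 1/2 - tau / 2; this completes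
      the odd multiples of one half to m steps by 1 and m + 1 steps by tau.\<close>
    also have "?y - \<tau> / 2 = (S - of_nat (m + 1) * \<tau>) - of_nat m"
      by (simp add: m field_simps)
    also have "btheta 1 \<tau> 0 \<dots> = qexp (of_nat (m + 1) * S - \<tau> * (of_nat (m + 1))\<^sup>2 / 2) * btheta 1 \<tau> 0 S"
      by (simp only: btheta_minus_nat btheta_minus_tau_nat)
    finally have "theta1 (S - of_nat N * (1 / 2 + \<tau> / 2)) \<tau> = - (qexp ((\<tau> / 8 - ?y / 2) + (of_nat (m + 1) * S - \<tau> * (of_nat (m + 1))\<^sup>2 / 2)) * btheta 1 \<tau> 0 S)"
      unfolding theta1_conv_btheta by (simp only: qexp_add mult.assoc)
    moreover have "cmod (qexp ((\<tau> / 8 - ?y / 2) + (of_nat (m + 1) * S - \<tau> * (of_nat (m + 1))\<^sup>2 / 2))) = exp k * exp (- pi * N * Im S)"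
      unfolding norm_qexp exp_add[symmetric] k_def by (rule arg_cong[where f = exp]) (simp add: m power2_eq_square field_simps)
    ultimately show ?thesis by (simp only: norm_mult norm_minus_cancel)
  qed
  then show ?thesis using False by (intro exI[of _ "exp k"]) (simp add: half_shift_def)
qed

section \<open>Quasi-periodicity and span in one slot\<close>

lemma theta1_prod_quasi:
  assumes "finite I"
  shows "(\<Prod>j\<in>I. theta1 (v + \<tau> - a j) \<tau>) = (-1) ^ card I * qexp (- (of_nat (card I) * v) - of_nat (card I) * \<tau> / 2 + sum a I) * (\<Prod>j\<in>I. theta1 (v - a j) \<tau>)"
  using assms
proof (induction I)
  case (insert x I)
  let ?A = "- (v - a x) - \<tau> / 2" and ?B = "- (of_nat (card I) * v) - of_nat (card I) * \<tau> / 2 + sum a I"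
  have 1: "theta1 (v + \<tau> - a x) \<tau> = - qexp ?A * theta1 (v - a x) \<tau>"
    using theta1_plus_tau[of "v - a x" \<tau>] by (simp add: algebra_simps)
  have "- (of_nat (card (insert x I)) * v) - of_nat (card (insert x I)) * \<tau> / 2 + sum a (insert x I) = ?A + ?B"
    using insert by (simp add: field_simps)
  then have Q: "qexp (- (of_nat (card (insert x I)) * v) - of_nat (card (insert x I)) * \<tau> / 2 + sum a (insert x I)) = qexp ?A * qexp ?B"
    by (simp only: qexp_add[of ?A ?B])
  show ?case
    unfolding Q
    unfolding prod.insert[OF insert.hyps] 1 insert.IH card_insert_disjoint[OF insert.hyps] power_Suc
    by (simp only: mult_minus_left mult_minus_right minus_minus mult_1 mult_ac)
qed simp

text \<open>The N - 1 pair factors have degree N - 1 but bring in qexp of the sum of the other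
  points. The centre-of-mass factor contributes its inverse and one more degree, and
  \<open>half_shift\<close> corrects the sign.\<close>

lemma minus_slot_span:
  fixes a :: "nat \<Rightarrow> complex"
  assumes \<tau>: "Im \<tau> > 0" and I: "finite I" "card I = N - 1" and N: "0 < N"
  shows "\<exists>d. \<forall>v. btheta 1 \<tau> 0 (v + sum a I + half_shift N) * (\<Prod>j\<in>I. theta1 (v - a j) \<tau>)
      = (\<Sum>r<N. d r * btheta N \<tau> (of_nat (N - 1) * (- 1/2) + of_nat r) v)"
proof -
  let ?A = "sum a I + half_shift N"
  obtain c where c: "fourier (of_nat (card I) * (- 1/2)) c (\<lambda>v. \<Prod>j\<in>I. theta1 (v + - a j) \<tau>)"
    using fourier_prod[OF I(1), of "- 1/2" "\<lambda>j v. theta1 (v + - a j) \<tau>"] fourier_theta1[OF \<tau>] by blast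
  have "fourier 0 (\<lambda>k. qexp (\<tau> * (0 + of_int k)\<^sup>2 / 2) * qexp ((of_int k + 0) * ?A)) (\<lambda>v. btheta 1 \<tau> 0 (v + ?A))"
    by (rule fourier_translate[OF fourier_btheta_1[OF \<tau>]])
  from fourier_mult[OF this c] obtain b where
    b: "fourier (0 + of_nat (card I) * (- 1/2)) b (\<lambda>v. btheta 1 \<tau> 0 (v + ?A) * (\<Prod>j\<in>I. theta1 (v + - a j) \<tau>))" by blast
  have sgn: "(-1) ^ card I * qexp (- half_shift N) = 1"
    using N I by (cases "even N") (auto simp: half_shift_def qexp_minus qexp_half)
  have "btheta 1 \<tau> 0 (v + \<tau> + ?A) * (\<Prod>j\<in>I. theta1 (v + \<tau> + - a j) \<tau>)
      = qexp (- (of_nat N * v) - of_nat N * \<tau> / 2) * (btheta 1 \<tau> 0 (v + ?A) * (\<Prod>j\<in>I. theta1 (v + - a j) \<tau>))" for v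
  proof -
    have 1: "btheta 1 \<tau> 0 (v + \<tau> + ?A) = qexp (- (v + ?A) - \<tau> / 2) * btheta 1 \<tau> 0 (v + ?A)"
      using btheta_plus_tau[of 1 \<tau> 0 "v + ?A"] by (simp add: add_ac)
    have 2: "(\<Prod>j\<in>I. theta1 (v + \<tau> + - a j) \<tau>) = (-1) ^ card I * qexp (- (of_nat (card I) * v) - of_nat (card I) * \<tau> / 2 + sum a I) * (\<Prod>j\<in>I. theta1 (v + - a j) \<tau>)"
      using theta1_prod_quasi[OF I(1), of v \<tau> a] by simp
    have "N = Suc (card I)" using N I by simp
    then have "(- (v + ?A) - \<tau> / 2) + (- (of_nat (card I) * v) - of_nat (card I) * \<tau> / 2 + sum a I)
        = - half_shift N + (- (of_nat N * v) - of_nat N * \<tau> / 2)"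
      by (simp add: field_simps)
    then have "qexp (- (v + ?A) - \<tau> / 2) * qexp (- (of_nat (card I) * v) - of_nat (card I) * \<tau> / 2 + sum a I)
        = qexp (- half_shift N) * qexp (- (of_nat N * v) - of_nat N * \<tau> / 2)"
      by (simp only: qexp_add[symmetric])
    then have "qexp (- (v + ?A) - \<tau> / 2) * ((-1) ^ card I * qexp (- (of_nat (card I) * v) - of_nat (card I) * \<tau> / 2 + sum a I))
        = ((-1) ^ card I * qexp (- half_shift N)) * qexp (- (of_nat N * v) - of_nat N * \<tau> / 2)"
      by (simp only: mult.left_commute mult.assoc)
    also have "\<dots> = qexp (- (of_nat N * v) - of_nat N * \<tau> / 2)" by (simp only: sgn mult_1)
    finally have X: "qexp (- (v + ?A) - \<tau> / 2) * ((-1) ^ card I * qexp (- (of_nat (card I) * v) - of_nat (card I) * \<tau> / 2 + sum a I))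
        = qexp (- (of_nat N * v) - of_nat N * \<tau> / 2)" .
    have "(p * b) * (q * r) = (p * q) * (b * r)" for p q b r :: complex by (simp only: mult_ac)
    then show ?thesis unfolding 1 2 X[symmetric] .
  qed
  from quasi_periodic_span[OF b N \<tau> this]
  show ?thesis unfolding I(2) by (simp add: add.assoc)
qed

text \<open>The contributions of a and -a cancel, so here the functional equation is free of the
  other points.\<close>

lemma pm_pair_quasi:
  "theta1 (v + \<tau> + a) \<tau> * theta1 (v + \<tau> - a) \<tau> = qexp (- (2 * v) - \<tau>) * (theta1 (v + a) \<tau> * theta1 (v - a) \<tau>)"
proof -
  have "theta1 (v + \<tau> + a) \<tau> = - qexp (- (v + a) - \<tau> / 2) * theta1 (v + a) \<tau>"
    using theta1_plus_tau[of "v + a" \<tau>] by (simp add: add_ac)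
  moreover have "theta1 (v + \<tau> - a) \<tau> = - qexp (- (v - a) - \<tau> / 2) * theta1 (v - a) \<tau>"
    using theta1_plus_tau[of "v - a" \<tau>] by (simp add: algebra_simps)
  moreover have "- (2 * v) - \<tau> = (- (v + a) - \<tau> / 2) + (- (v - a) - \<tau> / 2)" by simp
  then have "qexp (- (2 * v) - \<tau>) = qexp (- (v + a) - \<tau> / 2) * qexp (- (v - a) - \<tau> / 2)"
    by (simp only: qexp_add)
  ultimately show ?thesis by simp
qed

lemma pm_prod_quasi:
  assumes "finite I"
  shows "(\<Prod>j\<in>I. theta1 (v + \<tau> + a j) \<tau> * theta1 (v + \<tau> - a j) \<tau>)
    = qexp (- (of_nat (2 * card I) * v) - of_nat (2 * card I) * \<tau> / 2) * (\<Prod>j\<in>I. theta1 (v + a j) \<tau> * theta1 (v - a j) \<tau>)"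
proof -
  have "(\<Prod>j\<in>I. theta1 (v + \<tau> + a j) \<tau> * theta1 (v + \<tau> - a j) \<tau>) = qexp (- (2 * v) - \<tau>) ^ card I * (\<Prod>j\<in>I. theta1 (v + a j) \<tau> * theta1 (v - a j) \<tau>)"
    unfolding pm_pair_quasi by (simp only: prod.distrib prod_constant)
  also have "qexp (- (2 * v) - \<tau>) ^ card I = qexp (of_nat (card I) * (- (2 * v) - \<tau>))" by (simp only: qexp_of_nat_mult)
  also have "of_nat (card I) * (- (2 * v) - \<tau>) = - (of_nat (2 * card I) * v) - of_nat (2 * card I) * \<tau> / 2"
    by (simp add: algebra_simps)
  finally show ?thesis .
qed

text \<open>Shifting v by tau shifts the argument by 2 tau; the two steps together have degree
  4.\<close>

lemma theta1_double_quasi: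
  "theta1 (2 * (v + \<tau>)) \<tau> = qexp (- (of_nat 4 * v) - of_nat 4 * \<tau> / 2) * theta1 (2 * v) \<tau>"
proof -
  have "theta1 (2 * (v + \<tau>)) \<tau> = theta1 (2 * v + \<tau> + \<tau>) \<tau>" by (simp add: algebra_simps)
  also have "\<dots> = (qexp (- (2 * v + \<tau>) - \<tau> / 2) * qexp (- (2 * v) - \<tau> / 2)) * theta1 (2 * v) \<tau>"
    by (simp only: theta1_plus_tau) simp
  also have "qexp (- (2 * v + \<tau>) - \<tau> / 2) * qexp (- (2 * v) - \<tau> / 2) = qexp (- (of_nat 4 * v) - of_nat 4 * \<tau> / 2)"
    unfolding qexp_add[symmetric] by (rule arg_cong) (simp add: field_simps)
  finally show ?thesis .
qed

lemma fourier_pm_prod: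
  assumes \<tau>: "Im \<tau> > 0" and I: "finite I"
  shows "\<exists>c. fourier (of_nat (card I) * (- 1)) c (\<lambda>v. \<Prod>j\<in>I. theta1 (v + a j) \<tau> * theta1 (v - a j) \<tau>)"
proof (rule fourier_prod[OF I])
  fix j
  obtain c d where "fourier (- 1/2) c (\<lambda>v. theta1 (v + a j) \<tau>)" "fourier (- 1/2) d (\<lambda>v. theta1 (v + - a j) \<tau>)"
    using fourier_theta1[OF \<tau>] by blast
  from fourier_mult[OF this] show "\<exists>c. fourier (- 1) c (\<lambda>v. theta1 (v + a j) \<tau> * theta1 (v - a j) \<tau>)" by simp
qed

text \<open>The offset is the integer - card I and can be moved to 0. A nonempty I, which reflects N
  >= 2, makes the degree positive.\<close>

lemma D_slot_span:
  assumes \<tau>: "Im \<tau> > 0" and I: "finite I" "0 < card I"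
  shows "\<exists>d. \<forall>v. (\<Prod>j\<in>I. theta1 (v + a j) \<tau> * theta1 (v - a j) \<tau>) = (\<Sum>r<2 * card I. d r * btheta (2 * card I) \<tau> (of_nat r) v)"
proof -
  obtain c where "fourier (0 + of_int (- int (card I))) c (\<lambda>v. \<Prod>j\<in>I. theta1 (v + a j) \<tau> * theta1 (v - a j) \<tau>)"
    using fourier_pm_prod[OF \<tau> I(1)] by auto
  then obtain c where "fourier 0 c (\<lambda>v. \<Prod>j\<in>I. theta1 (v + a j) \<tau> * theta1 (v - a j) \<tau>)"
    using fourier_shift_index by blast
  from quasi_periodic_span[OF this _ \<tau> pm_prod_quasi[OF I(1)]] I(2) show ?thesis by simp
qed

text \<open>With card I = N - 1 the degree is 2 (N - 1) + 4 = 2 (N + 1). Doubling the argument makes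
  the frequencies of the first factor integers, so the total offset can again be moved to 0.\<close>

lemma C_slot_span:
  assumes \<tau>: "Im \<tau> > 0" and I: "finite I"
  defines "n \<equiv> 2 * card I + 4"
  shows "\<exists>d. \<forall>v. theta1 (2 * v) \<tau> * (\<Prod>j\<in>I. theta1 (v + a j) \<tau> * theta1 (v - a j) \<tau>) = (\<Sum>r<n. d r * btheta n \<tau> (of_nat r) v)"
proof -
  obtain c where c: "fourier (of_nat (card I) * (- 1)) c (\<lambda>v. \<Prod>j\<in>I. theta1 (v + a j) \<tau> * theta1 (v - a j) \<tau>)"
    using fourier_pm_prod[OF \<tau> I(1)] by auto
  obtain e where "fourier (- 1/2) e (\<lambda>v. theta1 (v + 0) \<tau>)" using fourier_theta1[OF \<tau>] by blast
  then obtain e where e: "fourier (2 * (- 1/2)) e (\<lambda>v. theta1 (2 * v) \<tau>)" using fourier_double by fastforce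
  have sh: "2 * (- 1/2) + of_nat (card I) * (- 1) = (0 + of_int (- int (card I) - 1) :: complex)" by simp
  from fourier_mult[OF e c, unfolded sh] obtain b
    where "fourier (0 + of_int (- int (card I) - 1)) b (\<lambda>v. theta1 (2 * v) \<tau> * (\<Prod>j\<in>I. theta1 (v + a j) \<tau> * theta1 (v - a j) \<tau>))"
    by blast
  then obtain b where b: "fourier 0 b (\<lambda>v. theta1 (2 * v) \<tau> * (\<Prod>j\<in>I. theta1 (v + a j) \<tau> * theta1 (v - a j) \<tau>))"
    using fourier_shift_index by blast
  have "theta1 (2 * (v + \<tau>)) \<tau> * (\<Prod>j\<in>I. theta1 (v + \<tau> + a j) \<tau> * theta1 (v + \<tau> - a j) \<tau>)
      = qexp (- (of_nat n * v) - of_nat n * \<tau> / 2) * (theta1 (2 * v) \<tau> * (\<Prod>j\<in>I. theta1 (v + a j) \<tau> * theta1 (v - a j) \<tau>))" for v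
  proof -
    have "- (of_nat n * v) - of_nat n * \<tau> / 2 = (- (of_nat 4 * v) - of_nat 4 * \<tau> / 2) + (- (of_nat (2 * card I) * v) - of_nat (2 * card I) * \<tau> / 2)"
      by (simp add: n_def field_simps)
    then have "qexp (- (of_nat n * v) - of_nat n * \<tau> / 2) = qexp (- (of_nat 4 * v) - of_nat 4 * \<tau> / 2) * qexp (- (of_nat (2 * card I) * v) - of_nat (2 * card I) * \<tau> / 2)"
      by (simp only: qexp_add)
    then show ?thesis unfolding theta1_double_quasi pm_prod_quasi[OF I] by (simp only: mult_ac)
  qed
  from quasi_periodic_span[OF b _ \<tau> this] show ?thesis by (simp add: n_def)
qed

text \<open>Averaging f with its reflection replaces each of the n functions by its symmetrisation
  or antisymmetrisation, and these lie in the span of the N functions \<psi>.\<close>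

lemma parity_span:
  fixes f :: "complex \<Rightarrow> complex" and \<epsilon> :: real
  assumes f: "\<And>v. f v = (\<Sum>r<n. d r * btheta n \<tau> (of_nat r) v)"
    and parity: "\<And>v. f (- v) = of_real \<epsilon> * f v" and \<epsilon>: "\<epsilon> * \<epsilon> = 1"
    and span: "\<And>r. r < n \<Longrightarrow> \<exists>c. \<forall>v. btheta n \<tau> (of_nat r) v + of_real \<epsilon> * btheta n \<tau> (- of_nat r) v = (\<Sum>m<N. c m * \<psi> m v)"
  shows "\<exists>c. \<forall>v. f v = (\<Sum>m<N. c m * \<psi> m v)"
proof -
  have "\<forall>r. \<exists>c. r < n \<longrightarrow> (\<forall>v. btheta n \<tau> (of_nat r) v + of_real \<epsilon> * btheta n \<tau> (- of_nat r) v = (\<Sum>m<N. c m * \<psi> m v))"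
    using span by blast
  then obtain C where C: "\<And>r v. r < n \<Longrightarrow> btheta n \<tau> (of_nat r) v + of_real \<epsilon> * btheta n \<tau> (- of_nat r) v = (\<Sum>m<N. C r m * \<psi> m v)"
    by metis
  have "f v = (\<Sum>m<N. (\<Sum>r<n. d r * C r m / 2) * \<psi> m v)" for v
  proof -
    have "complex_of_real \<epsilon> * of_real \<epsilon> = 1" using \<epsilon> by (simp flip: of_real_mult)
    then have "of_real \<epsilon> * f (- v) = f v" by (simp only: parity mult.assoc[symmetric] mult_1)
    then have "f v = (f v + of_real \<epsilon> * f (- v)) / 2" by simp
    also have "\<dots> = (\<Sum>r<n. d r * (btheta n \<tau> (of_nat r) v + of_real \<epsilon> * btheta n \<tau> (- of_nat r) v) / 2)"
      unfolding f btheta_minus by (simp add: sum_distrib_left sum_divide_distrib algebra_simps add_divide_distrib flip: sum.distrib)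
    also have "\<dots> = (\<Sum>r<n. \<Sum>m<N. d r * C r m / 2 * \<psi> m v)"
      by (intro sum.cong refl) (simp add: C sum_distrib_left sum_divide_distrib mult_ac)
    also have "\<dots> = (\<Sum>m<N. (\<Sum>r<n. d r * C r m / 2) * \<psi> m v)"
      by (subst sum.swap) (simp add: sum_distrib_right)
    finally show ?thesis .
  qed
  then show ?thesis by (intro exI[of _ "\<lambda>m. \<Sum>r<n. d r * C r m / 2"] allI)
qed

lemma span_single:
  fixes \<psi> :: "nat \<Rightarrow> complex \<Rightarrow> complex"
  assumes "m < N" "\<And>v. f v = a * \<psi> m v"
  shows "\<exists>c. \<forall>v. f v = (\<Sum>k<N. c k * \<psi> k v)"
proof -
  have "f v = (\<Sum>k<N. (if k = m then a else 0) * \<psi> k v)" for v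
    using assms by (simp add: if_distribR if_distrib cong: if_cong)
  then show ?thesis by (intro exI[of _ "\<lambda>k. if k = m then a else 0"] allI)
qed

subsection \<open>The three plasmas\<close>

lemma theta1_nonzero_near:
  assumes \<tau>: "Im \<tau> > 0" and v: "Im v \<noteq> 0" "\<bar>Im v\<bar> < Im \<tau>"
  shows "theta1 v \<tau> \<noteq> 0"
proof (cases "Im v > 0")
  case True
  then show ?thesis using theta1_nonzero[OF \<tau>, of v] v by auto
next
  case False
  then have "theta1 (- v) \<tau> \<noteq> 0" using theta1_nonzero[OF \<tau>, of "- v"] v by auto
  then show ?thesis by (simp add: theta1_minus)
qed

text \<open>Heights of a configuration, in units of \<open>W\<close>, that are so small that differences, sums, doubles
  and the total miss all lines carrying zeros of the theta functions.\<close>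
definition sample_height :: "nat \<Rightarrow> nat \<Rightarrow> real" where
  "sample_height N k = real (Suc k) / (4 * (real N + 1)\<^sup>2)"

lemma sample_height:
  assumes "k < N"
  shows "0 < sample_height N k" "sample_height N k < 1 / (4 * (real N + 1))"
proof -
  show "0 < sample_height N k" by (simp add: sample_height_def)
  have "sample_height N k < (real N + 1) / (4 * (real N + 1)\<^sup>2)"
    unfolding sample_height_def using assms by (intro divide_strict_right_mono) auto
  also have "\<dots> = 1 / (4 * (real N + 1))" by (simp add: power2_eq_square)
  finally show "sample_height N k < 1 / (4 * (real N + 1))" .
qed

lemma sample_height_less:
  assumes "k < N"
  shows "sample_height N k < 1 / 4"
proof -
  have "1 / (4 * (real N + 1)) \<le> 1 / 4" by (simp add: field_simps)
  then show ?thesis using sample_height(2)[OF assms] by linarith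
qed

lemma sample_height_inj: "j \<noteq> k \<Longrightarrow> sample_height N j \<noteq> sample_height N k"
  by (simp add: sample_height_def)

lemma sum_sample_height: "0 \<le> (\<Sum>k<N. sample_height N k)" "(\<Sum>k<N. sample_height N k) < 1 / 2"
proof -
  show "0 \<le> (\<Sum>k<N. sample_height N k)" by (intro sum_nonneg) (simp add: sample_height_def)
  have "(\<Sum>k<N. sample_height N k) \<le> (\<Sum>k<N. 1 / (4 * (real N + 1)))"
    by (intro sum_mono less_imp_le sample_height(2)) auto
  also have "\<dots> = real N / (4 * (real N + 1))" by simp
  also have "\<dots> < 1 / 2" by (simp add: field_simps)
  finally show "(\<Sum>k<N. sample_height N k) < 1 / 2" .
qed

definition sample :: "real \<Rightarrow> nat \<Rightarrow> nat \<Rightarrow> complex" where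
  "sample W N k = \<i> * of_real (W * sample_height N k)"

lemma pair_prod_cong:
  assumes "\<And>i. i < N \<Longrightarrow> z i = z' i"
  shows "pair_prod a N z = pair_prod a N z'"
  using assms unfolding pair_prod_def by (intro prod.cong refl) auto

lemma pair_prod_nonzero:
  assumes "\<And>j k. j < k \<Longrightarrow> k < N \<Longrightarrow> a (z k) (z j) \<noteq> 0"
  shows "pair_prod a N z \<noteq> 0"
  using assms by (auto simp: pair_prod_def)

lemma norm_pair_prod: "cmod (pair_prod a N z) = (\<Prod>k<N. \<Prod>j<k. cmod (a (z k) (z j)))"
  by (simp add: pair_prod_def prod_norm)

lemma int_dvd_small:
  fixes d :: int
  assumes "\<bar>d\<bar> < int n"
  shows "int n dvd d \<longleftrightarrow> d = 0"
  using assms dvd_imp_le_int[of d "int n"] by auto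

lemma abs_mult_less_self:
  fixes t d :: real
  assumes "0 < t" "\<bar>d\<bar> < 1"
  shows "\<bar>t * d\<bar> < t"
  using mult_strict_left_mono[OF assms(2,1)] assms(1) by (simp add: abs_mult)

lemma determinantal_A:
  fixes L W :: real and N :: nat
  assumes L: "0 < L" and W: "0 < W" and \<tau>: "\<tau> = \<i> * of_real (W / L)"
  shows "determinantal (Lambda L W) N
       (\<lambda>z. (cmod ((if even N then theta0 else theta1)
                 (\<Sum>k<N. (z k / of_real L - (of_real L + \<i> * of_real W) / (2 * of_real L))) \<tau>))\<^sup>2
             * Q_plasma (Phi_minus L \<tau>) L W N N 2 z)
       (Kern A_type L W \<tau> N)"
proof -
  have Im\<tau>: "Im \<tau> = W / L" by (simp add: \<tau>)
  then have \<tau>0: "Im \<tau> > 0" using L W by simp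
  note [measurable] = borel_measurable_theta1[OF \<tau>0]
  define c where "c = L * W / sqrt (2 * N * (W / L))"
  \<comment> \<open>J(m + 1) - N / 2, the residue class of M_(m + 1) according to
    \<open>theta2_conv_btheta\<close>.\<close>
  define \<rho> where "\<rho> m = real m + 1/2 - real N / 2" for m
  define \<psi> where "\<psi> m = btheta N \<tau> (of_real (\<rho> m))" for m
  define a where "a x y = theta1 ((x - y) / of_real L) \<tau>" for x y
  define S where "S z = (\<Sum>k<N. z k / of_real L)" for z :: "nat \<Rightarrow> complex"
  define F where "F z = btheta 1 \<tau> 0 (S z + half_shift N) * pair_prod a N z" for z
  have a_anti: "a x y = - a y x" for x y
  proof -
    have "(x - y) / of_real L = - ((y - x) / of_real L)" by (simp add: minus_divide_left)
    then show ?thesis unfolding a_def by (simp only: theta1_minus)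
  qed
  obtain C1 where C1: "C1 > 0" "\<And>S. cmod ((if even N then theta0 else theta1) (S - of_nat N * (1 / 2 + \<tau> / 2)) \<tau>)
      = C1 * exp (- pi * N * Im S) * cmod (btheta 1 \<tau> 0 (S + half_shift N))"
    using norm_theta_center_of_mass[OF \<tau>0, of N] by blast
  obtain C2 where C2: "C2 > 0" and Q: "\<And>z. (\<And>i. i < N \<Longrightarrow> z i \<in> Lambda L W) \<Longrightarrow> (\<And>j k. j < k \<Longrightarrow> k < N \<Longrightarrow> theta1 ((z k - z j) / of_real L) \<tau> \<noteq> 0) \<Longrightarrow>
     Q_plasma (Phi_minus L \<tau>) L W N N 2 z
       = C2 * (\<Prod>k<N. \<Prod>j<k. cmod (theta1 ((z k - z j) / of_real L) \<tau>))\<^sup>2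
           * (\<Prod>k<N. exp (- 2 * pi * N / (L * W) * ((Im (z k))\<^sup>2 - W * Im (z k))))"
    using Q_plasma_minus[OF L W \<tau>, of N] by blast
  have center: "(\<Sum>k<N. (z k / of_real L - (of_real L + \<i> * of_real W) / (2 * of_real L))) = S z - of_nat N * (1 / 2 + \<tau> / 2)" for z
  proof -
    have e: "(of_real L + \<i> * of_real W) / (2 * of_real L) = 1 / 2 + \<tau> / 2" using L by (simp add: \<tau> field_simps)
    show ?thesis unfolding S_def e by (simp add: sum_subtractf)
  qed
  show ?thesis
  proof (rule plasma_kernel[OF L W \<tau> _ c_def, where \<psi> = \<psi> and \<mu> = "\<lambda>_. 1" and F = F and C = "C1\<^sup>2 * C2"
        and P = "\<lambda>x y. theta1 ((y - x) / of_real L) \<tau> \<noteq> 0" and Q = "\<lambda>_. True"])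
    show "N = calN A_type N" by simp
  next
    fix m assume m: "m < N"
    then have N: "0 < N" by simp
    show "continuous_on UNIV (\<psi> m)"
      unfolding \<psi>_def using continuous_on_btheta[OF \<tau>0 N continuous_on_id] by simp
    have J: "\<rho> m = Jf A_type (Suc m) - real N / 2" by (simp add: \<rho>_def)
    show "Mf A_type L \<tau> N (Suc m) z = of_real (exp (pi * (W / L) * (Jf A_type (Suc m))\<^sup>2 / N)) * \<psi> m (z / of_real L)" for z
      unfolding Mf_def Let_def root_sys.case calN.simps \<psi>_def by (rule Mf_term(1)[OF N \<tau> J])
    show "hf A_type L W \<tau> N (Suc m) = of_real (1 * c * (exp (pi * (W / L) * (Jf A_type (Suc m))\<^sup>2 / N))\<^sup>2)"
      unfolding hf_def Let_def root_sys.case calN.simps hf_exp[OF \<tau>] Im\<tau> c_def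
      by (simp only: of_real_mult mult_1 of_nat_mult of_nat_numeral)
    show "0 < 1 * c" using L W N by (simp add: c_def)
  next
    fix j k assume jk: "j < N" "k < N"
    have d: "\<rho> j - \<rho> k = of_int (int j - int k)" by (simp add: \<rho>_def)
    have "int N dvd int j - int k \<longleftrightarrow> j = k" using jk by (subst int_dvd_small) auto
    then show "torus_inner N L W (\<psi> j) (\<psi> k)
        = (if j = k then of_real (1 * c) else 0)"
      unfolding \<psi>_def c_def using btheta_inner[OF L W _ \<tau> d, of N] jk by simp
  next
    fix z i assume i: "i < N"
    let ?I = "{..<N} - {i}"
    obtain K where K: "\<And>w. pair_prod a N (z(i := w)) = K * (\<Prod>j\<in>?I. a w (z j))"
      using pair_prod_slot[where a = a, OF a_anti i] by blast
    obtain d where d: "\<And>v. btheta 1 \<tau> 0 (v + (\<Sum>j\<in>?I. z j / of_real L) + half_shift N) * (\<Prod>j\<in>?I. theta1 (v - z j / of_real L) \<tau>)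
      = (\<Sum>r<N. d r * btheta N \<tau> (of_nat (N - 1) * (- 1/2) + of_nat r) v)"
      using minus_slot_span[OF \<tau>0, of ?I N "\<lambda>j. z j / of_real L"] i by auto
    have "F (z(i := w)) = (\<Sum>m<N. (K * d m) * \<psi> m (w / of_real L))" for w
    proof -
      have "S (z(i := w)) = w / of_real L + (\<Sum>j\<in>?I. z j / of_real L)"
        unfolding S_def using i by (subst sum.remove[of _ i]) auto
      then have "F (z(i := w)) = K * (btheta 1 \<tau> 0 (w / of_real L + (\<Sum>j\<in>?I. z j / of_real L) + half_shift N) * (\<Prod>j\<in>?I. theta1 (w / of_real L - z j / of_real L) \<tau>))"
        unfolding F_def K by (simp add: a_def diff_divide_distrib)
      also have "\<dots> = (\<Sum>m<N. (K * d m) * \<psi> m (w / of_real L))"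
        unfolding d sum_distrib_left
      proof (intro sum.cong refl)
        fix r
        \<comment> \<open>The offsets -1/2 of the N - 1 factors theta_1 add up to the residue
          classes of the functions M_j.\<close>
        have "of_nat (N - 1) * (- 1/2) + of_nat r = complex_of_real (\<rho> r)"
          using i by (simp add: \<rho>_def of_nat_diff field_simps)
        then show "K * (d r * btheta N \<tau> (of_nat (N - 1) * (- 1/2) + of_nat r) (w / of_real L)) = (K * d r) * \<psi> r (w / of_real L)"
          unfolding \<psi>_def by (simp only: mult.assoc)
      qed
      finally show ?thesis .
    qed
    then show "\<exists>d. \<forall>w. F (z(i := w)) = (\<Sum>m<N. d m * \<psi> m (w / of_real L))"
      by (intro exI[of _ "\<lambda>m. K * d m"] allI)
  next
    fix z i j assume ij: "i < N" "j < N" "i \<noteq> j"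
    have t: "Transposition.transpose i j permutes {..<N}" using ij by (simp add: permutes_swap_id)
    have "S (z \<circ> Transposition.transpose i j) = S z"
      unfolding S_def by (subst sum.permute[OF t, of "\<lambda>k. z k / of_real L"]) (simp add: o_def)
    then show "F (z \<circ> Transposition.transpose i j) = - F z"
      unfolding F_def by (simp only: pair_prod_antisym[where a = a, OF a_anti ij] mult_minus_right)
  next
    fix z z' :: "nat \<Rightarrow> complex" assume "\<And>i. i < N \<Longrightarrow> z i = z' i"
    then show "F z = F z'"
      unfolding F_def S_def using pair_prod_cong[of N z z' a] by simp
  next
    let ?z = "sample W N"
    have "pair_prod a N ?z \<noteq> 0"
    proof (rule pair_prod_nonzero)
      fix j k assume jk: "j < k" "k < N"
      have "Im ((?z k - ?z j) / of_real L) = (W / L) * (sample_height N k - sample_height N j)"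
        by (simp add: sample_def field_simps)
      moreover have "\<bar>sample_height N k - sample_height N j\<bar> < 1"
        using sample_height(1)[of j N] sample_height(1)[of k N] sample_height_less[of j N] sample_height_less[of k N] jk by auto
      then have "\<bar>(W / L) * (sample_height N k - sample_height N j)\<bar> < W / L"
        using L W by (intro abs_mult_less_self) auto
      ultimately show "a (?z k) (?z j) \<noteq> 0"
        unfolding a_def using L W jk sample_height_inj[of k j N] by (intro theta1_nonzero_near \<tau>0) (auto simp: Im\<tau>)
    qed
    \<comment> \<open>The zeros lie at heights (k + 1/2) Im tau, while the total height of the
      sample is at least 0 and less than Im tau / 2.\<close>
    moreover have "btheta 1 \<tau> 0 (S ?z + half_shift N) \<noteq> 0"
    proof
      assume "btheta 1 \<tau> 0 (S ?z + half_shift N) = 0"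
      then have "jtheta \<tau> (S ?z + half_shift N) = 0" using btheta_conv_jtheta[OF \<tau>0, of 1 0] by simp
      then obtain k :: int where k: "Im (S ?z + half_shift N) = (of_int k + 1/2) * (W / L)"
        using jtheta_eq_0D[OF \<tau>0, of "S ?z + half_shift N"] unfolding Im\<tau> by blast
      have "Im (S ?z + half_shift N) = (\<Sum>k<N. sample_height N k) * (W / L)"
        by (simp add: S_def sample_def half_shift_def flip: sum_distrib_left sum_divide_distrib)
      with k have "(\<Sum>k<N. sample_height N k) = of_int k + 1/2" using L W by simp
      then have k: "- 1/2 \<le> real_of_int k" "real_of_int k < 0" using sum_sample_height[of N] by linarith+
      then have "k \<le> - 1" by simp
      then have "real_of_int k \<le> - 1" by linarith
      then show False using k by linarith
    qed
    ultimately show "F ?z \<noteq> 0" by (simp add: F_def)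
  next
    fix M :: "(nat \<Rightarrow> complex) measure" and g :: "(nat \<Rightarrow> complex) \<Rightarrow> nat \<Rightarrow> complex"
    assume g: "\<And>i. i < N \<Longrightarrow> (\<lambda>\<omega>. g \<omega> i) \<in> borel_measurable M"
    obtain k where k: "\<And>z. z \<in> Lambda L W \<Longrightarrow> V_bg (Phi_minus L \<tau>) L W N z = k + pi * real N / (L * W) * ((Im z)\<^sup>2 - W * Im z)"
      using V_bg_minus[OF L W \<tau>, of N] by blast
    have th: "(\<lambda>v. (if even N then theta0 else theta1) v \<tau>) \<in> borel_measurable borel"
    proof (cases "even N")
      case True
      have "continuous_on UNIV (\<lambda>v. theta0 v \<tau>)"
        unfolding theta0_conv_btheta by (intro continuous_intros \<tau>0) simp
      then show ?thesis using True by (simp add: borel_measurable_continuous_onI)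
    qed simp
    show "(\<lambda>\<omega>. (\<Prod>i<N. indicator (Lambda L W) (g \<omega> i)) * ((cmod ((if even N then theta0 else theta1)
                 (\<Sum>k<N. (g \<omega> k / of_real L - (of_real L + \<i> * of_real W) / (2 * of_real L))) \<tau>))\<^sup>2
             * Q_plasma (Phi_minus L \<tau>) L W N N 2 (g \<omega>))) \<in> borel_measurable M"
    proof (rule Q_plasma_measurable[OF _ k _ g])
      show "(\<lambda>(a, b). Phi_minus L \<tau> a b) \<in> borel_measurable (borel \<Otimes>\<^sub>M borel)"
        unfolding Phi_minus_def by measurable
      show "(\<lambda>z. k + pi * real N / (L * W) * ((Im z)\<^sup>2 - W * Im z)) \<in> borel_measurable borel" by measurable
      have "(\<lambda>\<omega>. \<Sum>k<N. (g \<omega> k / of_real L - (of_real L + \<i> * of_real W) / (2 * of_real L))) \<in> borel_measurable M"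
        using g by (intro borel_measurable_sum borel_measurable_diff borel_measurable_divide borel_measurable_const) auto
      from measurable_compose[OF this th]
      show "(\<lambda>\<omega>. (cmod ((if even N then theta0 else theta1)
                 (\<Sum>k<N. (g \<omega> k / of_real L - (of_real L + \<i> * of_real W) / (2 * of_real L))) \<tau>))\<^sup>2) \<in> borel_measurable M"
        by measurable
    qed
  next
    show "Measurable.pred (borel \<Otimes>\<^sub>M borel) (\<lambda>(x, y). theta1 ((y - x) / of_real L) \<tau> \<noteq> 0)" by measurable
    show "AE y in lborel. theta1 ((y - x) / of_real L) \<tau> \<noteq> 0" for x
      using AE_theta1_nonzero[OF L W \<tau>, of 1 "- x"] by simp
  next
    fix z assume z: "\<And>i. i < N \<Longrightarrow> z i \<in> Lambda L W \<and> True"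
      and nz: "\<And>j k. j < k \<Longrightarrow> k < N \<Longrightarrow> theta1 ((z k - z j) / of_real L) \<tau> \<noteq> 0"
    let ?B = "cmod (btheta 1 \<tau> 0 (S z + half_shift N))" and ?T = "\<Prod>k<N. \<Prod>j<k. cmod (theta1 ((z k - z j) / of_real L) \<tau>)"
    have "Im (S z) = (\<Sum>k<N. Im (z k) / L)" by (simp add: S_def)
    then have "(exp (- pi * N * Im (S z)))\<^sup>2 = exp (\<Sum>k<N. - 2 * pi * N * Im (z k) / L)"
      by (simp add: sum_distrib_left sum_negf mult_ac flip: exp_double)
    also have "\<dots> = (\<Prod>k<N. exp (- 2 * pi * N * Im (z k) / L))" by (rule exp_sum) simp
    finally have E: "(exp (- pi * N * Im (S z)))\<^sup>2 = (\<Prod>k<N. exp (- 2 * pi * N * Im (z k) / L))" .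
    \<comment> \<open>The exponential from the centre of mass cancels the part of the background
      weight that is linear in Im z.\<close>
    have G: "(\<Prod>k<N. exp (- 2 * pi * N * Im (z k) / L)) * (\<Prod>k<N. exp (- 2 * pi * N / (L * W) * ((Im (z k))\<^sup>2 - W * Im (z k))))
        = (\<Prod>k<N. exp (- pi * N * (Im (z k))\<^sup>2 / (L * W)))\<^sup>2"
      unfolding prod.distrib[symmetric] prod_power_distrib
    proof (intro prod.cong refl)
      fix k
      have "- 2 * pi * N * Im (z k) / L + - 2 * pi * N / (L * W) * ((Im (z k))\<^sup>2 - W * Im (z k)) = 2 * (- pi * N * (Im (z k))\<^sup>2 / (L * W))"
        using L W by (simp add: field_simps)
      then show "exp (- 2 * pi * N * Im (z k) / L) * exp (- 2 * pi * N / (L * W) * ((Im (z k))\<^sup>2 - W * Im (z k))) = (exp (- pi * N * (Im (z k))\<^sup>2 / (L * W)))\<^sup>2"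
        by (simp only: exp_add[symmetric] exp_double[symmetric])
    qed
    have "(cmod ((if even N then theta0 else theta1)
                 (\<Sum>k<N. (z k / of_real L - (of_real L + \<i> * of_real W) / (2 * of_real L))) \<tau>))\<^sup>2
             * Q_plasma (Phi_minus L \<tau>) L W N N 2 z
        = (C1 * exp (- pi * N * Im (S z)) * ?B)\<^sup>2 * (C2 * ?T\<^sup>2 * (\<Prod>k<N. exp (- 2 * pi * N / (L * W) * ((Im (z k))\<^sup>2 - W * Im (z k)))))"
      unfolding center C1(2) by (subst Q) (use z nz in auto)
    also have "\<dots> = C1\<^sup>2 * C2 * (((exp (- pi * N * Im (S z)))\<^sup>2 * (\<Prod>k<N. exp (- 2 * pi * N / (L * W) * ((Im (z k))\<^sup>2 - W * Im (z k))))) * (?B * ?T)\<^sup>2)"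
      by (simp only: power_mult_distrib mult_ac)
    also have "\<dots> = C1\<^sup>2 * C2 * ((\<Prod>k<N. exp (- pi * N * (Im (z k))\<^sup>2 / (L * W))) * (?B * ?T))\<^sup>2"
      unfolding E G by (simp only: power_mult_distrib)
    also have "?B * ?T = cmod (F z)" by (simp only: F_def norm_mult norm_pair_prod a_def)
    finally show "(cmod ((if even N then theta0 else theta1)
                 (\<Sum>k<N. (z k / of_real L - (of_real L + \<i> * of_real W) / (2 * of_real L))) \<tau>))\<^sup>2
             * Q_plasma (Phi_minus L \<tau>) L W N N 2 z
        = C1\<^sup>2 * C2 * ((\<Prod>i<N. exp (- pi * real N * (Im (z i))\<^sup>2 / (L * W))) * cmod (F z))\<^sup>2" .
  qed (use C1 C2 in auto)
qed

text \<open>Types C and D at once: E is theta_1(2 v), which is odd, or 1, which is even. Its squared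
  modulus carries the single-point factor of the weight, and its parity \<epsilon> selects
  antisymmetric or symmetric combinations of \<open>btheta\<close>. The relation n = 2 Nm makes the
  Gaussian of the potential that of the kernel.\<close>

lemma determinantal_pm:
  fixes L W \<epsilon> :: real and N Nm n :: nat and E :: "complex \<Rightarrow> complex"
  assumes L: "0 < L" and W: "0 < W" and \<tau>: "\<tau> = \<i> * of_real (W / L)"
    and n: "n = calN R N" "n = 2 * Nm" "0 < n"
    and c: "c = L * W / sqrt (2 * n * (W / L))"
    and \<epsilon>: "\<epsilon> * \<epsilon> = 1"
    and \<psi>: "\<And>m v. \<psi> m v = btheta n \<tau> (of_real (\<rho> m)) v + of_real \<epsilon> * btheta n \<tau> (of_real (- \<rho> m)) v"
    and M: "\<And>m z. m < N \<Longrightarrow> Mf R L \<tau> N (Suc m) z = of_real (exp (pi * (W / L) * (Jf R (Suc m))\<^sup>2 / n)) * \<psi> m (z / of_real L)"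
    and h: "\<And>m. m < N \<Longrightarrow> hf R L W \<tau> N (Suc m) = of_real (\<mu> m * c * (exp (pi * (W / L) * (Jf R (Suc m))\<^sup>2 / n))\<^sup>2)"
    and \<mu>: "\<And>m. m < N \<Longrightarrow> 0 < \<mu> m"
    and inner: "\<And>j k. j < N \<Longrightarrow> k < N \<Longrightarrow> torus_inner n L W (\<psi> j) (\<psi> k) = (if j = k then of_real (\<mu> j * c) else 0)"
    and E_weight: "\<And>v. theta1 (2 * v) \<tau> \<noteq> 0 \<Longrightarrow> exp ((real Nm - real N + 1) * ln (cmod (theta1 (2 * v) \<tau>))) = (cmod (E v))\<^sup>2"
    and E_parity: "\<And>v. E (- v) = of_real \<epsilon> * E v"
    and E_nz: "\<And>v. 0 < Im v \<Longrightarrow> Im v < Im \<tau> / 2 \<Longrightarrow> E v \<noteq> 0"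
    and E_slot: "\<And>(I :: nat set) a. finite I \<Longrightarrow> Suc (card I) = N \<Longrightarrow>
       \<exists>d. \<forall>v. E v * (\<Prod>j\<in>I. theta1 (v + a j) \<tau> * theta1 (v - a j) \<tau>) = (\<Sum>r<n. d r * btheta n \<tau> (of_nat r) v)"
    and \<psi>_span: "\<And>r. r < n \<Longrightarrow> \<exists>c. \<forall>v. btheta n \<tau> (of_nat r) v + of_real \<epsilon> * btheta n \<tau> (- of_nat r) v = (\<Sum>m<N. c m * \<psi> m v)"
  shows "determinantal (Lambda L W) N (Q_plasma (Phi_pm L \<tau>) L W N Nm 2) (Kern R L W \<tau> N)"
proof -
  have Im\<tau>: "Im \<tau> = W / L" by (simp add: \<tau>)
  then have \<tau>0: "Im \<tau> > 0" using L W by simp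
  note [measurable] = borel_measurable_theta1[OF \<tau>0]
  define a where "a x y = theta1 ((x + y) / of_real L) \<tau> * theta1 ((x - y) / of_real L) \<tau>" for x y
  define F where "F z = (\<Prod>k<N. E (z k / of_real L)) * pair_prod a N z" for z
  have a_anti: "a x y = - a y x" for x y
  proof -
    have "(x - y) / of_real L = - ((y - x) / of_real L)" by (simp add: minus_divide_left)
    then show ?thesis unfolding a_def by (simp only: theta1_minus mult_minus_right add.commute)
  qed
  obtain C where C: "C > 0" and Q: "\<And>z. (\<And>i. i < N \<Longrightarrow> z i \<in> Lambda L W) \<Longrightarrow> (\<And>j k. j < k \<Longrightarrow> k < N \<Longrightarrow>
        theta1 ((z k + z j) / of_real L) \<tau> \<noteq> 0 \<and> theta1 ((z k - z j) / of_real L) \<tau> \<noteq> 0) \<Longrightarrow>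
     Q_plasma (Phi_pm L \<tau>) L W N Nm 2 z
       = C * (\<Prod>k<N. \<Prod>j<k. cmod (theta1 ((z k + z j) / of_real L) \<tau> * theta1 ((z k - z j) / of_real L) \<tau>))\<^sup>2
           * (\<Prod>k<N. exp (- 4 * pi * Nm / (L * W) * (Im (z k))\<^sup>2))
           * exp ((real Nm - real N + 1) * (\<Sum>k<N. ln (cmod (theta1 (2 * z k / of_real L) \<tau>))))"
    using Q_plasma_pm[OF L W \<tau>, of N Nm] by blast
  show ?thesis
  proof (rule plasma_kernel[OF L W \<tau> n(1) c _ M h _ inner, where F = F and C = C
        and P = "\<lambda>x y. theta1 ((y + x) / of_real L) \<tau> \<noteq> 0 \<and> theta1 ((y - x) / of_real L) \<tau> \<noteq> 0" and Q = "\<lambda>x. theta1 (2 * x / of_real L) \<tau> \<noteq> 0"])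
    fix m assume m: "m < N"
    have "continuous_on UNIV (\<lambda>v. btheta n \<tau> (of_real (\<rho> m)) v + of_real \<epsilon> * btheta n \<tau> (of_real (- \<rho> m)) v)"
      by (intro continuous_intros \<tau>0 n(3))
    then show "continuous_on UNIV (\<psi> m)" by (simp only: \<psi>[symmetric])
    show "0 < \<mu> m * c" using \<mu>[OF m] L W n(3) by (simp add: c)
  next
    fix z i assume i: "i < N"
    let ?I = "{..<N} - {i}"
    obtain K where K: "\<And>w. pair_prod a N (z(i := w)) = K * (\<Prod>j\<in>?I. a w (z j))"
      using pair_prod_slot[where a = a, OF a_anti i] by blast
    define f where "f v = E v * (\<Prod>j\<in>?I. theta1 (v + z j / of_real L) \<tau> * theta1 (v - z j / of_real L) \<tau>)" for v
    obtain d where d: "\<And>v. f v = (\<Sum>r<n. d r * btheta n \<tau> (of_nat r) v)"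
      using E_slot[of ?I "\<lambda>j. z j / of_real L"] i unfolding f_def by auto
    \<comment> \<open>The pair factors are even in v, so f has the parity of E.\<close>
    have "f (- v) = of_real \<epsilon> * f v" for v
    proof -
      have "theta1 (- v + b) \<tau> * theta1 (- v - b) \<tau> = theta1 (v + b) \<tau> * theta1 (v - b) \<tau>" for b
      proof -
        have e: "- v + b = - (v - b)" "- v - b = - (v + b)" by simp_all
        show ?thesis unfolding e theta1_minus by simp
      qed
      then show ?thesis unfolding f_def E_parity by (simp only: mult.assoc)
    qed
    then obtain e where e: "\<And>v. f v = (\<Sum>m<N. e m * \<psi> m v)"
      using parity_span[OF d _ \<epsilon> \<psi>_span] by blast
    define K' where "K' = (\<Prod>j\<in>?I. E (z j / of_real L)) * K"
    have "F (z(i := w)) = (\<Sum>m<N. (K' * e m) * \<psi> m (w / of_real L))" for w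
    proof -
      have "(\<Prod>k<N. E ((z(i := w)) k / of_real L)) = E (w / of_real L) * (\<Prod>j\<in>?I. E (z j / of_real L))"
        using i by (subst prod.remove[of _ i]) auto
      then have "F (z(i := w)) = K' * f (w / of_real L)"
        unfolding F_def K K'_def f_def a_def by (simp add: diff_divide_distrib add_divide_distrib)
      then show ?thesis unfolding e by (simp only: sum_distrib_left mult.assoc)
    qed
    then show "\<exists>d. \<forall>w. F (z(i := w)) = (\<Sum>m<N. d m * \<psi> m (w / of_real L))"
      by (intro exI[of _ "\<lambda>m. K' * e m"] allI)
  next
    fix z i j assume ij: "i < N" "j < N" "i \<noteq> j"
    have t: "Transposition.transpose i j permutes {..<N}" using ij by (simp add: permutes_swap_id)
    have "(\<Prod>k<N. E ((z \<circ> Transposition.transpose i j) k / of_real L)) = (\<Prod>k<N. E (z k / of_real L))"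
      by (subst prod.permute[OF t, of "\<lambda>k. E (z k / of_real L)"]) (simp add: o_def)
    then show "F (z \<circ> Transposition.transpose i j) = - F z"
      unfolding F_def by (simp only: pair_prod_antisym[where a = a, OF a_anti ij] mult_minus_right)
  next
    fix z z' :: "nat \<Rightarrow> complex" assume "\<And>i. i < N \<Longrightarrow> z i = z' i"
    then show "F z = F z'"
      unfolding F_def using pair_prod_cong[of N z z' a] by simp
  next
    let ?z = "sample W N"
    have "pair_prod a N ?z \<noteq> 0"
    proof (rule pair_prod_nonzero)
      fix j k assume jk: "j < k" "k < N"
      have 1: "Im ((?z k - ?z j) / of_real L) = (W / L) * (sample_height N k - sample_height N j)"
        "Im ((?z k + ?z j) / of_real L) = (W / L) * (sample_height N k + sample_height N j)"
        by (simp_all add: sample_def field_simps)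
      have b: "\<bar>sample_height N k - sample_height N j\<bar> < 1" "\<bar>sample_height N k + sample_height N j\<bar> < 1"
        "sample_height N k + sample_height N j \<noteq> 0"
        using sample_height(1)[of j N] sample_height(1)[of k N] sample_height_less[of j N] sample_height_less[of k N] jk by auto
      have t: "0 < W / L" using L W by simp
      have "theta1 ((?z k + ?z j) / of_real L) \<tau> \<noteq> 0"
      proof (rule theta1_nonzero_near[OF \<tau>0])
        show "Im ((?z k + ?z j) / of_real L) \<noteq> 0" unfolding 1 using L W b(3) by simp
        show "\<bar>Im ((?z k + ?z j) / of_real L)\<bar> < Im \<tau>" unfolding 1 Im\<tau> by (rule abs_mult_less_self[OF t b(2)])
      qed
      moreover have "theta1 ((?z k - ?z j) / of_real L) \<tau> \<noteq> 0"
      proof (rule theta1_nonzero_near[OF \<tau>0])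
        show "Im ((?z k - ?z j) / of_real L) \<noteq> 0" unfolding 1 using L W sample_height_inj[of k j N] jk by simp
        show "\<bar>Im ((?z k - ?z j) / of_real L)\<bar> < Im \<tau>" unfolding 1 Im\<tau> by (rule abs_mult_less_self[OF t b(1)])
      qed
      ultimately show "a (?z k) (?z j) \<noteq> 0" by (simp add: a_def)
    qed
    moreover have "E (?z k / of_real L) \<noteq> 0" if "k < N" for k
    proof -
      have "Im (?z k / of_real L) = W / L * sample_height N k" by (simp add: sample_def)
      moreover have "W / L * sample_height N k < W / L * (1 / 2)"
        using L W sample_height_less[OF that] by (intro mult_strict_left_mono) auto
      ultimately show ?thesis
        using L W sample_height(1)[OF that] by (intro E_nz) (simp_all add: Im\<tau>)
    qed
    ultimately show "F ?z \<noteq> 0" by (simp add: F_def)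
  next
    fix M :: "(nat \<Rightarrow> complex) measure" and g :: "(nat \<Rightarrow> complex) \<Rightarrow> nat \<Rightarrow> complex"
    assume g: "\<And>i. i < N \<Longrightarrow> (\<lambda>\<omega>. g \<omega> i) \<in> borel_measurable M"
    obtain k where k: "\<And>z. z \<in> Lambda L W \<Longrightarrow> V_bg (Phi_pm L \<tau>) L W Nm z = k + 2 * pi * real Nm / (L * W) * (Im z)\<^sup>2 - real Nm / 2 * ln (cmod (theta1 (2 * z / of_real L) \<tau>))"
      using V_bg_pm[OF L W \<tau>, of Nm] by blast
    have "(\<lambda>\<omega>. (\<Prod>i<N. indicator (Lambda L W) (g \<omega> i)) * (1 * Q_plasma (Phi_pm L \<tau>) L W N Nm 2 (g \<omega>)) :: real) \<in> borel_measurable M"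
    proof (rule Q_plasma_measurable[OF _ k _ g, where h = "\<lambda>_. 1"])
      show "(\<lambda>(a, b). Phi_pm L \<tau> a b) \<in> borel_measurable (borel \<Otimes>\<^sub>M borel)"
        unfolding Phi_pm_def by measurable
      show "(\<lambda>z. k + 2 * pi * real Nm / (L * W) * (Im z)\<^sup>2 - real Nm / 2 * ln (cmod (theta1 (2 * z / of_real L) \<tau>))) \<in> borel_measurable borel" by measurable
    qed simp_all
    then show "(\<lambda>\<omega>. (\<Prod>i<N. indicator (Lambda L W) (g \<omega> i)) * Q_plasma (Phi_pm L \<tau>) L W N Nm 2 (g \<omega>)) \<in> borel_measurable M" by simp
  next
    show "Measurable.pred (borel \<Otimes>\<^sub>M borel) (\<lambda>(x, y). theta1 ((y + x) / of_real L) \<tau> \<noteq> 0 \<and> theta1 ((y - x) / of_real L) \<tau> \<noteq> 0)" by measurable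
    show "AE y in lborel. theta1 ((y + x) / of_real L) \<tau> \<noteq> 0 \<and> theta1 ((y - x) / of_real L) \<tau> \<noteq> 0" for x
      using AE_theta1_nonzero[OF L W \<tau> one_neq_zero, of "- x"] AE_theta1_nonzero[OF L W \<tau> one_neq_zero, of x]
      by eventually_elim (simp add: add.commute)
    show "Measurable.pred borel (\<lambda>x. theta1 (2 * x / of_real L) \<tau> \<noteq> 0)" by measurable
    show "AE x in lborel. theta1 (2 * x / of_real L) \<tau> \<noteq> 0"
      using AE_theta1_nonzero[OF L W \<tau>, of 2 0] by simp
  next
    fix z assume z: "\<And>i. i < N \<Longrightarrow> z i \<in> Lambda L W \<and> theta1 (2 * z i / of_real L) \<tau> \<noteq> 0"
      and nz: "\<And>j k. j < k \<Longrightarrow> k < N \<Longrightarrow> theta1 ((z k + z j) / of_real L) \<tau> \<noteq> 0 \<and> theta1 ((z k - z j) / of_real L) \<tau> \<noteq> 0"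
    let ?T = "\<Prod>k<N. \<Prod>j<k. cmod (theta1 ((z k + z j) / of_real L) \<tau> * theta1 ((z k - z j) / of_real L) \<tau>)"
    have G: "(\<Prod>k<N. exp (- 4 * pi * Nm / (L * W) * (Im (z k))\<^sup>2)) = (\<Prod>k<N. exp (- pi * n * (Im (z k))\<^sup>2 / (L * W)))\<^sup>2"
      unfolding prod_power_distrib by (intro prod.cong refl) (simp add: n(2) flip: exp_double)
    have "exp ((real Nm - real N + 1) * (\<Sum>k<N. ln (cmod (theta1 (2 * z k / of_real L) \<tau>))))
        = (\<Prod>k<N. exp ((real Nm - real N + 1) * ln (cmod (theta1 (2 * z k / of_real L) \<tau>))))"
      unfolding sum_distrib_left by (rule exp_sum) simp
    also have "\<dots> = (\<Prod>k<N. cmod (E (z k / of_real L)))\<^sup>2"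
      unfolding prod_power_distrib
    proof (intro prod.cong refl)
      fix k assume "k \<in> {..<N}"
      then show "exp ((real Nm - real N + 1) * ln (cmod (theta1 (2 * z k / of_real L) \<tau>))) = (cmod (E (z k / of_real L)))\<^sup>2"
        using E_weight[of "z k / of_real L"] z[of k] by simp
    qed
    finally have H: "exp ((real Nm - real N + 1) * (\<Sum>k<N. ln (cmod (theta1 (2 * z k / of_real L) \<tau>)))) = (\<Prod>k<N. cmod (E (z k / of_real L)))\<^sup>2" .
    have "Q_plasma (Phi_pm L \<tau>) L W N Nm 2 z = C * ?T\<^sup>2 * (\<Prod>k<N. exp (- pi * n * (Im (z k))\<^sup>2 / (L * W)))\<^sup>2 * (\<Prod>k<N. cmod (E (z k / of_real L)))\<^sup>2"
      unfolding G[symmetric] H[symmetric] by (rule Q) (use z nz in auto)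
    also have "\<dots> = C * ((\<Prod>k<N. exp (- pi * n * (Im (z k))\<^sup>2 / (L * W))) * ((\<Prod>k<N. cmod (E (z k / of_real L))) * ?T))\<^sup>2"
      by (simp only: power_mult_distrib mult_ac)
    also have "(\<Prod>k<N. cmod (E (z k / of_real L))) * ?T = cmod (F z)"
      by (simp only: F_def norm_mult norm_pair_prod a_def prod_norm)
    finally show "Q_plasma (Phi_pm L \<tau>) L W N Nm 2 z = C * ((\<Prod>i<N. exp (- pi * real n * (Im (z i))\<^sup>2 / (L * W))) * cmod (F z))\<^sup>2" .
  qed (use C in auto)
qed

lemma btheta_real_diff: "btheta n \<tau> (of_real (real r - real n)) v = btheta n \<tau> (of_nat r) v"
  using btheta_add_period[of n \<tau> "of_real (real r - real n)" v] by simp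

lemma determinantal_C:
  fixes L W :: real and N :: nat
  assumes L: "0 < L" and W: "0 < W" and \<tau>: "\<tau> = \<i> * of_real (W / L)"
  shows "determinantal (Lambda L W) N (Q_plasma (Phi_pm L \<tau>) L W N (N + 1) 2) (Kern C_type L W \<tau> N)"
proof -
  have Im\<tau>: "Im \<tau> = W / L" by (simp add: \<tau>)
  then have \<tau>0: "Im \<tau> > 0" using L W by simp
  define n where "n = 2 * (N + 1)"
  have n: "0 < n" by (simp add: n_def)
  define c where "c = L * W / sqrt (2 * n * (W / L))"
  \<comment> \<open>J(m + 1) - n / 2 with n / 2 = N + 1. These run from -N to -1, one representative
    for each pair of distinct opposite classes modulo n.\<close>
  define \<rho> where "\<rho> m = real m - real N" for m
  define \<psi> where "\<psi> m v = btheta n \<tau> (of_real (\<rho> m)) v + of_real (- 1) * btheta n \<tau> (of_real (- \<rho> m)) v" for m v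
  show ?thesis
  proof (rule determinantal_pm[OF L W \<tau> _ _ n c_def _ \<psi>_def, where \<mu> = "\<lambda>_. 2" and E = "\<lambda>v. theta1 (2 * v) \<tau>"])
    show "n = calN C_type N" "n = 2 * (N + 1)" by (simp_all add: n_def)
  next
    fix m assume m: "m < N"
    have J: "\<rho> m = Jf C_type (Suc m) - real n / 2" by (simp add: \<rho>_def n_def field_simps)
    have cn: "calN C_type N = n" by (simp add: n_def)
    show "Mf C_type L \<tau> N (Suc m) z = of_real (exp (pi * (W / L) * (Jf C_type (Suc m))\<^sup>2 / n)) * \<psi> m (z / of_real L)" for z
      unfolding Mf_def Let_def root_sys.case cn \<psi>_def Mf_term[OF n \<tau> J] by (simp add: right_diff_distrib)
    show "hf C_type L W \<tau> N (Suc m) = of_real (2 * c * (exp (pi * (W / L) * (Jf C_type (Suc m))\<^sup>2 / n))\<^sup>2)"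
      unfolding hf_def Let_def root_sys.case cn hf_exp[OF \<tau>] Im\<tau> c_def by (simp only: of_real_mult of_real_numeral of_nat_mult of_nat_numeral)
  next
    fix j k assume jk: "j < N" "k < N"
    have d: "\<rho> j - \<rho> k = of_int (int j - int k)" and s: "\<rho> j + \<rho> k = of_int (int j + int k - 2 * int N)"
      by (simp_all add: \<rho>_def)
    have 1: "int n dvd int j - int k \<longleftrightarrow> j = k"
      using jk by (subst int_dvd_small) (auto simp: n_def)
    \<comment> \<open>The sum of two values of \<rho> lies strictly between -n and 0, so mixed modes
      never resonate and all norms are 2 c.\<close>
    have 2: "\<not> int n dvd int j + int k - 2 * int N"
      using jk by (subst int_dvd_small) (auto simp: n_def)
    have "(- 1) * (- 1) = (1::real)" by simp
    from btheta_pm_inner[OF L W n \<tau> d s this]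
    show "torus_inner n L W (\<psi> j) (\<psi> k)
        = (if j = k then of_real (2 * c) else 0)"
      unfolding \<psi>_def c_def 1 using 2 by simp
  next
    fix v assume "theta1 (2 * v) \<tau> \<noteq> 0"
    then show "exp ((real (N + 1) - real N + 1) * ln (cmod (theta1 (2 * v) \<tau>))) = (cmod (theta1 (2 * v) \<tau>))\<^sup>2"
      by (simp add: exp_double)
  next
    show "theta1 (2 * - v) \<tau> = of_real (- 1) * theta1 (2 * v) \<tau>" for v
      using theta1_minus[of "2 * v" \<tau>] by simp
    show "theta1 (2 * v) \<tau> \<noteq> 0" if "0 < Im v" "Im v < Im \<tau> / 2" for v
      using that by (intro theta1_nonzero \<tau>0) auto
  next
    fix I :: "nat set" and a assume I: "finite I" "Suc (card I) = N"
    have "2 * card I + 4 = n" using I by (simp add: n_def)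
    with C_slot_span[OF \<tau>0 I(1), of a]
    show "\<exists>d. \<forall>v. theta1 (2 * v) \<tau> * (\<Prod>j\<in>I. theta1 (v + a j) \<tau> * theta1 (v - a j) \<tau>) = (\<Sum>r<n. d r * btheta n \<tau> (of_nat r) v)"
      by simp
  next
    fix r assume r: "r < n"
    let ?f = "\<lambda>v. btheta n \<tau> (of_nat r) v + of_real (- 1) * btheta n \<tau> (- of_nat r) v"
    \<comment> \<open>The classes 0 and N + 1 are their own negatives and antisymmetrise to 0; the
      remaining 2 N classes form N pairs.\<close>
    consider "r = 0 \<or> r = N + 1" | "1 \<le> r" "r \<le> N" | "N + 2 \<le> r" by linarith
    then show "\<exists>d. \<forall>v. ?f v = (\<Sum>m<N. d m * \<psi> m v)"
    proof cases
      case 1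
      have "btheta n \<tau> (- of_nat r) v = btheta n \<tau> (of_nat r) v" for v
      proof (cases "r = 0")
        case False
        then have e: "- of_nat r + of_nat n = (of_nat r :: complex)" using 1 by (simp add: n_def)
        show ?thesis using btheta_add_period[of n \<tau> "- of_nat r" v] unfolding e by simp
      qed simp
      then show ?thesis by (intro exI[of _ "\<lambda>_. 0"]) simp
    next
      case 2
      have "\<rho> (N - r) = - real r" using 2 by (simp add: \<rho>_def of_nat_diff)
      then have "?f v = - 1 * \<psi> (N - r) v" for v by (simp add: \<psi>_def)
      then show ?thesis using 2 by (intro span_single[where m = "N - r" and a = "- 1"]) auto
    next
      case 3
      have \<rho>: "\<rho> (r - N - 2) = real r - real n" using 3 by (simp add: \<rho>_def n_def of_nat_diff)
      have "btheta n \<tau> (of_real (- \<rho> (r - N - 2))) v = btheta n \<tau> (- of_nat r) v" for v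
        using btheta_real_diff[of n \<tau> r "- v"] unfolding btheta_minus \<rho> by simp
      then have "?f v = 1 * \<psi> (r - N - 2) v" for v
        unfolding \<psi>_def by (simp only: \<rho> btheta_real_diff mult_1)
      then show ?thesis using 3 r by (intro span_single[where m = "r - N - 2" and a = 1]) (auto simp: n_def)
    qed
  qed simp_all
qed

lemma determinantal_D:
  fixes L W :: real and N :: nat
  assumes L: "0 < L" and W: "0 < W" and \<tau>: "\<tau> = \<i> * of_real (W / L)" and N: "2 \<le> N"
  shows "determinantal (Lambda L W) N (Q_plasma (Phi_pm L \<tau>) L W N (N - 1) 2) (Kern D_type L W \<tau> N)"
proof -
  have Im\<tau>: "Im \<tau> = W / L" by (simp add: \<tau>)
  then have \<tau>0: "Im \<tau> > 0" using L W by simp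
  define n where "n = 2 * (N - 1)"
  have n: "0 < n" using N by (simp add: n_def)
  have rn: "real n = 2 * real N - 2" using N by (simp add: n_def of_nat_diff)
  have intn: "int n = 2 * int N - 2" using N by (simp add: n_def of_nat_diff)
  define c where "c = L * W / sqrt (2 * n * (W / L))"
  \<comment> \<open>J(m + 1) - n / 2 with n / 2 = N - 1, running from -(N - 1) to 0.\<close>
  define \<rho> where "\<rho> m = real m - (real N - 1)" for m
  define \<psi> where "\<psi> m v = btheta n \<tau> (of_real (\<rho> m)) v + of_real 1 * btheta n \<tau> (of_real (- \<rho> m)) v" for m v
  \<comment> \<open>At both ends \<rho> and -\<rho> are the same class modulo n, so the two terms of
    \<open>\<psi>\<close> coincide and the squared norm is 4 c instead of 2 c.\<close>
  define \<mu> where "\<mu> m = (if Suc m = 1 \<or> Suc m = N then 4 else 2 :: real)" for m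
  show ?thesis
  proof (rule determinantal_pm[OF L W \<tau> _ _ n c_def _ \<psi>_def, where \<mu> = \<mu> and E = "\<lambda>v. 1"])
    show "n = calN D_type N" "n = 2 * (N - 1)" by (simp_all add: n_def)
  next
    fix m assume m: "m < N"
    have J: "\<rho> m = Jf D_type (Suc m) - real n / 2" by (simp add: \<rho>_def rn field_simps)
    have cn: "calN D_type N = n" by (simp add: n_def)
    show "Mf D_type L \<tau> N (Suc m) z = of_real (exp (pi * (W / L) * (Jf D_type (Suc m))\<^sup>2 / n)) * \<psi> m (z / of_real L)" for z
      unfolding Mf_def Let_def root_sys.case cn \<psi>_def Mf_term[OF n \<tau> J] by (simp add: distrib_left)
    show "hf D_type L W \<tau> N (Suc m) = of_real (\<mu> m * c * (exp (pi * (W / L) * (Jf D_type (Suc m))\<^sup>2 / n))\<^sup>2)"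
      unfolding hf_def Let_def root_sys.case cn hf_exp[OF \<tau>] Im\<tau> c_def \<mu>_def
      by (cases "Suc m = 1 \<or> Suc m = N") (simp_all only: if_True if_False of_real_mult of_real_numeral of_nat_mult of_nat_numeral)
    show "0 < \<mu> m" by (simp add: \<mu>_def)
  next
    fix j k assume jk: "j < N" "k < N"
    have d: "\<rho> j - \<rho> k = of_int (int j - int k)" and s: "\<rho> j + \<rho> k = of_int (int j + int k - int n)"
      by (simp_all add: \<rho>_def rn intn)
    have 1: "int n dvd int j - int k \<longleftrightarrow> j = k"
      using jk N by (subst int_dvd_small) (auto simp: intn)
    have 2: "int n dvd int j + int k - int n \<longleftrightarrow> (j = k \<and> (Suc j = 1 \<or> Suc j = N))"
    \<comment> \<open>For j = k = 0 the two classes add up to -n, a multiple of n that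
      \<open>int_dvd_small\<close> does not reach.\<close>
    proof (cases "j + k = 0")
      case False
      then have "int n dvd int j + int k - int n \<longleftrightarrow> int j + int k - int n = 0"
        using jk N by (intro int_dvd_small) (auto simp: intn)
      then show ?thesis using jk N False by (auto simp: intn)
    qed simp
    have "1 * 1 = (1::real)" by simp
    from btheta_pm_inner[OF L W n \<tau> d s this]
    show "torus_inner n L W (\<psi> j) (\<psi> k)
        = (if j = k then of_real (\<mu> j * c) else 0)"
      unfolding \<psi>_def c_def 1 2 \<mu>_def by auto
  next
    show "exp ((real (N - 1) - real N + 1) * ln (cmod (theta1 (2 * v) \<tau>))) = (cmod 1)\<^sup>2" for v
      using N by (simp add: of_nat_diff)
  next
    fix I :: "nat set" and a assume I: "finite I" "Suc (card I) = N"
    then have "2 * card I = n" "0 < card I" using N by (simp_all add: n_def flip: I(2))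
    with D_slot_span[OF \<tau>0 I(1), of a]
    show "\<exists>d. \<forall>v. 1 * (\<Prod>j\<in>I. theta1 (v + a j) \<tau> * theta1 (v - a j) \<tau>) = (\<Sum>r<n. d r * btheta n \<tau> (of_nat r) v)"
      by simp
  next
    fix r assume r: "r < n"
    let ?f = "\<lambda>v. btheta n \<tau> (of_nat r) v + of_real 1 * btheta n \<tau> (- of_nat r) v"
    show "\<exists>d. \<forall>v. ?f v = (\<Sum>m<N. d m * \<psi> m v)"
    \<comment> \<open>The self-opposite classes 0 and N - 1 survive symmetrisation, and the other 2
      N - 4 classes form N - 2 pairs: N functions in all.\<close>
    proof (cases "r < N")
      case True
      have "\<rho> (N - 1 - r) = - real r" using True by (simp add: \<rho>_def of_nat_diff)
      then have "?f v = 1 * \<psi> (N - 1 - r) v" for v by (simp add: \<psi>_def add.commute)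
      then show ?thesis using True by (intro span_single[where m = "N - 1 - r" and a = 1]) auto
    next
      case False
      have \<rho>: "\<rho> (r - (N - 1)) = real r - real n" using False N by (simp add: \<rho>_def rn of_nat_diff)
      have "btheta n \<tau> (of_real (- \<rho> (r - (N - 1)))) v = btheta n \<tau> (- of_nat r) v" for v
        using btheta_real_diff[of n \<tau> r "- v"] unfolding btheta_minus \<rho> by simp
      then have "?f v = 1 * \<psi> (r - (N - 1)) v" for v
        unfolding \<psi>_def by (simp only: \<rho> btheta_real_diff mult_1)
      then show ?thesis using False r by (intro span_single[where m = "r - (N - 1)" and a = 1]) (auto simp: n_def)
    qed
  qed simp_all
qed

theorem theorem4p2:
  fixes L W :: real and N :: nat
  assumes "0 < L" and "0 < W"
  defines "\<tau> \<equiv> \<i> * of_real (W / L)"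
  shows
    "determinantal (Lambda L W) N
       (\<lambda>z. (cmod ((if even N then theta0 else theta1)
                 (\<Sum>k<N. (z k / of_real L - (of_real L + \<i> * of_real W) / (2 * of_real L))) \<tau>))\<^sup>2
             * Q_plasma (Phi_minus L \<tau>) L W N N 2 z)
       (Kern A_type L W \<tau> N)
   \<and> determinantal (Lambda L W) N (Q_plasma (Phi_pm L \<tau>) L W N (N + 1) 2) (Kern C_type L W \<tau> N)
   \<and> (2 \<le> N \<longrightarrow>
       determinantal (Lambda L W) N (Q_plasma (Phi_pm L \<tau>) L W N (N - 1) 2) (Kern D_type L W \<tau> N))"
proof -
  have \<tau>: "\<tau> = \<i> * of_real (W / L)" by (simp only: \<tau>_def)
  show ?thesis
    by (intro conjI impI determinantal_A[OF assms(1,2) \<tau>] determinantal_C[OF assms(1,2) \<tau>] determinantal_D[OF assms(1,2) \<tau>])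
qed

end
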